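(* Let $\mathcal A$ be a finite essential affine arrangement in $\mathbb R^n$ with a fixed system of polar coordinates generic with respect to $\mathcal A$. The polar ordering $\vartriangleleft$ is a total ordering on the facets of $V_i(\bar\theta)$ (the nonempty sets $F(\bar\theta)=F\cap V_i(\bar\theta)$, $F\in\mathcal S$), for any given $\bar\theta=(\bar\theta_i,\dots,\bar\theta_{n-1})$ with $0\le i\le n$, $\bar\theta_j\in[0,\delta]$. In particular (taking $\bar\theta=\emptyset$) it gives a total ordering on $\mathcal S$.
   Context: **Arrangement.** $\mathcal A$ is a finite affine hyperplane arrangement in $V=\mathbb R^n$, essential (minimal nonempty intersections of hyperplanes are points). $L(\mathcal A)$ is the set of nonempty intersections of hyperplanes of $\mathcal A$. $\mathcal S$ is the set of facets of the induced stratification of $\mathbb R^n$ (classes of points having the same position, on or strictly on one of the two sides, with respect to each $H\in\mathcal A$). Chambers are codimension-$0$ facets. **Polar coordinates.** Given an origin $O$ and an orthonormal basis $\mathbf e_1,\dots,\mathbf e_n$, with Cartesian coordinates $x_1,\dots,x_n$, the polar coordinates $\theta_0=\rho\ge 0$, $\theta_1,\dots,\theta_{n-2}\in[0,\pi]$, $\theta_{n-1}\in(-\pi,\pi]$ satisfy $x_i=\rho\sin\theta_1\cdots\sin\theta_{i-1}\cos\theta_i$ for $i<n$, $x_n=\rho\sin\theta_1\cdots\sin\theta_{n-1}$ (with $\theta_i:=0$ if $x_i=\dots=x_n=0$). $V_i=O+\langle\mathbf e_1,\dots,\mathbf e_i\rangle$, $V_0=\{O\}$. $V_i(\bar\theta_i,\dots,\bar\theta_{n-1})$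 is the set of $P\notin V_{i-1}$ with $\theta_j(P)=\bar\theta_j$ for $j\ge i$ (convention: $\bar\theta_j\in\{0,\pi\}$ implies $\bar\theta_k=0$ for $k>j$); it is an $i$-dimensional open half-subspace, with span $|V_i(\bar\theta)|$; $V_n(\emptyset)=\mathbb R^n$, and $V_0(\bar\theta_0,\dots,\bar\theta_{n-1})$ is the single point with those coordinates. For $\delta\in(0,\pi/2)$, $\tilde B(\delta)=\{P:\theta_i(P)\in(0,\delta),\,1\le i\le n-1,\ \rho(P)>0\}$. **Generic.** The system is generic with respect to $\mathcal A$ if (i) $O$ lies in a chamber $C_0$; (ii) for some $\delta\in(0,\pi/2)$ the union of bounded facets is contained in $\tilde B=\tilde B(\delta)$ (therefore every facet meets $\tilde B$); (iii) every $V_i(\bar\theta)$ meeting $\mathrm{clos}(\tilde B)$ satisfies, for each codimension-$k$ $L\in L(\mathcal A)$ with $i\ge k$: $V_i(\bar\theta)\cap L\cap\mathrm{clos}(\tilde B)\ne\emptyset$ and $\dim(|V_i(\bar\theta)|\cap L)=i-k$. Fix such a system and $\delta$. **Polar ordering.** For a facet $F$ and $\bar\theta=(\bar\theta_i,\dots,\bar\theta_{n-1})$, $\bar\theta_j\in[0,\delta]$, put $F(\bar\theta)=F\cap V_i(\bar\theta)$ ($F(\emptyset)=F$ for $i=n$) and, when nonempty, $i_{F(\bar\theta)}=\min\{j\ge0: V_j\cap\mathrm{clos}(F(\bar\theta))\ne\emptyset\}$. The minimum point $P_{F(\bar\theta)}$ is: if $i_{F(\bar\theta)}\ge i>0$,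 the unique vertex of $\mathrm{clos}(F(\bar\theta))$ minimizing $\theta_{i-1}$ on it; if $0<i_{F(\bar\theta)}<i$, the unique point of $\mathrm{clos}(F(\bar\theta))\cap V_{i_{F(\bar\theta)}}$ minimizing $\theta_{i_{F(\bar\theta)}-1}$; if $i_{F(\bar\theta)}=0$, the origin $O$ (only for $F=C_0$); if $i=0$, the point $F(\bar\theta)$ itself. Let $\Theta(F(\bar\theta))=(\theta_0(P),\dots,\theta_{i_{F(\bar\theta)}-1}(P),0,\dots,0)\in\mathbb R^n$, $P=P_{F(\bar\theta)}$. For nonempty $F(\bar\theta),G(\bar\theta)$ define recursively $F(\bar\theta)\vartriangleleft G(\bar\theta)$ iff one of the following holds. (I) $P_{F(\bar\theta)}\ne P_{G(\bar\theta)}$ and $\Theta(F(\bar\theta))<\Theta(G(\bar\theta))$ anti-lexicographically (lexicographically starting from the last coordinate). (IIa) $P_{F(\bar\theta)}=P_{G(\bar\theta)}$, $\dim F(\bar\theta)=0$ and $F(\bar\theta)\ne G(\bar\theta)$. (IIb) $P_{F(\bar\theta)}=P_{G(\bar\theta)}$, both have positive dimension and, with $i_0=i_{F(\bar\theta)}=i_{G(\bar\theta)}$: if $i_0\ge i$, writing $\Theta(F(\bar\theta))=\Theta(G(\bar\theta))=(\tilde\theta_0,\dots,\tilde\theta_{i-1},\bar\theta_i,\dots,\bar\theta_{i_0-1},0,\dots,0)$, one has $F(\tilde\theta_{i-1}+\epsilon,\bar\theta_i,\dots,\bar\theta_{i_0-1},0,\dots,0)\vartriangleleft G(\tilde\theta_{i-1}+\epsilon,\bar\theta_i,\dots,\bar\theta_{i_0-1},0,\dots,0)$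 for all $0<\epsilon\ll\delta$; if $i_0<i$, writing the common vector as $(\tilde\theta_0,\dots,\tilde\theta_{i_0-1},0,\dots,0)$, one has $F(\tilde\theta_{i_0-1}+\epsilon,0,\dots,0)\vartriangleleft G(\tilde\theta_{i_0-1}+\epsilon,0,\dots,0)$ for all $0<\epsilon\ll\delta$.
   Formalization: Rule (IIb) with i_0<i may compare sections F(θ̃+ε,0,…,0), G(θ̃+ε,0,…,0) one of which is empty, where the relation is undefined; the formal definition adds that an empty section precedes every nonempty one. *)

theory Defs
  imports "HOL-Analysis.Analysis"
begin

definition arrangement :: "(real^'n) set set \<Rightarrow> bool" where
  "arrangement A \<longleftrightarrow> finite A \<and> (\<forall>H\<in>A. \<exists>a b. a \<noteq> 0 \<and> H = {x. a \<bullet> x = b})"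

text \<open>As \<open>\<Inter>{} = UNIV\<close>, the whole space is the flat of codimension 0.\<close>

definition flats :: "(real^'n) set set \<Rightarrow> (real^'n) set set" where
  "flats A = {\<Inter>B |B. B \<subseteq> A} - {{}}"

definition same_position :: "(real^'n) set set \<Rightarrow> real^'n \<Rightarrow> real^'n \<Rightarrow> bool" where
  "same_position A x y \<longleftrightarrow>
     (\<forall>H\<in>A. \<forall>a b. a \<noteq> 0 \<and> H = {z. a \<bullet> z = b} \<longrightarrow> sgn (a \<bullet> x - b) = sgn (a \<bullet> y - b))"

definition facets :: "(real^'n) set set \<Rightarrow> (real^'n) set set" where
  "facets A = {{y. same_position A x y} |x. True}"

definition essential :: "(real^'n) set set \<Rightarrow> bool" where
  "essential A \<longleftrightarrow> (\<forall>X\<in>flats A. (\<forall>Y\<in>flats A. Y \<subseteq> X \<longrightarrow> Y = X) \<longrightarrow> (\<exists>x. X = {x}))"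

definition chamber :: "(real^'n) set set \<Rightarrow> (real^'n) set \<Rightarrow> bool" where
  "chamber A C \<longleftrightarrow> C \<in> facets A \<and> aff_dim C = int CARD('n)"

definition orthonormal_frame :: "(nat \<Rightarrow> real^'n) \<Rightarrow> bool" where
  "orthonormal_frame e \<longleftrightarrow>
     (\<forall>i\<in>{1..CARD('n)}. \<forall>j\<in>{1..CARD('n)}. e i \<bullet> e j = (if i = j then 1 else 0))"

text \<open>
  \<open>is_polar p e P t\<close>: the entries \<open>t 0, \<dots>, t (n - 1)\<close> are the polar coordinates of \<open>P\<close> with
  respect to the origin \<open>p\<close> and the basis \<open>e 1, \<dots>, e n\<close>; all further entries are 0.
  If \<open>n = 1\<close> the only equation is \<open>x\<^sub>1 = \<rho>\<close>, so that only the points of a closed half-line have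
  polar coordinates. For this reason the sets below ask explicitly for the existence of \<open>t\<close>.
\<close>

definition is_polar :: "real^'n \<Rightarrow> (nat \<Rightarrow> real^'n) \<Rightarrow> real^'n \<Rightarrow> (nat \<Rightarrow> real) \<Rightarrow> bool" where
  "is_polar p e P t \<longleftrightarrow>
     (let n = CARD('n); x = (\<lambda>i. (P - p) \<bullet> e i) in
        0 \<le> t 0 \<and>
        (\<forall>j. 1 \<le> j \<and> j + 2 \<le> n \<longrightarrow> 0 \<le> t j \<and> t j \<le> pi) \<and>
        (2 \<le> n \<longrightarrow> - pi < t (n - 1) \<and> t (n - 1) \<le> pi) \<and>
        (\<forall>i\<in>{1..<n}. x i = t 0 * (\<Prod>j\<in>{1..<i}. sin (t j)) * cos (t i)) \<and>
        x n = t 0 * (\<Prod>j\<in>{1..<n}. sin (t j)) \<and>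
        (\<forall>i\<in>{1..<n}. (\<forall>k\<in>{i..n}. x k = 0) \<longrightarrow> t i = 0) \<and>
        (\<forall>j\<ge>n. t j = 0))"

definition polar :: "real^'n \<Rightarrow> (nat \<Rightarrow> real^'n) \<Rightarrow> real^'n \<Rightarrow> nat \<Rightarrow> real" where
  "polar p e P = (THE t. is_polar p e P t)"

definition flag :: "real^'n \<Rightarrow> (nat \<Rightarrow> real^'n) \<Rightarrow> nat \<Rightarrow> (real^'n) set" where
  "flag p e i = (\<lambda>v. p + v) ` span (e ` {1..i})"

text \<open>
  \<open>half_flat p e i th\<close> is \<open>V\<^sub>i(th i, \<dots>, th (n - 1))\<close>; the entries \<open>th j\<close> with \<open>j < i\<close> are ignored.
  If \<open>th\<close> violates the convention that an angle in \<open>{0, \<pi>}\<close> is followed by zeros only, the set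
  is empty.
\<close>

definition half_flat ::
    "real^'n \<Rightarrow> (nat \<Rightarrow> real^'n) \<Rightarrow> nat \<Rightarrow> (nat \<Rightarrow> real) \<Rightarrow> (real^'n) set" where
  "half_flat p e i th =
     (if i = CARD('n) then UNIV
      else {P. (0 < i \<longrightarrow> P \<notin> flag p e (i - 1)) \<and>
               (\<exists>t. is_polar p e P t \<and> (\<forall>j\<in>{i..<CARD('n)}. t j = th j))})"

definition sector :: "real^'n \<Rightarrow> (nat \<Rightarrow> real^'n) \<Rightarrow> real \<Rightarrow> (real^'n) set" where
  "sector p e \<delta> =
     {P. \<exists>t. is_polar p e P t \<and> 0 < t 0 \<and> (\<forall>i\<in>{1..<CARD('n)}. 0 < t i \<and> t i < \<delta>)}"

definition generic_polar ::
    "(real^'n) set set \<Rightarrow> real^'n \<Rightarrow> (nat \<Rightarrow> real^'n) \<Rightarrow> real \<Rightarrow> bool" where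
  "generic_polar A p e \<delta> \<longleftrightarrow>
     orthonormal_frame e \<and>
     (\<exists>C. chamber A C \<and> p \<in> C) \<and>
     0 < \<delta> \<and> \<delta> < pi / 2 \<and>
     \<Union>{F \<in> facets A. bounded F} \<subseteq> sector p e \<delta> \<and>
     (\<forall>i\<le>CARD('n). \<forall>th.
        half_flat p e i th \<inter> closure (sector p e \<delta>) \<noteq> {} \<longrightarrow>
        (\<forall>L\<in>flats A. \<forall>k\<le>i. aff_dim L = int CARD('n) - int k \<longrightarrow>
           half_flat p e i th \<inter> L \<inter> closure (sector p e \<delta>) \<noteq> {} \<and>
           aff_dim (affine hull (half_flat p e i th) \<inter> L) = int i - int k))"

definition section_of ::
    "real^'n \<Rightarrow> (nat \<Rightarrow> real^'n) \<Rightarrow> nat \<Rightarrow> (nat \<Rightarrow> real) \<Rightarrow> (real^'n) set \<Rightarrow> (real^'n) set" where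
  "section_of p e i th F = F \<inter> half_flat p e i th"

definition min_index ::
    "real^'n \<Rightarrow> (nat \<Rightarrow> real^'n) \<Rightarrow> nat \<Rightarrow> (nat \<Rightarrow> real) \<Rightarrow> (real^'n) set \<Rightarrow> nat" where
  "min_index p e i th F = (LEAST j. flag p e j \<inter> closure (section_of p e i th F) \<noteq> {})"

definition min_point ::
    "real^'n \<Rightarrow> (nat \<Rightarrow> real^'n) \<Rightarrow> nat \<Rightarrow> (nat \<Rightarrow> real) \<Rightarrow> (real^'n) set \<Rightarrow> real^'n" where
  "min_point p e i th F =
     (let K = closure (section_of p e i th F); m = min_index p e i th F in
        if i = 0 then (THE P. section_of p e i th F = {P})
        else if m = 0 then p
        else if i \<le> m then
          (THE P. P extreme_point_of K \<and> (\<forall>Q\<in>K. polar p e P (i - 1) \<le> polar p e Q (i - 1)))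
        else
          (THE P. P \<in> K \<inter> flag p e m \<and>
             (\<forall>Q\<in>K \<inter> flag p e m. polar p e P (m - 1) \<le> polar p e Q (m - 1))))"

definition min_coords ::
    "real^'n \<Rightarrow> (nat \<Rightarrow> real^'n) \<Rightarrow> nat \<Rightarrow> (nat \<Rightarrow> real) \<Rightarrow> (real^'n) set \<Rightarrow> nat \<Rightarrow> real" where
  "min_coords p e i th F =
     (\<lambda>j. if j < min_index p e i th F then polar p e (min_point p e i th F) j else 0)"

definition antilex_less :: "nat \<Rightarrow> (nat \<Rightarrow> real) \<Rightarrow> (nat \<Rightarrow> real) \<Rightarrow> bool" where
  "antilex_less n x y \<longleftrightarrow> (\<exists>k<n. x k < y k \<and> (\<forall>j. k < j \<and> j < n \<longrightarrow> x j = y j))"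

text \<open>
  The comparison of the sections of \<open>F\<close> and \<open>G\<close> by \<open>V\<^sub>i(th)\<close>. In the last two disjuncts the
  common vector \<open>\<Theta>\<close> of the two sections is increased by \<open>\<epsilon>\<close> in one entry (\<open>i - 1\<close> or
  \<open>m - 1\<close>) and the entries from there on are the angles of the smaller section.

  If \<open>m < i\<close>, the section of \<open>F\<close> by \<open>V\<^sub>m\<close> may consist of the minimum point alone, even though
  \<open>F\<close> has a section of positive dimension by \<open>V\<^sub>i(th)\<close>. Then the smaller sections of \<open>F\<close> are
  empty. By convention an empty section precedes the nonempty ones, which agrees with the
  rule that a point precedes the other sections having that minimum point.
\<close>

context
  notes conj_cong [fundef_cong]
begin

function polar_less ::
    "real^'n \<Rightarrow> (nat \<Rightarrow> real^'n) \<Rightarrow> nat \<Rightarrow> (nat \<Rightarrow> real) \<Rightarrow> (real^'n) set \<Rightarrow> (real^'n) set \<Rightarrow> bool" where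
  "polar_less p e i th F G \<longleftrightarrow>
     (let F' = section_of p e i th F; G' = section_of p e i th G;
          PF = min_point p e i th F; PG = min_point p e i th G;
          \<Theta>F = min_coords p e i th F; \<Theta>G = min_coords p e i th G;
          m = min_index p e i th F
      in G' \<noteq> {} \<and>
        (F' = {} \<or>
         PF \<noteq> PG \<and> antilex_less CARD('n) \<Theta>F \<Theta>G \<or>
         PF = PG \<and> aff_dim F' = 0 \<and> F' \<noteq> G' \<or>
         PF = PG \<and> 0 < aff_dim F' \<and> 0 < aff_dim G' \<and> 0 < i \<and> i \<le> m \<and>
           (\<forall>\<^sub>F \<epsilon> in at_right 0. polar_less p e (i - 1) (\<Theta>F(i - 1 := \<Theta>F (i - 1) + \<epsilon>)) F G) \<or>
         PF = PG \<and> 0 < aff_dim F' \<and> 0 < aff_dim G' \<and> 0 < m \<and> m < i \<and>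
           (\<forall>\<^sub>F \<epsilon> in at_right 0. polar_less p e (m - 1) (\<Theta>F(m - 1 := \<Theta>F (m - 1) + \<epsilon>)) F G)))"
  by pat_completeness auto
termination
  by (relation "Wellfounded.measure (\<lambda>(p, e, i, th, F, G). i)") auto

end

declare polar_less.simps [simp del]

definition section_facets ::
    "(real^'n) set set \<Rightarrow> real^'n \<Rightarrow> (nat \<Rightarrow> real^'n) \<Rightarrow> nat \<Rightarrow> (nat \<Rightarrow> real) \<Rightarrow>
     (real^'n) set set" where
  "section_facets A p e i th = section_of p e i th ` facets A - {{}}"

definition polar_order ::
    "(real^'n) set set \<Rightarrow> real^'n \<Rightarrow> (nat \<Rightarrow> real^'n) \<Rightarrow> nat \<Rightarrow> (nat \<Rightarrow> real) \<Rightarrow>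
     (real^'n) set rel" where
  "polar_order A p e i th =
     {(section_of p e i th F, section_of p e i th G) |F G.
        F \<in> facets A \<and> G \<in> facets A \<and>
        section_of p e i th F \<noteq> {} \<and> section_of p e i th G \<noteq> {} \<and> polar_less p e i th F G}"

end

theory Submission
  imports Defs
begin

text \<open>
  In homogeneous coordinates, let \<open>V\<^sub>i(\<theta>)\<close> be given by a direction \<open>u\<close> in the span of the basis vectors
  \<open>i, \<dots>, n\<close>. By genericity each flat of codimension \<open>i\<close> meets \<open>V\<^sub>i(u)\<close> in one point, and up to scaling
  this point is a linear function of \<open>u\<close>. A simplex-type argument shows that the minimum point of a
  section exists, is unique and is such a vertex. Consequently the relation \<open>F \<lhd> G\<close> in \<open>V\<^sub>i(u)\<close> is
  determined by the signs of finitely many linear forms at \<open>u\<close> (induction on \<open>i\<close>; nonemptiness of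
  sections is dealt with by Fourier-Motzkin elimination). Increasing an angle by \<open>\<epsilon>\<close> moves the
  direction along a line, on which all these signs are eventually constant. Hence either
  \<open>F \<lhd> G\<close> for all small \<open>\<epsilon>\<close> or for no small \<open>\<epsilon>\<close>, and totality and transitivity pass from the
  smaller sections to the larger one. Totality also uses that of two facets with the same minimum
  point at least one has nonempty smaller sections.
\<close>

section \<open>Polar coordinates in homogeneous coordinates\<close>

text \<open>Genericity speaks only about half-flats that meet the closed sector, but the recursion
  increases angles that may already equal \<delta>. What the proof keeps of it is a property that is
  open in the direction: for every flat of codimension i, the vector \<open>flat_proj B i u\<close>
  has positive first coordinate, and so it does for all directions reached by descending to lower
  dimensions through such vertices.

  Sections may be unbounded, so compactness cannot supply minimum points. The directions with all
  angles zero take its place: moving along them inside a flat decreases the relevant angle, and the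
  motion must be stopped by a further hyperplane if the closed facet misses the next smaller
  subspace.

  Requiring a comparison for all small \<epsilon> could destroy totality, if two facets changed
  places infinitely often as \<epsilon> tends to 0. Finitely many linear forms on a line exclude
  this.\<close>

locale polar_frame =
  fixes p :: "real^'n" and e :: "nat \<Rightarrow> real^'n"
  assumes frame: "orthonormal_frame e"
begin

text \<open>Points of \<open>\<real>\<^sup>n\<close> are lifted to homogeneous coordinates by \<open>hom\<close>, and \<open>eh 0\<close> spans the
  additional axis. In this way \<open>V\<^sub>i\<close> is the affine part of the linear space \<open>Vh (Suc i)\<close>, the radius becomes
  one more angle, and \<open>V\<^sub>i(\<theta>)\<close> is the set \<open>cone i u\<close> for a direction \<open>u \<in> Dh i\<close>, also for \<open>i = 0\<close>.\<close>

definition eh :: "nat \<Rightarrow> real \<times> (real^'n)" where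
  "eh j = (if j = 0 then (1, 0) else (0, e j))"

definition Vh :: "nat \<Rightarrow> (real \<times> (real^'n)) set" where
  "Vh i = {z. \<forall>j. i \<le> j \<and> j \<le> CARD('n) \<longrightarrow> z \<bullet> eh j = 0}"

definition Dh :: "nat \<Rightarrow> (real \<times> (real^'n)) set" where
  "Dh i = {z. \<forall>j<i. z \<bullet> eh j = 0}"

definition hom :: "real^'n \<Rightarrow> real \<times> (real^'n)" where
  "hom q = (1, q - p)"

definition pnt :: "real \<times> (real^'n) \<Rightarrow> real^'n" where
  "pnt x = p + snd x /\<^sub>R fst x"

text \<open>On \<open>lpos\<close> and for \<open>1 \<le> i \<le> n\<close> this is the product
  \<rho> sin \<theta>_1 ... sin \<theta>_(i-1), up to the scale of \<open>x\<close>.\<close>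

definition tail :: "nat \<Rightarrow> real \<times> (real^'n) \<Rightarrow> real" where
  "tail i x = sqrt (\<Sum>j=i..CARD('n). (x \<bullet> eh j)\<^sup>2)"

text \<open>Membership in \<open>lpos\<close> (the last nonzero coordinate is positive) says that no angle equals \<open>\<pi>\<close>
  and that the last angle is not negative; \<open>ang\<close> is only meaningful on such vectors.\<close>

definition lpos :: "(real \<times> (real^'n)) set" where
  "lpos = {x. \<exists>k\<le>CARD('n). 0 < x \<bullet> eh k \<and> x \<in> Vh (Suc k)}"

text \<open>The arc cotangent of x_j over the tail behind it, hence decreasing in x_j and unaffected
  by positive scaling; entry 0 is the radius of \<open>pnt x\<close>. A vanishing tail gives 0,
  which for x_j > 0 is the true angle and for x_j = 0 the convention.\<close>

definition ang :: "real \<times> (real^'n) \<Rightarrow> nat \<Rightarrow> real" where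
  "ang x j = (if CARD('n) \<le> j \<or> tail (Suc j) x = 0 then 0
     else if j = 0 then tail 1 x / fst x
     else pi / 2 - arctan (x \<bullet> eh j / tail (Suc j) x))"

text \<open>For \<open>i = n\<close> and a positive multiple \<open>u\<close> of \<open>eh n\<close>
  this is only an open half-space and not V_n, so the top dimension is treated apart.\<close>

definition cone :: "nat \<Rightarrow> real \<times> (real^'n) \<Rightarrow> (real^'n) set" where
  "cone i u = {q. \<exists>s>0. hom q - s *\<^sub>R u \<in> Vh i}"

section \<open>Orthonormal homogeneous coordinates and the linear flag\<close>

lemma eh_0: "x \<bullet> eh 0 = fst x"
  by (simp add: eh_def inner_prod_def)

lemma eh_pos: "0 < j \<Longrightarrow> x \<bullet> eh j = snd x \<bullet> e j"
  by (simp add: eh_def inner_prod_def)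

lemma eh_orthonormal:
  "i \<le> CARD('n) \<Longrightarrow> j \<le> CARD('n) \<Longrightarrow> eh i \<bullet> eh j = (if i = j then 1 else 0)"
  using frame by (auto simp: eh_def orthonormal_frame_def inner_prod_def)

lemma frame_complete:
  assumes "\<And>j. j \<in> {1..CARD('n)} \<Longrightarrow> v \<bullet> e j = 0"
  shows "v = 0"
proof -
  let ?n = "CARD('n)" and ?S = "e ` {1..CARD('n)}"
  have inj: "inj_on e {1..?n}"
    using frame by (intro inj_onI) (metis orthonormal_frame_def zero_neq_one)
  have ind: "independent ?S"
  proof (rule pairwise_orthogonal_independent)
    show "pairwise orthogonal ?S"
      using frame by (auto simp: pairwise_def orthogonal_def orthonormal_frame_def)
    show "0 \<notin> ?S"
      using frame by (force simp: orthonormal_frame_def)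
  qed
  have "UNIV \<subseteq> span ?S"
    using ind inj by (intro card_ge_dim_independent) (auto simp: card_image)
  moreover have "orthogonal v w" if "w \<in> span ?S" for w
    by (rule orthogonal_to_span[OF that]) (use assms in \<open>auto simp: orthogonal_def\<close>)
  ultimately have "orthogonal v v" by auto
  then show ?thesis by (simp add: orthogonal_self)
qed

lemma eh_complete:
  assumes "\<And>j. j \<le> CARD('n) \<Longrightarrow> z \<bullet> eh j = 0"
  shows "z = 0"
proof -
  have "fst z = 0" using assms[of 0] by (simp add: eh_0)
  moreover have "snd z = 0"
    using assms by (intro frame_complete) (metis atLeastAtMost_iff eh_pos less_le_trans zero_less_one)
  ultimately show ?thesis by (simp add: prod_eq_iff)
qed

lemma eh_eqI:
  assumes "\<And>j. j \<le> CARD('n) \<Longrightarrow> y \<bullet> eh j = z \<bullet> eh j"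
  shows "y = z"
  using eh_complete[of "y - z"] assms by (simp add: inner_diff_left)

lemma eh_coords: "\<exists>h. \<forall>j\<le>CARD('n). h \<bullet> eh j = c j"
proof (intro exI allI impI)
  fix k assume k: "k \<le> CARD('n)"
  have "(\<Sum>j\<le>CARD('n). c j *\<^sub>R eh j) \<bullet> eh k = (\<Sum>j\<le>CARD('n). if j = k then c k else 0)"
    unfolding inner_sum_left by (rule sum.cong) (auto simp: eh_orthonormal k)
  then show "(\<Sum>j\<le>CARD('n). c j *\<^sub>R eh j) \<bullet> eh k = c k" using k by simp
qed

lemma Vh_0: "Vh 0 = {0}"
  using eh_complete by (auto simp: Vh_def)

lemma Vh_top: "CARD('n) < i \<Longrightarrow> Vh i = UNIV"
  by (auto simp: Vh_def)

lemma subspace_Vh: "subspace (Vh i)"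
  by (auto simp: subspace_def Vh_def inner_add_left)

lemma Vh_mono: "i \<le> j \<Longrightarrow> Vh i \<subseteq> Vh j"
  by (auto simp: Vh_def)

lemma Vh_inner: "z \<in> Vh i \<Longrightarrow> i \<le> j \<Longrightarrow> j \<le> CARD('n) \<Longrightarrow> z \<bullet> eh j = 0"
  by (auto simp: Vh_def)

lemmas Vh_add = subspace_add[OF subspace_Vh]
  and Vh_diff = subspace_diff[OF subspace_Vh]
  and Vh_scale = subspace_scale[OF subspace_Vh]
  and Vh_zero = subspace_0[OF subspace_Vh]

lemma Vh_SucD: "z \<in> Vh (Suc i) \<Longrightarrow> z \<bullet> eh i = 0 \<Longrightarrow> z \<in> Vh i"
  unfolding Vh_def mem_Collect_eq using Suc_leI le_neq_implies_less by blast

lemma eh_in_Vh: "i < k \<Longrightarrow> i \<le> CARD('n) \<Longrightarrow> eh i \<in> Vh k"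
  by (auto simp: Vh_def eh_orthonormal)

lemma dim_Vh:
  assumes "i \<le> Suc CARD('n)"
  shows "dim (Vh i) = i"
proof -
  have le: "j \<le> CARD('n)" if "j < i" for j using that assms by simp
  have inj: "inj_on eh {..<i}"
    by (intro inj_onI) (metis eh_orthonormal le lessThan_iff zero_neq_one)
  have ind: "independent (eh ` {..<i})"
  proof (rule pairwise_orthogonal_independent)
    show "pairwise orthogonal (eh ` {..<i})"
      by (auto simp: pairwise_def orthogonal_def eh_orthonormal le)
    show "0 \<notin> eh ` {..<i}"
      by (auto simp: image_iff) (metis eh_orthonormal inner_zero_left le zero_neq_one)
  qed
  have "Vh i \<subseteq> span (eh ` {..<i})"
  proof
    fix z assume z: "z \<in> Vh i"
    have "z = (\<Sum>j<i. (z \<bullet> eh j) *\<^sub>R eh j)"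
    proof (rule eh_eqI)
      fix k assume k: "k \<le> CARD('n)"
      have "(\<Sum>j<i. (z \<bullet> eh j) *\<^sub>R eh j) \<bullet> eh k = (\<Sum>j<i. if j = k then z \<bullet> eh k else 0)"
        unfolding inner_sum_left by (rule sum.cong) (auto simp: eh_orthonormal le k)
      also have "\<dots> = z \<bullet> eh k"
        using Vh_inner[OF z, of k] k by auto
      finally show "z \<bullet> eh k = (\<Sum>j<i. (z \<bullet> eh j) *\<^sub>R eh j) \<bullet> eh k" by simp
    qed
    then show "z \<in> span (eh ` {..<i})"
      by (metis (no_types, lifting) span_sum span_scale span_base imageI)
  qed
  moreover have "eh ` {..<i} \<subseteq> Vh i"
    using eh_in_Vh le by auto
  ultimately show ?thesis
    using dim_unique[OF _ _ ind] inj by (simp add: card_image)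
qed

lemma fst_hom [simp]: "fst (hom q) = 1" and snd_hom [simp]: "snd (hom q) = q - p"
  by (auto simp: hom_def)

lemma pnt_hom [simp]: "pnt (hom q) = q"
  by (simp add: pnt_def)

lemma hom_pnt: "fst x \<noteq> 0 \<Longrightarrow> hom (pnt x) = x /\<^sub>R fst x"
  by (simp add: prod_eq_iff hom_def pnt_def)

lemma hom_eq_iff [simp]: "hom q = hom r \<longleftrightarrow> q = r"
  by (simp add: hom_def)

lemma pnt_scale: "c \<noteq> 0 \<Longrightarrow> pnt (c *\<^sub>R x) = pnt x"
  by (simp add: pnt_def)

lemma flag_eq: "flag p e i = {q. hom q \<in> Vh (Suc i)}"
proof -
  have "span (e ` {1..i}) = {v. \<forall>j. Suc i \<le> j \<and> j \<le> CARD('n) \<longrightarrow> v \<bullet> e j = 0}"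
    (is "_ = ?R")
  proof
    have "subspace ?R" by (auto simp: subspace_def inner_add_left)
    moreover have "e ` {1..i} \<subseteq> ?R"
      using frame by (auto simp: orthonormal_frame_def)
    ultimately show "span (e ` {1..i}) \<subseteq> ?R"
      by (simp add: span_minimal)
    show "?R \<subseteq> span (e ` {1..i})"
    proof
      fix v assume v: "v \<in> ?R"
      let ?w = "\<Sum>j\<in>{1..i} \<inter> {1..CARD('n)}. (v \<bullet> e j) *\<^sub>R e j"
      have "v - ?w = 0"
      proof (rule frame_complete)
        fix k assume k: "k \<in> {1..CARD('n)}"
        have "?w \<bullet> e k = (\<Sum>j\<in>{1..i} \<inter> {1..CARD('n)}. if j = k then v \<bullet> e k else 0)"
          unfolding inner_sum_left using frame k
          by (intro sum.cong) (auto simp: orthonormal_frame_def)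
        also have "\<dots> = v \<bullet> e k"
          using v k by auto
        finally show "(v - ?w) \<bullet> e k = 0" by (simp add: inner_diff_left)
      qed
      moreover have "?w \<in> span (e ` {1..i})"
        by (intro span_sum span_scale span_base) auto
      ultimately show "v \<in> span (e ` {1..i})" by simp
    qed
  qed
  then have "q \<in> flag p e i \<longleftrightarrow> hom q \<in> Vh (Suc i)" for q
    unfolding flag_def Vh_def
    by (force simp: image_iff eh_pos hom_def algebra_simps intro: exI[of _ "q - p"])
  then show ?thesis by blast
qed

lemma flag_mono: "i \<le> j \<Longrightarrow> flag p e i \<subseteq> flag p e j"
  using Vh_mono[of "Suc i" "Suc j"] by (auto simp: flag_eq)

lemma flag_0: "flag p e 0 = {p}"
  by (auto simp: flag_def)

lemma flag_top: "flag p e CARD('n) = UNIV"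
  by (simp add: flag_eq Vh_top)

lemma Dh_mono: "i \<le> j \<Longrightarrow> Dh j \<subseteq> Dh i"
  by (auto simp: Dh_def)

lemma Dh_inner: "z \<in> Dh i \<Longrightarrow> j < i \<Longrightarrow> z \<bullet> eh j = 0"
  by (auto simp: Dh_def)

lemma subspace_Dh: "subspace (Dh i)"
  by (auto simp: subspace_def Dh_def inner_add_left)

lemma eh_in_Dh: "i \<le> j \<Longrightarrow> j \<le> CARD('n) \<Longrightarrow> eh j \<in> Dh i"
  by (auto simp: Dh_def eh_orthonormal)

lemma Dh_Int_Vh: "z \<in> Dh i \<Longrightarrow> z \<in> Vh i \<Longrightarrow> z = 0"
  by (rule eh_complete) (metis Dh_inner Vh_inner linorder_not_less)

section \<open>Tails, last nonzero coordinates and angles\<close>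

lemma tail_nonneg: "0 \<le> tail i x"
  by (simp add: tail_def sum_nonneg)

lemma tail_power2: "(tail i x)\<^sup>2 = (\<Sum>j=i..CARD('n). (x \<bullet> eh j)\<^sup>2)"
  by (simp add: tail_def sum_nonneg)

lemma tail_Suc: "i \<le> CARD('n) \<Longrightarrow> (tail i x)\<^sup>2 = (x \<bullet> eh i)\<^sup>2 + (tail (Suc i) x)\<^sup>2"
  unfolding tail_power2 by (simp add: sum.atLeast_Suc_atMost)

lemma tail_eq_0: "tail i x = 0 \<longleftrightarrow> x \<in> Vh i"
  by (auto simp: tail_def Vh_def sum_nonneg_eq_0_iff)

lemma tail_cong: "(\<And>j. i \<le> j \<Longrightarrow> j \<le> CARD('n) \<Longrightarrow> x \<bullet> eh j = y \<bullet> eh j) \<Longrightarrow> tail i x = tail i y"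
  unfolding tail_def by (intro arg_cong[where f=sqrt] sum.cong) auto

lemma tail_Vh: "x - y \<in> Vh i \<Longrightarrow> tail i x = tail i y"
  using Vh_inner[of "x - y" i] by (intro tail_cong) (simp add: inner_diff_left)

lemma tail_scale: "tail i (c *\<^sub>R x) = \<bar>c\<bar> * tail i x"
  by (simp add: tail_def power_mult_distrib sum_distrib_left[symmetric] real_sqrt_mult)

lemma tail_triangle: "tail i (x + y) \<le> tail i x + tail i y"
proof -
  have *: "tail i x = L2_set (\<lambda>j. x \<bullet> eh j) {i..CARD('n)}" for x
    by (simp add: tail_def L2_set_def)
  show ?thesis
    unfolding * inner_add_left by (rule L2_set_triangle_ineq)
qed

lemma abs_coord_le_tail: "i \<le> j \<Longrightarrow> j \<le> CARD('n) \<Longrightarrow> \<bar>x \<bullet> eh j\<bar> \<le> tail i x"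
  unfolding tail_def by (intro real_le_rsqrt, simp, intro member_le_sum) auto

lemma lpos_Suc_0:
  assumes "x \<in> lpos" "i \<le> CARD('n)" "x \<in> Vh (Suc i)"
  shows "0 \<le> x \<bullet> eh i"
proof -
  obtain k where k: "k \<le> CARD('n)" "0 < x \<bullet> eh k" "x \<in> Vh (Suc k)"
    using assms by (auto simp: lpos_def)
  show ?thesis
  proof (cases "i \<le> k")
    case True
    then have "i = k" using assms(3) k Vh_inner[of x "Suc i" k] by fastforce
    then show ?thesis using k by simp
  next
    case False
    then show ?thesis using Vh_inner[OF k(3), of i] assms by simp
  qed
qed

lemma lpos_top: "x \<in> lpos \<Longrightarrow> 0 \<le> x \<bullet> eh CARD('n)"
  by (rule lpos_Suc_0) (auto simp: Vh_top)

lemma lpos_nonzero: "x \<in> lpos \<Longrightarrow> x \<noteq> 0"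
  by (auto simp: lpos_def)

text \<open>The last nonzero coordinate of \<open>u\<close> has index at least \<open>i\<close>, and
  from \<open>i\<close> on \<open>x\<close> is a positive multiple of \<open>u\<close>.\<close>

lemma lpos_Vh:
  assumes "u \<in> lpos" "u \<in> Dh i" "x - s *\<^sub>R u \<in> Vh i" "0 < s"
  shows "x \<in> lpos"
proof -
  obtain k where k: "k \<le> CARD('n)" "0 < u \<bullet> eh k" "u \<in> Vh (Suc k)"
    using assms by (auto simp: lpos_def)
  have ik: "i \<le> k" using Dh_inner[OF assms(2), of k] k by (metis less_irrefl linorder_not_less)
  have *: "x \<bullet> eh j = s * (u \<bullet> eh j)" if "i \<le> j" "j \<le> CARD('n)" for j
    using Vh_inner[OF assms(3) that] by (simp add: inner_diff_left)
  have "0 < x \<bullet> eh k" using * ik k assms(4) by simp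
  moreover have "x \<in> Vh (Suc k)"
    unfolding Vh_def using * ik Vh_inner[OF k(3)] by auto
  ultimately show ?thesis using k by (auto simp: lpos_def)
qed

lemma ang_nonneg:
  assumes "0 < fst x"
  shows "0 \<le> ang x j"
  using assms arctan_ubound[of "x \<bullet> eh j / tail (Suc j) x"] tail_nonneg[of 1 x]
  by (auto simp: ang_def)

lemma ang_pos:
  assumes "0 < fst x" "j < CARD('n)" "x \<notin> Vh (Suc j)"
  shows "0 < ang x j"
  using assms arctan_ubound[of "x \<bullet> eh j / tail (Suc j) x"] tail_nonneg[of 1 x]
  by (auto simp: ang_def tail_eq_0 order_le_less)

lemma ang_Vh: "x \<in> Vh (Suc j) \<Longrightarrow> ang x j = 0"
  by (simp add: ang_def tail_eq_0)

lemma ang_le_pi: "0 < j \<Longrightarrow> 0 \<le> ang x j \<and> ang x j \<le> pi"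
  using arctan_bounded[of "x \<bullet> eh j / tail (Suc j) x"] by (auto simp: ang_def)

lemma ang_lt_pi: "0 < j \<Longrightarrow> ang x j < pi"
  using arctan_bounded[of "x \<bullet> eh j / tail (Suc j) x"] by (auto simp: ang_def)

lemma ang_scale: "0 < c \<Longrightarrow> ang (c *\<^sub>R x) j = ang x j"
  by (auto simp: ang_def tail_scale)

lemma ang_cong:
  assumes "x - y \<in> Vh j"
  shows "ang x j = ang y j"
proof -
  have t: "tail (Suc j) x = tail (Suc j) y" "tail 1 x = tail 1 y" if "j = 0"
    using assms that Vh_mono[of j 1] by (auto intro!: tail_Vh)
  have t': "tail (Suc j) x = tail (Suc j) y"
    using assms Vh_mono[of j "Suc j"] by (auto intro!: tail_Vh)
  show ?thesis
  proof (cases "CARD('n) \<le> j")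
    case False
    then have "x \<bullet> eh j = y \<bullet> eh j"
      using Vh_inner[OF assms, of j] by (simp add: inner_diff_left)
    then show ?thesis using t t' by (auto simp: ang_def eh_0)
  qed (simp add: ang_def)
qed

lemma ang_cong_scale:
  assumes "x - s *\<^sub>R u \<in> Vh i" "0 < s" "i \<le> j"
  shows "ang x j = ang u j"
  using ang_cong[of x "s *\<^sub>R u" j] Vh_mono[OF assms(3)] assms ang_scale[of s u j] by auto

text \<open>A right triangle with legs x_j and \<open>tail (Suc j) x\<close> and hypotenuse
  \<open>tail j x\<close>. Membership in \<open>lpos\<close> settles the degenerate triangle: if the
  second leg vanishes, the first is nonnegative, in agreement with angle 0.\<close>

lemma tail_mult_cos:
  assumes "x \<in> lpos" "1 \<le> j" "j < CARD('n)"
  shows "tail j x * cos (ang x j) = x \<bullet> eh j" (is ?A)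
    and "tail j x * sin (ang x j) = tail (Suc j) x" (is ?B)
proof -
  let ?T = "tail (Suc j) x" and ?a = "x \<bullet> eh j"
  have sq: "(tail j x)\<^sup>2 = ?a\<^sup>2 + ?T\<^sup>2" using tail_Suc assms by simp
  have "?A \<and> ?B"
  proof (cases "?T = 0")
    case True
    then have "0 \<le> ?a" using lpos_Suc_0[of x j] assms by (simp add: tail_eq_0)
    then have "tail j x = ?a" using sq True tail_nonneg[of j x] by (simp add: power2_eq_iff_nonneg)
    then show ?thesis using True by (simp add: ang_def)
  next
    case False
    then have T: "0 < ?T" using tail_nonneg[of "Suc j" x] by simp
    have tj: "tail j x = ?T * sqrt (1 + (?a / ?T)\<^sup>2)"
    proof -
      have "?T\<^sup>2 * (1 + (?a / ?T)\<^sup>2) = (tail j x)\<^sup>2"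
        using sq T by (simp add: distrib_left power_divide)
      then have "tail j x = sqrt (?T\<^sup>2 * (1 + (?a / ?T)\<^sup>2))"
        using tail_nonneg[of j x] by simp
      then show ?thesis using T by (simp add: real_sqrt_mult)
    qed
    have s: "sqrt (1 + (?a / ?T)\<^sup>2) \<noteq> 0"
      by (metis add_nonneg_eq_0_iff real_sqrt_eq_zero_cancel_iff zero_le_one zero_le_power2 zero_neq_one)
    have *: "ang x j = pi / 2 - arctan (?a / ?T)" using assms False by (simp add: ang_def)
    show ?thesis
      unfolding * cos_diff sin_diff tj using s T
      by (simp add: sin_arctan cos_arctan)
  qed
  then show ?A ?B by auto
qed

lemma tail_eq_prod:
  assumes "x \<in> lpos" "1 \<le> j" "j \<le> CARD('n)"
  shows "tail j x = tail 1 x * (\<Prod>l\<in>{1..<j}. sin (ang x l))"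
  using assms(2,3)
proof (induction j rule: dec_induct)
  case (step k)
  then show ?case
    using tail_mult_cos(2)[OF assms(1), of k] by (simp add: prod.atLeastLessThan_Suc)
qed simp

section \<open>Existence and uniqueness of polar coordinates\<close>

lemma tail_top: "x \<in> lpos \<Longrightarrow> tail CARD('n) x = x \<bullet> eh CARD('n)"
  using lpos_top[of x] by (simp add: tail_def)

lemma is_polar_ang:
  assumes "hom q \<in> lpos"
  shows "is_polar p e q (ang (hom q))"
proof -
  let ?x = "hom q" and ?n = "CARD('n)"
  have x: "(q - p) \<bullet> e i = ?x \<bullet> eh i" if "1 \<le> i" for i using that by (simp add: eh_pos)
  have t0: "ang ?x 0 = tail 1 ?x"
    by (simp add: ang_def)
  have 1: "(q - p) \<bullet> e i = ang ?x 0 * (\<Prod>j\<in>{1..<i}. sin (ang ?x j)) * cos (ang ?x i)"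
    if "i \<in> {1..<?n}" for i
  proof -
    from that have i: "1 \<le> i" "i < ?n" by auto
    show ?thesis
      unfolding x[OF i(1)] t0 tail_eq_prod[OF assms(1) i(1) less_imp_le[OF i(2)], symmetric]
      by (rule tail_mult_cos(1)[OF assms(1) i, symmetric])
  qed
  have 2: "(q - p) \<bullet> e ?n = ang ?x 0 * (\<Prod>j\<in>{1..<?n}. sin (ang ?x j))"
    unfolding x[OF Suc_leI[OF zero_less_card_finite, folded One_nat_def]] t0
    using tail_top[OF assms(1)]
      tail_eq_prod[OF assms(1) Suc_leI[OF zero_less_card_finite, folded One_nat_def] order_refl]
        by metis
  have 3: "ang ?x i = 0" if i: "i \<in> {1..<?n}" and 0: "\<forall>k\<in>{i..?n}. (q - p) \<bullet> e k = 0" for i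
  proof (rule ang_Vh)
    show "?x \<in> Vh (Suc i)"
      unfolding Vh_def using i 0 by (auto simp: eh_pos)
  qed
  show ?thesis
    unfolding is_polar_def Let_def
  proof (intro conjI)
    show "2 \<le> ?n \<longrightarrow> - pi < ang ?x (?n - 1) \<and> ang ?x (?n - 1) \<le> pi"
      using less_le_trans[OF _ ang_nonneg[of ?x "?n - 1"], of "- pi"] ang_le_pi[of "?n - 1" ?x]
      by simp
    show "\<forall>i\<in>{1..<?n}. (\<forall>k\<in>{i..?n}. (q - p) \<bullet> e k = 0) \<longrightarrow> ang ?x i = 0"
      using 3 by blast
    show "\<forall>i\<in>{1..<?n}. (q - p) \<bullet> e i = ang ?x 0 * (\<Prod>j\<in>{1..<i}. sin (ang ?x j)) * cos (ang ?x i)"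
      using 1 by blast
    show "(q - p) \<bullet> e ?n = ang ?x 0 * (\<Prod>j\<in>{1..<?n}. sin (ang ?x j))"
      by (rule 2)
    show "\<forall>j. 1 \<le> j \<and> j + 2 \<le> ?n \<longrightarrow> 0 \<le> ang ?x j \<and> ang ?x j \<le> pi"
      using ang_le_pi by simp
    show "0 \<le> ang ?x 0" by (simp add: ang_nonneg)
    show "\<forall>j\<ge>?n. ang ?x j = 0" by (simp add: ang_def)
  qed
qed

text \<open>The products \<open>R j\<close> equal the tails, so sine and cosine of each angle are
  determined wherever the tail is nonzero, and the ranges exclude a difference of 2 pi. The last
  angle ranges over (-pi, pi], so \<open>R n\<close> could be negative; \<open>lpos\<close> fixes
  its sign.\<close>

lemma is_polar_unique:
  assumes "hom q \<in> lpos" and t: "is_polar p e q t"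
  shows "t = ang (hom q)"
proof -
  let ?n = "CARD('n)" and ?x = "hom q"
  define R where "R j = t 0 * (\<Prod>l\<in>{1..<j}. sin (t l))" for j
  have n1: "1 \<le> ?n" by (simp add: Suc_leI)
  have t0: "0 \<le> t 0" and ge: "t j = 0" if "?n \<le> j" for j
    using t that by (auto simp: is_polar_def Let_def)
  have rng: "0 \<le> t j \<and> t j \<le> pi" if "1 \<le> j" "j + 2 \<le> ?n" for j
    using t that by (auto simp: is_polar_def Let_def)
  have rng': "- pi < t j \<and> t j \<le> pi" if "1 \<le> j" "j < ?n" for j
  proof (cases "j + 2 \<le> ?n")
    case True
    then show ?thesis using rng[of j] that pi_gt_zero by linarith
  next
    case False
    then have "j = ?n - 1" "2 \<le> ?n" using that by auto
    then show ?thesis using t by (auto simp: is_polar_def Let_def)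
  qed
  have xc: "?x \<bullet> eh j = R j * cos (t j)" if "1 \<le> j" "j < ?n" for j
    using t that by (auto simp: is_polar_def Let_def R_def eh_pos)
  have xn: "?x \<bullet> eh ?n = R ?n"
    using t n1 by (auto simp: is_polar_def Let_def R_def eh_pos)
  have zero: "t j = 0" if "1 \<le> j" "j < ?n" "?x \<in> Vh j" for j
  proof -
    have "(q - p) \<bullet> e k = 0" if "k \<in> {j..?n}" for k
      using Vh_inner[OF \<open>?x \<in> Vh j\<close>, of k] that \<open>1 \<le> j\<close> by (simp add: eh_pos)
    then show ?thesis using t that by (auto simp: is_polar_def Let_def)
  qed
  have RS: "R (Suc j) = R j * sin (t j)" if "1 \<le> j" for j
    using that by (simp add: R_def prod.atLeastLessThan_Suc)
  have sq: "(tail j ?x)\<^sup>2 = (R j)\<^sup>2" if "1 \<le> j" "j \<le> ?n" for j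
    using that(2,1)
  proof (induction j rule: inc_induct)
    case base
    then show ?case using tail_top[OF assms(1)] xn by simp
  next
    case (step j)
    have "(tail j ?x)\<^sup>2 = (R j)\<^sup>2 * (cos (t j))\<^sup>2 + (R j)\<^sup>2 * (sin (t j))\<^sup>2"
      using tail_Suc[of j ?x] step xc[of j] RS[of j] by (simp add: power_mult_distrib)
    then show ?case by (simp add: distrib_left[symmetric])
  qed
  have R0: "0 \<le> R j" if "1 \<le> j" "j \<le> ?n" for j
  proof (cases "j = ?n")
    case True
    then show ?thesis using lpos_top[OF assms(1)] xn by simp
  next
    case False
    then show ?thesis unfolding R_def using that t0[of ?n] rng
      by (intro mult_nonneg_nonneg prod_nonneg ballI sin_ge_zero) auto
  qed
  have R: "R j = tail j ?x" if "1 \<le> j" "j \<le> ?n" for j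
    using sq[OF that] R0[OF that] tail_nonneg[of j ?x] by (simp add: power2_eq_iff_nonneg)
  show "t = ang ?x"
  proof
    fix j
    consider "j = 0" | "?n \<le> j" | "1 \<le> j" "j < ?n" by linarith
    then show "t j = ang ?x j"
    proof cases
      case 1
      then show ?thesis using R[of 1] n1 by (simp add: R_def ang_def)
    next
      case 2
      then show ?thesis using ge by (simp add: ang_def)
    next
      case 3
      show ?thesis
      proof (cases "?x \<in> Vh j")
        case True
        then show ?thesis using zero[OF 3 True] ang_Vh[of ?x j] Vh_mono[of j "Suc j"] by auto
      next
        case False
        then have "R j \<noteq> 0" using R[of j] 3 by (simp add: tail_eq_0)
        moreover have "R j * cos (t j) = R j * cos (ang ?x j)"
          using tail_mult_cos(1)[OF assms(1) 3] xc[OF 3] R[of j] 3 by auto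
        moreover have "R j * sin (t j) = R j * sin (ang ?x j)"
          using tail_mult_cos(2)[OF assms(1) 3] RS[of j] R[of j] R[of "Suc j"] 3 by auto
        ultimately obtain m :: int where m: "t j = ang ?x j + 2 * pi * m"
          using sin_cos_eq_iff[of "t j" "ang ?x j"] by auto
        have "\<bar>t j - ang ?x j\<bar> < 2 * pi"
          using rng'[OF 3] ang_nonneg[of ?x j] ang_lt_pi[of j ?x] 3 by (simp add: abs_less_iff)
        then have "\<bar>2 * pi * real_of_int m\<bar> < 2 * pi * 1" using m by simp
        then have "\<bar>real_of_int m\<bar> < 1"
          using pi_gt_zero by (simp only: abs_mult) simp
        then have "m = 0" by linarith
        then show ?thesis using m by simp
      qed
    qed
  qed
qed

lemma polar_eq_ang: "hom q \<in> lpos \<Longrightarrow> polar p e q = ang (hom q)"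
  unfolding polar_def using is_polar_unique is_polar_ang by (intro the_equality) auto

text \<open>The coordinates from \<open>i\<close> on are a common factor, formed by the free
  entries, times numbers that depend only on the prescribed angles. Excluding V_(i-1) makes the
  factor positive, which is the scaling in \<open>cone\<close>.\<close>

lemma half_flat_eq_cone:
  assumes i: "i < CARD('n)" and u: "u \<in> Dh i" "u \<in> lpos" "i = 0 \<Longrightarrow> 0 < fst u"
    and th: "\<And>j. i \<le> j \<Longrightarrow> j < CARD('n) \<Longrightarrow> th j = ang u j"
  shows "half_flat p e i th = cone i u"
proof -
  let ?n = "CARD('n)"
  have "R \<in> half_flat p e i th" if R: "R \<in> cone i u" for R
  proof -
    obtain s where s: "0 < s" "hom R - s *\<^sub>R u \<in> Vh i" using R by (auto simp: cone_def)
    have lp: "hom R \<in> lpos" using lpos_Vh[OF u(2,1) s(2,1)] .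
    have "ang (hom R) j = th j" if "j \<in> {i..<?n}" for j
      using ang_cong_scale[OF s(2,1), of j] th[of j] that by simp
    moreover have "R \<notin> flag p e (i - 1)" if "0 < i"
    proof
      assume "R \<in> flag p e (i - 1)"
      then have "hom R \<in> Vh i" using that by (simp add: flag_eq)
      then have "s *\<^sub>R u \<in> Vh i" using Vh_diff[OF _ s(2), of "hom R"] by simp
      then have "u \<in> Vh i" using Vh_scale[of "s *\<^sub>R u" i "1/s"] s by simp
      then show False using Dh_Int_Vh u lpos_nonzero by blast
    qed
    ultimately show ?thesis
      using i is_polar_ang[OF lp] by (auto simp: half_flat_def)
  qed
  moreover have "R \<in> cone i u" if "R \<in> half_flat p e i th" for R
  proof -
    have "(\<exists>t. is_polar p e R t \<and> (\<forall>j\<in>{i..<?n}. t j = th j))"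
      and nf: "0 < i \<Longrightarrow> R \<notin> flag p e (i - 1)"
      using that i by (auto simp: half_flat_def)
    then obtain t where t: "is_polar p e R t" and tj: "\<And>j. i \<le> j \<Longrightarrow> j < ?n \<Longrightarrow> t j = th j"
      by (metis atLeastLessThan_iff)
    define s0 where "s0 = (if i = 0 then 1 / fst u else 1)"
    \<comment> \<open>A sample point of the cone. For \<open>i = 0\<close> the cone is a single
      point; for \<open>i > 0\<close> the first coordinate of \<open>u\<close> is 0, so translating
      \<open>p\<close> by \<open>snd u\<close> only adds \<open>eh 0\<close>, an element of
      \<open>Vh i\<close>.\<close>
    define q where "q = (if i = 0 then pnt u else p + snd u)"
    have s0: "0 < s0" using u(3) by (simp add: s0_def)
    have qv: "hom q - s0 *\<^sub>R u \<in> Vh i"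
    proof (cases "i = 0")
      case True
      then show ?thesis using u(3) hom_pnt[of u] by (simp add: q_def s0_def Vh_zero divide_inverse)
    next
      case False
      then have "fst u = 0" using Dh_inner[OF u(1), of 0] by (simp add: eh_0)
      then have "hom q - s0 *\<^sub>R u = eh 0"
        using False by (simp add: prod_eq_iff q_def s0_def hom_def eh_def)
      then show ?thesis using eh_in_Vh[of 0 i] False by simp
    qed
    have lq: "hom q \<in> lpos" using lpos_Vh[OF u(2,1) qv s0] .
    let ?t = "ang (hom q)"
    have pq: "is_polar p e q ?t" by (rule is_polar_ang[OF lq])
    have tt: "t j = ?t j" if "i \<le> j" "j < ?n" for j
      using tj[OF that] th[OF that] ang_cong_scale[OF qv s0 that(1)] by simp
    \<comment> \<open>\<open>a\<close> collects the radius and the angles below \<open>i\<close>,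
      \<open>w\<close> the prescribed angles; the lower limit \<open>max 1 i\<close> keeps the
      radius out of \<open>w\<close> when \<open>i = 0\<close>.\<close>
    define a where "a t = t 0 * (\<Prod>l\<in>{1..<i}. sin (t l))" for t :: "nat \<Rightarrow> real"
    define w where "w j = (\<Prod>l\<in>{max 1 i..<j}. sin (?t l)) * (if j < ?n then cos (?t j) else 1)" for j
    have co: "hom r \<bullet> eh j = a t' * w j"
      if "is_polar p e r t'" "\<And>j. i \<le> j \<Longrightarrow> j < ?n \<Longrightarrow> t' j = ?t j" "i \<le> j" "j \<le> ?n" "1 \<le> j" for r t' j
    proof -
      have "hom r \<bullet> eh j = t' 0 * (\<Prod>l\<in>{1..<j}. sin (t' l)) * (if j < ?n then cos (t' j) else 1)"
        using that(1,4,5) by (auto simp: is_polar_def Let_def eh_pos)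
      also have "(\<Prod>l\<in>{1..<j}. sin (t' l)) =
          (\<Prod>l\<in>{1..<i}. sin (t' l)) * (\<Prod>l\<in>{max 1 i..<j}. sin (t' l))"
        using that(3,5) by (subst prod.union_disjoint[symmetric]) (auto intro!: prod.cong)
      also have "(\<Prod>l\<in>{max 1 i..<j}. sin (t' l)) = (\<Prod>l\<in>{max 1 i..<j}. sin (?t l))"
        using that by (intro prod.cong) auto
      finally show ?thesis using that by (simp add: a_def w_def)
    qed
    have coR: "hom R \<bullet> eh j = a t * w j" and coq: "hom q \<bullet> eh j = a ?t * w j"
      if "i \<le> j" "j \<le> ?n" "1 \<le> j" for j
      using co[OF t _ that] co[OF pq _ that] tt by auto
    show ?thesis
    proof (cases "i = 0")
      case True
      have "a t = a ?t" using True tt[of 0] by (simp add: a_def)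
      then have "hom R = hom q"
        using coR coq True by (intro eh_eqI) (metis eh_0 fst_hom le0 less_one linorder_not_le)
      then have "hom R - s0 *\<^sub>R u \<in> Vh i" using qv by simp
      then show ?thesis using s0 by (auto simp: cone_def)
    next
      case False
      have a0: "0 \<le> a t'" if "is_polar p e r t'" for r t'
      proof -
        have "0 \<le> sin (t' l)" if "l \<in> {1..<i}" for l
          using that i \<open>is_polar p e r t'\<close>
          by (intro sin_ge_zero) (auto simp: is_polar_def Let_def)
        moreover have "0 \<le> t' 0" using \<open>is_polar p e r t'\<close> by (auto simp: is_polar_def Let_def)
        ultimately show ?thesis unfolding a_def by (intro mult_nonneg_nonneg prod_nonneg) auto
      qed
      have "hom R \<notin> Vh i" using nf False by (simp add: flag_eq)
      then have 1: "a t \<noteq> 0" using coR False by (auto simp: Vh_def)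
      have "hom q \<notin> Vh i"
      proof
        assume "hom q \<in> Vh i"
        then have "s0 *\<^sub>R u \<in> Vh i" using Vh_diff[OF _ qv, of "hom q"] by simp
        then have "u \<in> Vh i" using Vh_scale[of "s0 *\<^sub>R u" i "1/s0"] s0 by simp
        then show False using Dh_Int_Vh u lpos_nonzero by blast
      qed
      then have 2: "a ?t \<noteq> 0" using coq False by (auto simp: Vh_def)
      define s where "s = a t / a ?t"
      have s: "0 < s" using 1 2 a0[OF t] a0[OF pq] by (simp add: s_def)
      have "hom R - s *\<^sub>R hom q \<in> Vh i"
        unfolding Vh_def using coR coq False 2 by (auto simp: inner_diff_left s_def)
      from Vh_add[OF this Vh_scale[OF qv, of s]]
      have "hom R - (s * s0) *\<^sub>R u \<in> Vh i" by (simp add: algebra_simps)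
      then show ?thesis using s s0 by (auto simp: cone_def intro!: exI[of _ "s * s0"])
    qed
  qed
  ultimately show ?thesis by blast
qed

text \<open>With equal tails the angle is a decreasing function of the coordinate. In homogeneous
  coordinates this includes the radius: a larger first coordinate means a smaller radius.\<close>

lemma ang_less_iff:
  assumes "x - y \<in> Vh (Suc j)" "x \<notin> Vh (Suc j)" "j < CARD('n)" "0 < fst x" "0 < fst y"
  shows "ang x j < ang y j \<longleftrightarrow> y \<bullet> eh j < x \<bullet> eh j"
proof -
  have T: "tail (Suc j) y = tail (Suc j) x" using tail_Vh[OF assms(1)] by simp
  have T0: "0 < tail (Suc j) x"
    using assms(2) tail_nonneg[of "Suc j" x] by (simp add: tail_eq_0[symmetric] order_le_less)
  show ?thesis
  proof (cases "j = 0")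
    case True
    then show ?thesis
      using T T0 assms by (auto simp: ang_def eh_0 divide_less_cancel frac_less2 field_simps)
  next
    case False
    then show ?thesis
      using T T0 assms(3) by (simp add: ang_def arctan_less_iff divide_less_cancel)
  qed
qed

lemma ang_eqD:
  assumes "x - y \<in> Vh (Suc j)" "x \<notin> Vh (Suc j)" "j < CARD('n)" "0 < fst x" "0 < fst y"
    "ang x j = ang y j"
  shows "x - y \<in> Vh j"
proof -
  have "y - x \<in> Vh (Suc j)" using Vh_scale[OF assms(1), of "-1"] by simp
  moreover have "y \<notin> Vh (Suc j)" using Vh_add[OF assms(1), of y] assms(2) by auto
  ultimately have "x \<bullet> eh j = y \<bullet> eh j"
    using ang_less_iff[OF assms(1-5)] ang_less_iff[of y x j] assms by auto
  then show ?thesis using Vh_SucD[OF assms(1)] by (simp add: inner_diff_left)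
qed

lemma ang_eq_imp_diff_in_Vh:
  assumes "j \<le> i" "i \<le> CARD('n)" "x - y \<in> Vh i" "x \<notin> Vh i" "0 < fst x" "0 < fst y"
    "\<And>l. j \<le> l \<Longrightarrow> l < i \<Longrightarrow> ang x l = ang y l"
  shows "x - y \<in> Vh j"
  using assms(1,7)
proof (induction j rule: inc_induct)
  case base
  then show ?case using assms by simp
next
  case (step j)
  have "x \<notin> Vh (Suc j)" using assms(4) Vh_mono[of "Suc j" i] step by auto
  then show ?case
    by (rule ang_eqD[rotated]) (use step assms in auto)
qed

text \<open>At the last index where the coordinates differ the tails still agree, so
  \<open>ang_less_iff\<close> applies there. The comparison of angle vectors thereby becomes a
  condition on signs of coordinate differences.\<close>

lemma antilex_ang_iff:
  assumes "i \<le> CARD('n)" "x - y \<in> Vh i" "x \<notin> Vh i" "0 < fst x" "0 < fst y"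
  shows "antilex_less CARD('n) (ang x) (ang y) \<longleftrightarrow>
    (\<exists>k<i. y \<bullet> eh k < x \<bullet> eh k \<and> (\<forall>j. k < j \<and> j < i \<longrightarrow> x \<bullet> eh j = y \<bullet> eh j))"
proof
  have eq: "ang x j = ang y j" if "i \<le> j" for j
    using ang_cong Vh_mono[OF that] assms by blast
  {
    assume "antilex_less CARD('n) (ang x) (ang y)"
    then obtain k where k: "k < CARD('n)" "ang x k < ang y k"
      "\<And>j. k < j \<Longrightarrow> j < CARD('n) \<Longrightarrow> ang x j = ang y j" by (auto simp: antilex_less_def)
    have ki: "k < i" using eq[of k] k(2) by force
    have d: "x - y \<in> Vh (Suc k)"
      by (rule ang_eq_imp_diff_in_Vh[of "Suc k" i]) (use ki k(3) assms in auto)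
    have "x \<notin> Vh (Suc k)" using Vh_mono[of "Suc k" i] ki assms by auto
    then have "y \<bullet> eh k < x \<bullet> eh k" using ang_less_iff[OF d] k assms by auto
    moreover have "x \<bullet> eh j = y \<bullet> eh j" if "k < j" "j < i" for j
      using Vh_inner[OF d, of j] that assms by (simp add: inner_diff_left)
    ultimately show "\<exists>k<i. y \<bullet> eh k < x \<bullet> eh k \<and> (\<forall>j. k < j \<and> j < i \<longrightarrow> x \<bullet> eh j = y \<bullet> eh j)"
      using ki by blast
  }
  assume "\<exists>k<i. y \<bullet> eh k < x \<bullet> eh k \<and> (\<forall>j. k < j \<and> j < i \<longrightarrow> x \<bullet> eh j = y \<bullet> eh j)"
  then obtain k where k: "k < i" "y \<bullet> eh k < x \<bullet> eh k"
    "\<And>j. k < j \<Longrightarrow> j < i \<Longrightarrow> x \<bullet> eh j = y \<bullet> eh j" by blast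
  have d: "x - y \<in> Vh (Suc k)"
    unfolding Vh_def
  proof (clarify)
    fix j assume "Suc k \<le> j" "j \<le> CARD('n)"
    then show "(x - y) \<bullet> eh j = 0"
      using k(3)[of j] Vh_inner[OF assms(2), of j] by (cases "j < i") (auto simp: inner_diff_left)
  qed
  have "x \<notin> Vh (Suc k)" using Vh_mono[of "Suc k" i] k assms by auto
  then have "ang x k < ang y k" using ang_less_iff[OF d] k assms by auto
  moreover have "ang x j = ang y j" if "k < j" for j
    using ang_cong[of x y j] Vh_mono[of "Suc k" j] d that by auto
  ultimately show "antilex_less CARD('n) (ang x) (ang y)"
    using k(1) assms(1) by (auto simp: antilex_less_def intro!: exI[of _ k])
qed

lemma ang_inj:
  assumes "hom q \<in> lpos" "hom r \<in> lpos" "\<And>j. j < CARD('n) \<Longrightarrow> ang (hom q) j = ang (hom r) j"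
  shows "q = r"
proof -
  have eq: "ang (hom q) j = ang (hom r) j" for j
    using assms(3)[of j] by (cases "j < CARD('n)") (auto simp: ang_def)
  have "hom q \<bullet> eh j = hom r \<bullet> eh j" if "j \<le> CARD('n)" for j
  proof (cases "j = 0")
    case False
    have "(q - p) \<bullet> e j = (r - p) \<bullet> e j"
      using is_polar_ang[OF assms(1)] is_polar_ang[OF assms(2)] that False
      by (cases "j = CARD('n)") (auto simp: is_polar_def Let_def eq)
    then show ?thesis using False by (simp add: eh_pos)
  qed (simp add: eh_0)
  then have "hom q = hom r" by (rule eh_eqI)
  then show ?thesis by simp
qed

end

lemma antilex_less_trans:
  assumes "antilex_less n x y" "antilex_less n y z"
  shows "antilex_less n x z"
proof -
  obtain k where k: "k < n" "x k < y k" "\<And>j. k < j \<Longrightarrow> j < n \<Longrightarrow> x j = y j"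
    using assms(1) by (auto simp: antilex_less_def)
  obtain l where l: "l < n" "y l < z l" "\<And>j. l < j \<Longrightarrow> j < n \<Longrightarrow> y j = z j"
    using assms(2) by (auto simp: antilex_less_def)
  have "x (max k l) < z (max k l)"
    using k l by (cases k l rule: linorder_cases) (auto simp: max_def)
  then show ?thesis
    using k l unfolding antilex_less_def by (intro exI[of _ "max k l"]) auto
qed

lemma antilex_less_irrefl: "\<not> antilex_less n x x"
  by (simp add: antilex_less_def)

lemma antilex_less_total:
  assumes "j < n" "x j \<noteq> y j"
  shows "antilex_less n x y \<or> antilex_less n y x"
proof -
  let ?S = "{j. j < n \<and> x j \<noteq> y j}"
  have "finite ?S" "?S \<noteq> {}" using assms by auto
  then have k: "Max ?S \<in> ?S" and "\<And>l. l \<in> ?S \<Longrightarrow> l \<le> Max ?S"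
    using Max_in[of ?S] Max_ge[of ?S] by blast+
  then have "x l = y l" if "Max ?S < l" "l < n" for l using that by fastforce
  then show ?thesis
    using k unfolding antilex_less_def
    by (cases "x (Max ?S) < y (Max ?S)") (auto intro!: exI[of _ "Max ?S"] simp del: Max_less_iff)
qed

section \<open>Sign vectors and flats\<close>

text \<open>\<open>same_position\<close> refers to all equations of a hyperplane; since they differ
  by nonzero factors, the single equation chosen in \<open>hform\<close> determines it.\<close>

lemma hyperplane_eq_proportional:
  fixes a a' :: "'a::euclidean_space"
  assumes "a \<noteq> 0" "a' \<noteq> 0" and eq: "{z. a \<bullet> z = b} = {z. a' \<bullet> z = b'}"
  obtains c where "c \<noteq> 0" "a' = c *\<^sub>R a" "b' = c * b"
proof
  let ?z = "(b / (a \<bullet> a)) *\<^sub>R a" and ?c = "(a' \<bullet> a) / (a \<bullet> a)"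
  have "?z \<in> {z. a \<bullet> z = b}" using assms(1) by simp
  then have z: "a' \<bullet> ?z = b'" using eq by blast
  have perp: "a' \<bullet> v = 0" if "a \<bullet> v = 0" for v
  proof -
    have "?z + v \<in> {z. a \<bullet> z = b}" using assms(1) that by (simp add: inner_add_right)
    then have "a' \<bullet> (?z + v) = b'" using eq by blast
    then show ?thesis using z by (simp add: inner_add_right)
  qed
  define w where "w = a' - ?c *\<^sub>R a"
  have "a \<bullet> w = 0" using assms(1) by (simp add: w_def inner_diff_right inner_commute)
  then have "w \<bullet> w = 0"
    using perp[of w] by (simp add: w_def inner_diff_left inner_diff_right inner_commute)
  then show a': "a' = ?c *\<^sub>R a" by (simp add: w_def)
  then show "?c \<noteq> 0" using assms(2) by auto
  show "b' = ?c * b" using z by (simp add: mult.commute)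
qed

lemma in_closure_if_segment:
  fixes x y :: "'a::real_normed_vector"
  assumes "\<And>t. 0 < t \<Longrightarrow> t \<le> 1 \<Longrightarrow> (1 - t) *\<^sub>R x + t *\<^sub>R y \<in> S"
  shows "x \<in> closure S"
proof -
  let ?f = "\<lambda>n. (1 - inverse (real (Suc n))) *\<^sub>R x + inverse (real (Suc n)) *\<^sub>R y"
  have "?f n \<in> S" for n
    by (rule assms) (auto simp: inverse_le_1_iff)
  moreover have "?f \<longlonglongrightarrow> (1 - 0) *\<^sub>R x + 0 *\<^sub>R y"
    by (intro tendsto_intros LIMSEQ_inverse_real_of_nat)
  ultimately show ?thesis
    unfolding closure_sequential by (intro exI[of _ ?f]) auto
qed

lemma small_scaling:
  fixes c d :: "'a \<Rightarrow> real"
  assumes "finite J" "\<And>j. j \<in> J \<Longrightarrow> 0 < d j"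
  shows "\<exists>r>0. \<forall>j\<in>J. r * c j < d j"
proof -
  have "\<forall>\<^sub>F r in at_right 0. r * c j < d j" if "j \<in> J" for j
  proof (rule order_tendstoD)
    show "((\<lambda>r. r * c j) \<longlongrightarrow> 0 * c j) (at_right 0)" by (intro tendsto_intros)
  qed (simp add: assms that)
  then have "\<forall>\<^sub>F r in at_right 0. \<forall>j\<in>J. r * c j < d j"
    using assms(1) by (simp add: eventually_ball_finite)
  then have "\<forall>\<^sub>F r in at_right (0::real). 0 < r \<and> (\<forall>j\<in>J. r * c j < d j)"
    by (intro eventually_conj eventually_at_right_less)
  then show ?thesis using eventually_happens'[OF trivial_limit_at_right_real] by blast
qed

locale generic_arrangement = polar_frame p e
  for p :: "real^'n" and e :: "nat \<Rightarrow> real^'n" +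
  fixes A :: "(real^'n) set set" and \<delta> :: real
  assumes arr: "arrangement A" and ess: "essential A" and gen: "generic_polar A p e \<delta>"
begin

lemma finite_A: "finite A"
  using arr by (simp add: arrangement_def)

definition hform :: "(real^'n) set \<Rightarrow> real \<times> (real^'n)" where
  "hform H = (SOME h. snd h \<noteq> 0 \<and> H = {q. h \<bullet> hom q = 0})"

text \<open>The face relation of sign vectors: on lifted points it describes the closure of the
  facet of \<open>y\<close>.\<close>

definition weak_conf :: "real \<times> (real^'n) \<Rightarrow> real \<times> (real^'n) \<Rightarrow> bool" where
  "weak_conf y x \<longleftrightarrow> (\<forall>H\<in>A. hform H \<bullet> x = 0 \<or> sgn (hform H \<bullet> x) = sgn (hform H \<bullet> y))"

definition sign_eq :: "real \<times> (real^'n) \<Rightarrow> real \<times> (real^'n) \<Rightarrow> bool" where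
  "sign_eq y x \<longleftrightarrow> (\<forall>H\<in>A. sgn (hform H \<bullet> x) = sgn (hform H \<bullet> y))"

definition active :: "real \<times> (real^'n) \<Rightarrow> (real^'n) set set" where
  "active x = {H\<in>A. hform H \<bullet> x = 0}"

definition Lh :: "(real^'n) set set \<Rightarrow> (real \<times> (real^'n)) set" where
  "Lh B = {z. \<forall>H\<in>B. hform H \<bullet> z = 0}"

text \<open>A flat is represented by a family of hyperplanes, and \<open>Lh B\<close> is the linear span of its lift.\<close>

definition codim_fam :: "nat \<Rightarrow> (real^'n) set set set" where
  "codim_fam i = {B. B \<subseteq> A \<and> \<Inter>B \<noteq> {} \<and> aff_dim (\<Inter>B) = int CARD('n) - int i}"

lemma hform:
  assumes "H \<in> A"
  shows "snd (hform H) \<noteq> 0" "H = {q. hform H \<bullet> hom q = 0}"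
proof -
  obtain a b where ab: "a \<noteq> 0" "H = {x. a \<bullet> x = b}"
    using arr assms by (auto simp: arrangement_def)
  have "snd (a \<bullet> p - b, a) \<noteq> 0 \<and> H = {q. (a \<bullet> p - b, a) \<bullet> hom q = 0}"
    using ab by (auto simp: hom_def inner_diff_right)
  then have "snd (hform H) \<noteq> 0 \<and> H = {q. hform H \<bullet> hom q = 0}"
    unfolding hform_def by (rule someI)
  then show "snd (hform H) \<noteq> 0" "H = {q. hform H \<bullet> hom q = 0}" by auto
qed

lemma hform_hom: "hform H \<bullet> hom q = snd (hform H) \<bullet> q - (snd (hform H) \<bullet> p - fst (hform H))"
  by (simp add: hom_def inner_prod_def inner_diff_right)

lemma mem_A_iff: "H \<in> A \<Longrightarrow> q \<in> H \<longleftrightarrow> hform H \<bullet> hom q = 0"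
  using hform(2) by blast

lemma same_position_iff: "same_position A x y \<longleftrightarrow> sign_eq (hom x) (hom y)"
proof
  assume sp: "same_position A x y"
  have "sgn (hform H \<bullet> hom y) = sgn (hform H \<bullet> hom x)" if "H \<in> A" for H
  proof -
    have "H = {z. snd (hform H) \<bullet> z = snd (hform H) \<bullet> p - fst (hform H)}"
      using mem_A_iff[OF that] by (auto simp: hform_hom)
    then have "sgn (snd (hform H) \<bullet> x - (snd (hform H) \<bullet> p - fst (hform H))) =
        sgn (snd (hform H) \<bullet> y - (snd (hform H) \<bullet> p - fst (hform H)))"
      using sp[unfolded same_position_def, rule_format, OF that] hform(1)[OF that] by blast
    then show ?thesis by (simp add: hform_hom)
  qed
  then show "sign_eq (hom x) (hom y)" by (simp add: sign_eq_def)
next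
  assume eq: "sign_eq (hom x) (hom y)"
  show "same_position A x y"
    unfolding same_position_def
  proof (intro ballI allI impI)
    fix H a b assume H: "H \<in> A" and ab: "a \<noteq> 0 \<and> H = {z. a \<bullet> z = b}"
    have "H = {z. snd (hform H) \<bullet> z = snd (hform H) \<bullet> p - fst (hform H)}"
      using mem_A_iff[OF H] by (auto simp: hform_hom)
    then have "{z. snd (hform H) \<bullet> z = snd (hform H) \<bullet> p - fst (hform H)} = {z. a \<bullet> z = b}"
      using ab by (rule trans[OF sym conjunct2])
    from hyperplane_eq_proportional[OF hform(1)[OF H] conjunct1[OF ab] this]
    obtain c where c: "a = c *\<^sub>R snd (hform H)" "b = c * (snd (hform H) \<bullet> p - fst (hform H))"
      by blast
    have "a \<bullet> z - b = c * (hform H \<bullet> hom z)" for z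
      by (simp add: c hform_hom algebra_simps)
    then show "sgn (a \<bullet> x - b) = sgn (a \<bullet> y - b)"
      using eq H by (simp add: sign_eq_def sgn_mult)
  qed
qed

section \<open>Facets and the closures of facets and sections\<close>

lemma facet_eq:
  assumes "F \<in> facets A" "q \<in> F"
  shows "F = {r. sign_eq (hom q) (hom r)}"
  using assms by (auto simp: facets_def same_position_iff sign_eq_def)

lemma facet_of: "{r. sign_eq (hom q) (hom r)} \<in> facets A"
  by (auto simp: facets_def same_position_iff)

lemma facets_nonempty: "F \<in> facets A \<Longrightarrow> F \<noteq> {}"
  by (auto simp: facets_def same_position_def)

lemma facets_disjoint: "F \<in> facets A \<Longrightarrow> G \<in> facets A \<Longrightarrow> q \<in> F \<Longrightarrow> q \<in> G \<Longrightarrow> F = G"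
  using facet_eq by metis

lemma hom_convex: "hom ((1 - t) *\<^sub>R x + t *\<^sub>R y) = (1 - t) *\<^sub>R hom x + t *\<^sub>R hom y"
  by (simp add: hom_def algebra_simps)

lemma sign_eq_imp_weak_conf: "sign_eq y x \<Longrightarrow> weak_conf y x"
  by (simp add: sign_eq_def weak_conf_def)

lemma sign_eq_refl: "sign_eq y y"
  by (simp add: sign_eq_def)

lemma sign_eq_scale: "0 < c \<Longrightarrow> sign_eq y (c *\<^sub>R x) \<longleftrightarrow> sign_eq y x"
  by (simp add: sign_eq_def sgn_mult)

lemma weak_conf_scale: "0 < c \<Longrightarrow> weak_conf y (c *\<^sub>R x) \<longleftrightarrow> weak_conf y x"
  by (simp add: weak_conf_def sgn_mult)

lemma sign_eq_add:
  assumes "weak_conf y x" "sign_eq y z" "0 \<le> s" "0 < t"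
  shows "sign_eq y (s *\<^sub>R x + t *\<^sub>R z)"
  unfolding sign_eq_def
proof
  fix H assume H: "H \<in> A"
  let ?a = "hform H \<bullet> x" and ?b = "hform H \<bullet> z"
  have b: "sgn ?b = sgn (hform H \<bullet> y)" using assms H by (simp add: sign_eq_def)
  have a: "?a = 0 \<or> sgn ?a = sgn ?b" using assms H b by (simp add: weak_conf_def)
  have "sgn (s * ?a + t * ?b) = sgn ?b"
  proof (cases ?b "0::real" rule: linorder_cases)
    case less
    then have "?a \<le> 0" using a by (auto simp: sgn_if split: if_splits)
    then have "s * ?a + t * ?b < 0"
      using less assms by (simp add: add_nonpos_neg mult_nonneg_nonpos mult_pos_neg)
    then show ?thesis using less by simp
  next
    case equal
    then show ?thesis using a by (auto simp: sgn_if split: if_splits)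
  next
    case greater
    then have "0 \<le> ?a" using a by (auto simp: sgn_if split: if_splits)
    then have "0 < s * ?a + t * ?b"
      using greater assms by (simp add: add_nonneg_pos)
    then show ?thesis using greater by simp
  qed
  then show "sgn (hform H \<bullet> (s *\<^sub>R x + t *\<^sub>R z)) = sgn (hform H \<bullet> y)"
    using b by (simp add: inner_add_right)
qed

lemma weak_conf_add:
  assumes "weak_conf y x" "weak_conf y z" "0 \<le> s" "0 \<le> t"
  shows "weak_conf y (s *\<^sub>R x + t *\<^sub>R z)"
  unfolding weak_conf_def
proof
  fix H assume H: "H \<in> A"
  let ?a = "hform H \<bullet> x" and ?b = "hform H \<bullet> z" and ?c = "hform H \<bullet> y"
  have a: "?a = 0 \<or> sgn ?a = sgn ?c" and b: "?b = 0 \<or> sgn ?b = sgn ?c"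
    using assms H by (auto simp: weak_conf_def)
  have "s * ?a + t * ?b = 0 \<or> sgn (s * ?a + t * ?b) = sgn ?c"
  proof (cases ?c "0::real" rule: linorder_cases)
    case less
    then have "?a \<le> 0" "?b \<le> 0" using a b by (auto simp: sgn_if split: if_splits)
    then have "s * ?a + t * ?b \<le> 0"
      using assms by (simp add: add_nonpos_nonpos mult_nonneg_nonpos)
    then show ?thesis using less by (auto simp: sgn_if)
  next
    case equal
    then show ?thesis using a b by (auto simp: sgn_if split: if_splits)
  next
    case greater
    then have "0 \<le> ?a" "0 \<le> ?b" using a b by (auto simp: sgn_if split: if_splits)
    then have "0 \<le> s * ?a + t * ?b" using assms by simp
    then show ?thesis using greater by (auto simp: sgn_if)
  qed
  then show "hform H \<bullet> (s *\<^sub>R x + t *\<^sub>R z) = 0 \<or> sgn (hform H \<bullet> (s *\<^sub>R x + t *\<^sub>R z)) = sgn ?c"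
    by (simp add: inner_add_right)
qed

lemma continuous_on_hom [continuous_intros]: "continuous_on S hom"
  unfolding hom_def by (intro continuous_intros)

lemma closed_weak_conf: "closed {r. weak_conf y (hom r)}"
proof -
  have "{r. weak_conf y (hom r)} = (\<Inter>H\<in>A. {r. hform H \<bullet> hom r = 0 \<or> sgn (hform H \<bullet> hom r)
    = sgn (hform H \<bullet> y)})"
    by (auto simp: weak_conf_def)
  moreover have "closed {r. hform H \<bullet> hom r = 0 \<or> sgn (hform H \<bullet> hom r) = sgn (hform H \<bullet> y)}" for H
  proof (cases "hform H \<bullet> y" "0::real" rule: linorder_cases)
    case less
    then have "{r. hform H \<bullet> hom r = 0 \<or> sgn (hform H \<bullet> hom r) = sgn (hform H \<bullet> y)}
      = {r. hform H \<bullet> hom r \<le> 0}"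
      by (auto simp: sgn_if split: if_splits)
    then show ?thesis by (simp add: closed_Collect_le continuous_intros)
  next
    case equal
    then have "{r. hform H \<bullet> hom r = 0 \<or> sgn (hform H \<bullet> hom r) = sgn (hform H \<bullet> y)}
      = {r. hform H \<bullet> hom r = 0}"
      by (auto simp: sgn_if split: if_splits)
    then show ?thesis by (simp add: closed_Collect_eq continuous_intros)
  next
    case greater
    then have "{r. hform H \<bullet> hom r = 0 \<or> sgn (hform H \<bullet> hom r) = sgn (hform H \<bullet> y)}
      = {r. 0 \<le> hform H \<bullet> hom r}"
      by (auto simp: sgn_if split: if_splits)
    then show ?thesis by (simp add: closed_Collect_le continuous_intros)
  qed
  ultimately show ?thesis by (simp add: closed_INT)
qed

text \<open>The factor \<open>s\<close> is a function of \<open>r\<close>: it can be read off at a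
  coordinate where \<open>u\<close> is positive. The set is then cut out by closed
  conditions.\<close>

lemma closed_cone:
  assumes "u \<in> Dh i" "u \<in> lpos"
  shows "closed {r. \<exists>s\<ge>0. hom r - s *\<^sub>R u \<in> Vh i}"
proof -
  obtain k where k: "k \<le> CARD('n)" "0 < u \<bullet> eh k"
    using assms by (auto simp: lpos_def)
  have ik: "i \<le> k" using Dh_inner[OF assms(1), of k] k by (metis less_irrefl linorder_not_less)
  let ?s = "\<lambda>r. hom r \<bullet> eh k / (u \<bullet> eh k)"
  have "(\<exists>s\<ge>0. hom r - s *\<^sub>R u \<in> Vh i) \<longleftrightarrow>
      0 \<le> ?s r \<and> (\<forall>j. i \<le> j \<and> j \<le> CARD('n) \<longrightarrow> (hom r - ?s r *\<^sub>R u) \<bullet> eh j = 0)" (is "?L \<longleftrightarrow> ?R") for r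
  proof
    assume ?L
    then obtain s where s: "0 \<le> s" "hom r - s *\<^sub>R u \<in> Vh i" by auto
    have "s = ?s r" using Vh_inner[OF s(2) ik k(1)] k by (simp add: inner_diff_left)
    then show ?R using s by (auto simp: Vh_def)
  qed (auto simp: Vh_def)
  then have "{r. \<exists>s\<ge>0. hom r - s *\<^sub>R u \<in> Vh i} =
      {r. 0 \<le> ?s r \<and> (\<forall>j. i \<le> j \<and> j \<le> CARD('n) \<longrightarrow> (hom r - ?s r *\<^sub>R u) \<bullet> eh j = 0)}" by simp
  also have "closed \<dots>"
    using k(2) by (intro closed_Collect_conj closed_Collect_all closed_Collect_imp open_Collect_const
      closed_Collect_le closed_Collect_eq continuous_intros) auto
  finally show ?thesis .
qed

lemma closure_facet:
  assumes "F \<in> facets A" "q \<in> F"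
  shows "closure F = {r. weak_conf (hom q) (hom r)}"
proof
  have F: "F = {r. sign_eq (hom q) (hom r)}" by (rule facet_eq[OF assms])
  show "closure F \<subseteq> {r. weak_conf (hom q) (hom r)}"
    using closed_weak_conf F by (intro closure_minimal) (auto intro: sign_eq_imp_weak_conf)
  show "{r. weak_conf (hom q) (hom r)} \<subseteq> closure F"
  proof
    fix r assume "r \<in> {r. weak_conf (hom q) (hom r)}"
    then show "r \<in> closure F"
      unfolding F by (intro in_closure_if_segment[of _ q]) (auto
        simp: hom_convex sign_eq_add sign_eq_refl)
  qed
qed

text \<open>On the segment from a point with \<open>s \<ge> 0\<close> to \<open>q\<close> the signs
  are those of \<open>q\<close> and the factor is positive, except possibly at the starting point.
  The value \<open>s = 0\<close> accounts for the closure points in V_(i-1).\<close>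

lemma closure_section:
  assumes F: "F \<in> facets A" "q \<in> F" "q \<in> cone i u" and u: "u \<in> Dh i" "u \<in> lpos"
  shows "closure (F \<inter> cone i u) = {r \<in> closure F. \<exists>s\<ge>0. hom r - s *\<^sub>R u \<in> Vh i}"
proof
  have "F \<inter> cone i u \<subseteq> {r. \<exists>s\<ge>0. hom r - s *\<^sub>R u \<in> Vh i}"
    by (auto simp: cone_def intro: less_imp_le)
  then have "closure (F \<inter> cone i u) \<subseteq> {r. \<exists>s\<ge>0. hom r - s *\<^sub>R u \<in> Vh i}"
    using closed_cone[OF u] by (rule closure_minimal)
  then show "closure (F \<inter> cone i u) \<subseteq> {r \<in> closure F. \<exists>s\<ge>0. hom r - s *\<^sub>R u \<in> Vh i}"
    using closure_mono[of "F \<inter> cone i u" F] by auto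
  show "{r \<in> closure F. \<exists>s\<ge>0. hom r - s *\<^sub>R u \<in> Vh i} \<subseteq> closure (F \<inter> cone i u)"
  proof clarify
    fix r s assume r: "r \<in> closure F" and s: "0 \<le> s" "hom r - s *\<^sub>R u \<in> Vh i"
    obtain s' where s': "0 < s'" "hom q - s' *\<^sub>R u \<in> Vh i" using F by (auto simp: cone_def)
    show "r \<in> closure (F \<inter> cone i u)"
    proof (rule in_closure_if_segment[of _ q])
      fix t :: real assume t: "0 < t" "t \<le> 1"
      have "weak_conf (hom q) (hom r)" using closure_facet[OF F(1,2)] r by blast
      then have "sign_eq (hom q) (hom ((1 - t) *\<^sub>R r + t *\<^sub>R q))"
        using t unfolding hom_convex by (intro sign_eq_add) (auto simp: sign_eq_refl)
      then have "(1 - t) *\<^sub>R r + t *\<^sub>R q \<in> F" using facet_eq[OF F(1,2)] by blast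
      moreover have "hom ((1 - t) *\<^sub>R r + t *\<^sub>R q) - ((1 - t) * s + t * s') *\<^sub>R u \<in> Vh i"
        using Vh_add[OF Vh_scale[OF s(2), of "1 - t"] Vh_scale[OF s'(2), of t]]
        unfolding hom_convex by (simp add: algebra_simps)
      moreover have "0 < (1 - t) * s + t * s'" using t s s' by (simp add: add_nonneg_pos)
      ultimately show "(1 - t) *\<^sub>R r + t *\<^sub>R q \<in> F \<inter> cone i u"
        by (auto simp: cone_def)
    qed
  qed
qed

section \<open>Flats and families of hyperplanes of given codimension\<close>

lemma Inter_iff: "B \<subseteq> A \<Longrightarrow> q \<in> \<Inter>B \<longleftrightarrow> hom q \<in> Lh B"
  using mem_A_iff by (auto simp: Lh_def)

lemma subspace_Lh: "subspace (Lh B)"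
  by (auto simp: subspace_def Lh_def inner_add_right)

lemmas Lh_add = subspace_add[OF subspace_Lh]
  and Lh_diff = subspace_diff[OF subspace_Lh]
  and Lh_scale = subspace_scale[OF subspace_Lh]
  and Lh_zero = subspace_0[OF subspace_Lh]

lemma Lh_antimono: "B \<subseteq> B' \<Longrightarrow> Lh B' \<subseteq> Lh B"
  by (auto simp: Lh_def)

lemma in_Lh_active: "B \<subseteq> active x \<Longrightarrow> x \<in> Lh B"
  by (auto simp: Lh_def active_def)

lemma codim_famD: "B \<in> codim_fam i \<Longrightarrow> B \<subseteq> A" "B \<in> codim_fam i \<Longrightarrow> \<Inter>B \<noteq> {}"
    "B \<in> codim_fam i \<Longrightarrow> aff_dim (\<Inter>B) = int CARD('n) - int i"
  by (auto simp: codim_fam_def)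

lemma finite_codim_fam: "finite (codim_fam i)"
  using finite_A by (auto simp: codim_fam_def intro: finite_subset[of _ "Pow A"])

lemma affine_Inter_A: "B \<subseteq> A \<Longrightarrow> affine (\<Inter>B)"
proof (rule affine_Inter)
  fix H assume "B \<subseteq> A" "H \<in> B"
  then have "\<exists>a b. H = {x. a \<bullet> x = b}" using arr unfolding arrangement_def by blast
  then show "affine H" using affine_hyperplane by auto
qed

lemma aff_dim_Inter_insert:
  assumes "B \<subseteq> A" "H \<in> A" "\<Inter>B \<inter> H \<noteq> {}"
  shows "aff_dim (\<Inter>(insert H B)) = (if \<Inter>B \<subseteq> H then aff_dim (\<Inter>B) else aff_dim (\<Inter>B) - 1)"
proof -
  obtain a b where ab: "H = {x. a \<bullet> x = b}"
    using arr assms(2) unfolding arrangement_def by blast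
  have "\<Inter>(insert H B) = \<Inter>B \<inter> {x. a \<bullet> x = b}" using ab by auto
  then show ?thesis
    using aff_dim_affine_Int_hyperplane[OF affine_Inter_A[OF assms(1)], of a b] assms(3) ab by simp
qed

text \<open>By essentiality a flat of positive dimension is not minimal, so some hyperplane meets it
  properly and lowers the dimension by exactly one.\<close>

lemma codim_fam_extend:
  assumes "B \<subseteq> A" "\<Inter>B \<noteq> {}" "int CARD('n) - int i \<le> aff_dim (\<Inter>B)" "i \<le> CARD('n)"
  shows "\<exists>B'\<in>codim_fam i. B \<subseteq> B'"
  using assms(1-3)
proof (induction "nat (aff_dim (\<Inter>B) - (int CARD('n) - int i))" arbitrary: B rule: less_induct)
  case less
  show ?case
  proof (cases "aff_dim (\<Inter>B) = int CARD('n) - int i")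
    case True
    then show ?thesis using less.prems by (auto simp: codim_fam_def)
  next
    case False
    have fl: "\<Inter>B \<in> flats A" using less.prems by (auto simp: flats_def)
    have "\<not> (\<exists>x. \<Inter>B = {x})"
      using False less.prems assms(4) aff_dim_eq_0[of "\<Inter>B"] by auto
    then obtain Y where Y: "Y \<in> flats A" "Y \<subseteq> \<Inter>B" "Y \<noteq> \<Inter>B"
      using ess fl unfolding essential_def by blast
    then obtain C where C: "C \<subseteq> A" "Y = \<Inter>C" "Y \<noteq> {}" by (auto simp: flats_def)
    have "\<not> \<Inter>B \<subseteq> \<Inter>C" using Y(2,3) C(2) by (metis subset_antisym)
    then obtain H where H: "H \<in> C" "\<not> \<Inter>B \<subseteq> H" by (metis Inter_greatest)
    have "Y \<subseteq> H" using H(1) C(2) by (simp add: Inter_lower)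
    then have ne: "\<Inter>B \<inter> H \<noteq> {}" using C(3) Y(2) by blast
    have HA: "H \<in> A" using H C by auto
    have d: "aff_dim (\<Inter>(insert H B)) = aff_dim (\<Inter>B) - 1"
      using aff_dim_Inter_insert[OF less.prems(1) HA ne] H by simp
    have "\<exists>B'\<in>codim_fam i. insert H B \<subseteq> B'"
    proof (rule less.hyps)
      show "insert H B \<subseteq> A" using HA less.prems by simp
      show "\<Inter>(insert H B) \<noteq> {}" using ne by (simp add: Int_commute)
      show "int CARD('n) - int i \<le> aff_dim (\<Inter>(insert H B))"
        unfolding d using False less.prems by linarith
      show "nat (aff_dim (\<Inter>(insert H B)) - (int CARD('n) - int i)) <
          nat (aff_dim (\<Inter>B) - (int CARD('n) - int i))"
        unfolding d using False less.prems by linarith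
    qed
    then show ?thesis by auto
  qed
qed

text \<open>Each hyperplane lowers the dimension by at most one, so no dimension is skipped when
  \<open>B\<close> is built up one member at a time.\<close>

lemma codim_fam_shrink:
  assumes "B \<subseteq> A" "\<Inter>B \<noteq> {}" "aff_dim (\<Inter>B) \<le> int CARD('n) - int i"
  shows "\<exists>B'\<in>codim_fam i. B' \<subseteq> B"
proof -
  have "finite B" using assms(1) finite_A finite_subset by blast
  then show ?thesis using assms
  proof (induction B rule: finite_induct)
    case empty
    then have "i = 0" by simp
    then show ?case by (intro bexI[of _ "{}"]) (auto simp: codim_fam_def)
  next
    case (insert H B)
    have B: "B \<subseteq> A" "H \<in> A" "\<Inter>B \<noteq> {}" "\<Inter>B \<inter> H \<noteq> {}"
      using insert.prems by auto
    show ?case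
    proof (cases "aff_dim (\<Inter>B) \<le> int CARD('n) - int i")
      case True
      then have "\<exists>B'\<in>codim_fam i. B' \<subseteq> B" using insert.IH B by simp
      then show ?thesis by auto
    next
      case False
      have "aff_dim (\<Inter>(insert H B)) \<ge> aff_dim (\<Inter>B) - 1"
        unfolding aff_dim_Inter_insert[OF B(1,2,4)] by simp
      then have "insert H B \<in> codim_fam i"
        unfolding codim_fam_def using False insert.prems by simp
      then show ?thesis by blast
    qed
  qed
qed

lemma Inter_active:
  assumes "0 < fst x"
  shows "active x \<subseteq> A" "\<Inter>(active x) \<noteq> {}"
proof -
  show "active x \<subseteq> A" by (auto simp: active_def)
  have "hom (pnt x) = x /\<^sub>R fst x" using assms by (intro hom_pnt) simp
  then have "pnt x \<in> \<Inter>(active x)" using mem_A_iff by (auto simp: active_def)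
  then show "\<Inter>(active x) \<noteq> {}" by blast
qed

text \<open>Either the hyperplanes through \<open>x\<close> already contain a family of codimension
  \<open>i\<close>, or they extend to one of codimension \<open>i - 1\<close>, whose directions in
  \<open>Lh B\<close> keep all active hyperplanes active.\<close>

lemma active_dichotomy:
  assumes "0 < fst x" "1 \<le> i" "i \<le> CARD('n)"
  shows "(\<exists>B\<in>codim_fam i. B \<subseteq> active x) \<or> (\<exists>B\<in>codim_fam (i - 1). active x \<subseteq> B)"
proof (cases "aff_dim (\<Inter>(active x)) \<le> int CARD('n) - int i")
  case True
  then show ?thesis using codim_fam_shrink[OF Inter_active] assms by blast
next
  case False
  then have "int CARD('n) - int (i - 1) \<le> aff_dim (\<Inter>(active x))" using assms by simp
  then have "\<exists>B\<in>codim_fam (i - 1). active x \<subseteq> B"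
    using codim_fam_extend[OF Inter_active[OF assms(1)]] assms by simp
  then show ?thesis by blast
qed

lemma active_subset_codim_fam_top:
  assumes "0 < fst x"
  shows "\<exists>B\<in>codim_fam CARD('n). active x \<subseteq> B"
proof -
  have "0 \<le> aff_dim (\<Inter>(active x))"
    using aff_dim_negative_iff[of "\<Inter>(active x)"] Inter_active(2)[OF assms]
      by (metis linorder_not_less)
  then show ?thesis
    using codim_fam_extend[OF Inter_active[OF assms], of "CARD('n)"] by simp
qed

lemma codim_fam_superset:
  assumes "B \<in> codim_fam i" "j \<le> i"
  shows "\<exists>B'\<in>codim_fam j. B' \<subseteq> B"
  using codim_fam_shrink[of B j] codim_famD[OF assms(1)] assms(2) by auto

section \<open>Consequences of genericity\<close>

text \<open>The condition \<theta>_j < \<delta> is written as x_j > cos \<delta> times the tail,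
  which is convex in \<open>x\<close>. A positive last coordinate makes all angles positive.\<close>

definition sec_cone :: "(real \<times> (real^'n)) set" where
  "sec_cone = {x. (\<forall>j. 1 \<le> j \<and> j < CARD('n) \<longrightarrow> cos \<delta> * tail j x < x \<bullet> eh j) \<and> 0 < x \<bullet> eh CARD('n)}"

text \<open>The closed counterpart of \<open>sec_cone\<close> for the coordinates from
  \<open>i\<close> on: angles in [0, \<delta>], for which the half-flats meet the closed
  sector.\<close>

definition sector_dirs :: "nat \<Rightarrow> (real \<times> (real^'n)) set" where
  "sector_dirs i = {u \<in> Dh i. u \<noteq> 0 \<and> (i = 0 \<longrightarrow> 0 < fst u) \<and> 0 \<le> u \<bullet> eh CARD('n) \<and>
     (\<forall>j. 1 \<le> j \<and> i \<le> j \<and> j < CARD('n) \<longrightarrow> cos \<delta> * tail j u \<le> u \<bullet> eh j)}"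

lemma N_pos: "1 \<le> CARD('n)"
  by (simp add: Suc_leI)

lemma delta: "0 < \<delta>" "\<delta> < pi / 2" "0 < cos \<delta>"
  using gen cos_gt_zero[of \<delta>] by (auto simp: generic_polar_def)

lemma sector_eq: "sector p e \<delta> = {q. hom q \<in> sec_cone}"
proof -
  let ?n = "CARD('n)"
  have "hom q \<in> sec_cone" if q: "q \<in> sector p e \<delta>" for q
  proof -
    obtain t where t: "is_polar p e q t" "0 < t 0" "\<forall>i\<in>{1..<?n}. 0 < t i \<and> t i < \<delta>"
      using q unfolding sector_def by blast
    have "0 < t 0 * (\<Prod>j\<in>{1..<?n}. sin (t j))"
    proof (intro mult_pos_pos prod_pos ballI sin_gt_zero)
      fix j assume "j \<in> {1..<?n}"
      then show "0 < t j" "t j < pi" using t(3) delta(2) pi_gt_zero by fastforce+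
    qed (rule t(2))
    then have xn: "0 < hom q \<bullet> eh ?n"
      using t(1) N_pos by (auto simp: is_polar_def Let_def eh_pos)
    then have lp: "hom q \<in> lpos" by (auto simp: lpos_def Vh_top intro!: exI[of _ ?n])
    have ta: "t = ang (hom q)" using is_polar_unique[OF lp t(1)] .
    have "cos \<delta> * tail j (hom q) < hom q \<bullet> eh j" if j: "1 \<le> j" "j < ?n" for j
    proof -
      have T: "0 < tail j (hom q)"
        using abs_coord_le_tail[of j ?n "hom q"] xn j by simp
      have "cos \<delta> < cos (ang (hom q) j)"
        using bspec[OF t(3), of j] j ta delta by (intro cos_monotone_0_pi) auto
      then show ?thesis
        using T tail_mult_cos(1)[OF lp j] by (metis mult.commute mult_strict_left_mono)
    qed
    then show ?thesis using xn by (simp add: sec_cone_def)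
  qed
  moreover have "q \<in> sector p e \<delta>" if "hom q \<in> sec_cone" for q
  proof -
    have xn: "0 < hom q \<bullet> eh ?n" and xj:
      "\<And>j. 1 \<le> j \<Longrightarrow> j < ?n \<Longrightarrow> cos \<delta> * tail j (hom q) < hom q \<bullet> eh j"
      using that by (auto simp: sec_cone_def)
    have lp: "hom q \<in> lpos" using xn by (auto simp: lpos_def Vh_top intro!: exI[of _ ?n])
    have T: "0 < tail j (hom q)" if "j \<le> ?n" for j
      using abs_coord_le_tail[of j ?n "hom q"] xn that by simp
    have nV: "hom q \<notin> Vh (Suc j)" if "j < ?n" for j
      using T[of "Suc j"] that tail_eq_0[of "Suc j" "hom q"] by auto
    have "ang (hom q) j < \<delta>" if j: "1 \<le> j" "j < ?n" for j
    proof (rule ccontr)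
      assume "\<not> ang (hom q) j < \<delta>"
      then have "cos (ang (hom q) j) \<le> cos \<delta>"
        using delta ang_le_pi[of j "hom q"] j by (intro cos_monotone_0_pi_le) auto
      then have "hom q \<bullet> eh j \<le> cos \<delta> * tail j (hom q)"
        using tail_mult_cos(1)[OF lp j] T[of j] j by (metis less_imp_le mult.commute mult_left_mono)
      then show False using xj[OF j] by simp
    qed
    then show ?thesis
      unfolding sector_def using is_polar_ang[OF lp] nV N_pos
      by (auto intro!: exI[of _ "ang (hom q)"] ang_pos)
  qed
  ultimately show ?thesis by blast
qed

lemma continuous_on_tail: "continuous_on S (\<lambda>r. tail j (hom r))"
  unfolding tail_def by (intro continuous_intros)

lemma closure_sectorD:
  assumes "q \<in> closure (sector p e \<delta>)"
  shows "0 \<le> hom q \<bullet> eh CARD('n)"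
    and "1 \<le> j \<Longrightarrow> j < CARD('n) \<Longrightarrow> cos \<delta> * tail j (hom q) \<le> hom q \<bullet> eh j"
proof -
  let ?S = "{q. (\<forall>j. 1 \<le> j \<and> j < CARD('n) \<longrightarrow> cos \<delta> * tail j (hom q) \<le> hom q \<bullet> eh j)
    \<and> 0 \<le> hom q \<bullet> eh CARD('n)}"
  have "closed ?S"
    by (intro closed_Collect_conj closed_Collect_all closed_Collect_imp open_Collect_const
      closed_Collect_le continuous_intros continuous_on_tail)
  moreover have "sector p e \<delta> \<subseteq> ?S"
    by (auto simp: sector_eq sec_cone_def less_imp_le)
  ultimately have "closure (sector p e \<delta>) \<subseteq> ?S" by (simp add: closure_minimal)
  then show "0 \<le> hom q \<bullet> eh CARD('n)"
    and "1 \<le> j \<Longrightarrow> j < CARD('n) \<Longrightarrow> cos \<delta> * tail j (hom q) \<le> hom q \<bullet> eh j"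
    using assms by auto
qed

text \<open>The conditions are convex, because the tail is a seminorm, so the segment from
  \<open>q\<close> to a point of the open sector runs in the sector.\<close>

lemma in_closure_sector:
  assumes z: "hom z \<in> sec_cone" and q: "0 \<le> hom q \<bullet> eh CARD('n)"
    "\<And>j. 1 \<le> j \<Longrightarrow> j < CARD('n) \<Longrightarrow> cos \<delta> * tail j (hom q) \<le> hom q \<bullet> eh j"
  shows "q \<in> closure (sector p e \<delta>)"
proof (rule in_closure_if_segment[of _ z])
  fix t :: real assume t: "0 < t" "t \<le> 1"
  have "cos \<delta> * tail j (hom ((1 - t) *\<^sub>R q + t *\<^sub>R z)) < hom ((1 - t) *\<^sub>R q + t *\<^sub>R z) \<bullet> eh j"
    if j: "1 \<le> j" "j < CARD('n)" for j
  proof -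
    have "tail j (hom ((1 - t) *\<^sub>R q + t *\<^sub>R z)) \<le> (1 - t) * tail j (hom q) + t * tail j (hom z)"
      unfolding hom_convex using tail_triangle[of j "(1 - t) *\<^sub>R hom q" "t *\<^sub>R hom z"] t
      by (simp add: tail_scale)
    then have "cos \<delta> * tail j (hom ((1 - t) *\<^sub>R q + t *\<^sub>R z)) \<le>
        (1 - t) * (cos \<delta> * tail j (hom q)) + t * (cos \<delta> * tail j (hom z))"
      using mult_left_mono[OF _ less_imp_le[OF delta(3)]] by (fastforce simp: algebra_simps)
    also have "\<dots> < (1 - t) * (hom q \<bullet> eh j) + t * (hom z \<bullet> eh j)"
      using q(2)[OF j] z j t
      by (intro add_le_less_mono mult_left_mono mult_strict_left_mono) (auto simp: sec_cone_def)
    finally show ?thesis unfolding hom_convex by (simp add: inner_add_left)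
  qed
  moreover have "0 < hom ((1 - t) *\<^sub>R q + t *\<^sub>R z) \<bullet> eh CARD('n)"
    unfolding hom_convex using q(1) z t
    by (auto simp: inner_add_left sec_cone_def intro!: add_nonneg_pos mult_nonneg_nonneg)
  ultimately show "(1 - t) *\<^sub>R q + t *\<^sub>R z \<in> sector p e \<delta>"
    by (simp add: sector_eq sec_cone_def)
qed

text \<open>The sign vector of a vertex is attained nowhere else. A vertex is therefore a bounded
  facet, and bounded facets lie in the sector.\<close>

lemma vertex_in_sector:
  assumes "B \<in> codim_fam CARD('n)" "q \<in> \<Inter>B"
  shows "hom q \<in> sec_cone" "\<Inter>B = {q}"
proof -
  have "aff_dim (\<Inter>B) = 0" using codim_famD(3)[OF assms(1)] by simp
  then obtain a where "\<Inter>B = {a}" using aff_dim_eq_0 by blast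
  then show sing: "\<Inter>B = {q}" using assms(2) by simp
  let ?F = "{r. sign_eq (hom q) (hom r)}"
  have "?F \<subseteq> \<Inter>B"
  proof
    fix r assume "r \<in> ?F"
    moreover have "hom q \<in> Lh B" using assms(2) Inter_iff[OF codim_famD(1)[OF assms(1)]] by blast
    ultimately have "hom r \<in> Lh B"
      using codim_famD(1)[OF assms(1)] unfolding Lh_def sign_eq_def mem_Collect_eq
      by (metis sgn_0 sgn_zero_iff subsetD)
    then show "r \<in> \<Inter>B" using Inter_iff[OF codim_famD(1)[OF assms(1)]] by blast
  qed
  then have "bounded ?F" using sing by (metis bounded_insert bounded_empty bounded_subset)
  then have "?F \<subseteq> sector p e \<delta>" using facet_of gen unfolding generic_polar_def by blast
  moreover have "q \<in> ?F" by (simp add: sign_eq_refl)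
  ultimately show "hom q \<in> sec_cone" by (auto simp: sector_eq)
qed

lemma codim_fam_top_nonempty: "codim_fam CARD('n) \<noteq> {}"
  using codim_fam_extend[of "{}" "CARD('n)"] by auto

lemma sec_cone_nonempty: obtains z where "hom z \<in> sec_cone"
proof -
  obtain B where B: "B \<in> codim_fam CARD('n)" using codim_fam_top_nonempty by auto
  then obtain q where "q \<in> \<Inter>B" using codim_famD(2) by blast
  then show ?thesis using vertex_in_sector(1)[OF B] that by blast
qed

text \<open>At the last nonzero coordinate the tail is the absolute value, so the sector inequality
  with cos \<delta> > 0 forces a positive sign; the indices 0 and n are covered by the explicit
  conditions.\<close>

lemma sector_dirs_lpos:
  assumes "u \<in> sector_dirs i"
  shows "u \<in> lpos"
proof -
  let ?n = "CARD('n)"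
  have u: "u \<in> Dh i" "u \<noteq> 0" using assms by (auto simp: sector_dirs_def)
  let ?S = "{k. k \<le> ?n \<and> u \<bullet> eh k \<noteq> 0}"
  have S: "finite ?S" "?S \<noteq> {}" using eh_complete[of u] u by auto
  define k where "k = Max ?S"
  have k: "k \<in> ?S" using Max_in[OF S] by (simp add: k_def)
  have V: "u \<in> Vh (Suc k)"
  proof -
    have "l \<notin> ?S" if "Suc k \<le> l" for l using Max_ge[OF S(1), of l] that unfolding k_def by linarith
    then show ?thesis unfolding Vh_def by blast
  qed
  have ik: "i \<le> k" using Dh_inner[OF u(1), of k] k
    by (metis (mono_tags, lifting) mem_Collect_eq not_le)
  have "0 < u \<bullet> eh k"
  proof -
    consider "k = ?n" | "1 \<le> k" "k < ?n" | "k = 0" "i = 0" using k ik by fastforce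
    then show ?thesis
    proof cases
      case 1
      then show ?thesis using assms k by (auto simp: sector_dirs_def)
    next
      case 2
      have "(tail k u)\<^sup>2 = (u \<bullet> eh k)\<^sup>2" using tail_Suc[of k u] V 2
        by (simp add: tail_eq_0[symmetric])
      then have "0 < tail k u" using k tail_nonneg[of k u] by (auto simp: order_le_less)
      then have "0 < cos \<delta> * tail k u" using delta by simp
      then show ?thesis using assms 2 ik by (fastforce simp: sector_dirs_def)
    next
      case 3
      then show ?thesis using assms by (simp add: sector_dirs_def eh_0)
    qed
  qed
  then show ?thesis using V k by (auto simp: lpos_def)
qed

lemma eh_lpos: "i \<le> CARD('n) \<Longrightarrow> eh i \<in> lpos"
  unfolding lpos_def using eh_orthonormal eh_in_Vh by fastforce

text \<open>\<open>eh i\<close> is the direction of V_i(0, ..., 0). It serves as the direction at an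
  index below the current dimension and as the source of the directions of ascent towards a
  vertex.\<close>

lemma eh_sector_dirs: "i \<le> CARD('n) \<Longrightarrow> eh i \<in> sector_dirs i"
proof -
  assume i: "i \<le> CARD('n)"
  have "tail j (eh i) \<le> 1" if "i \<le> j" for j
  proof (cases "i = j")
    case True
    have "(tail i (eh i))\<^sup>2 = 1"
      using tail_Suc[OF i, of "eh i"] eh_in_Vh[of i "Suc i"] i
      by (simp add: eh_orthonormal tail_eq_0[symmetric])
    then show ?thesis using True tail_nonneg[of i "eh i"] by (simp add: power2_eq_1_iff)
  next
    case False
    then show ?thesis using that eh_in_Vh[of i j] i by (simp add: tail_eq_0[symmetric])
  qed
  moreover have "tail j (eh i) = 0" if "i < j" for j using eh_in_Vh[of i j] i that
    by (simp add: tail_eq_0)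
  ultimately have "cos \<delta> * tail j (eh i) \<le> eh i \<bullet> eh j" if "i \<le> j" "j < CARD('n)" for j
    using that i delta by (cases
      "i = j") (auto simp: eh_orthonormal intro: order_trans[OF mult_left_le])
  moreover have "eh i \<noteq> 0" using eh_orthonormal[OF i i] by auto
  ultimately show ?thesis
    unfolding sector_dirs_def using eh_in_Dh[of i i] i eh_0[of "eh 0"] eh_orthonormal[of 0 0]
    by (auto simp: eh_orthonormal)
qed

text \<open>The coordinates below \<open>i\<close> are copied from a point of the open sector, the
  remaining ones are those of \<open>r *\<^sub>R u\<close>. The conditions below \<open>i\<close>
  are strict and survive for small \<open>r\<close>; those from \<open>i\<close> on are homogeneous
  in \<open>u\<close>.\<close>

lemma cone_meets_closure_sector:
  assumes u: "u \<in> sector_dirs i" and i: "1 \<le> i" "i < CARD('n)"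
  shows "cone i u \<inter> closure (sector p e \<delta>) \<noteq> {}"
proof -
  let ?n = "CARD('n)"
  obtain z where z: "hom z \<in> sec_cone" by (rule sec_cone_nonempty)
  define d where "d j = hom z \<bullet> eh j - cos \<delta> * tail j (hom z)" for j
  have dpos: "0 < d j" if "j \<in> {1..<i}" for j
    using z i that by (auto simp: sec_cone_def d_def)
  obtain r where r: "0 < r" "\<forall>j\<in>{1..<i}. r * (cos \<delta> * tail j u) < d j"
    using small_scaling[of "{1..<i}" d "\<lambda>j. cos \<delta> * tail j u"] dpos by blast
  obtain y where "\<forall>j\<le>?n. y \<bullet> eh j = (if j < i then hom z \<bullet> eh j else 0)"
    using eh_coords[of "\<lambda>j. if j < i then hom z \<bullet> eh j else 0"] by blast
  then have y: "y \<bullet> eh j = (if j < i then hom z \<bullet> eh j else 0)" if "j \<le> ?n" for j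
    using that by blast
  define x where "x = y + r *\<^sub>R u"
  have uD: "u \<in> Dh i" using u by (simp add: sector_dirs_def)
  have xlo: "x \<bullet> eh j = hom z \<bullet> eh j" if "j < i" for j
    using y[of j] that i Dh_inner[OF uD that] by (simp add: x_def inner_add_left)
  have yV: "y \<in> Vh i" using y by (auto simp: Vh_def)
  have "fst x = 1" using xlo[of 0] i by (simp add: eh_0)
  then have q: "hom (pnt x) = x" by (simp add: hom_pnt)
  have "pnt x \<in> cone i u" unfolding cone_def using q r(1) yV by (auto simp: x_def)
  moreover have "pnt x \<in> closure (sector p e \<delta>)"
  proof (rule in_closure_sector[OF z])
    show "0 \<le> hom (pnt x) \<bullet> eh ?n"
      unfolding q using y[of ?n] i u r(1) by (simp add: x_def inner_add_left sector_dirs_def)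
    fix j assume j: "1 \<le> j" "j < ?n"
    show "cos \<delta> * tail j (hom (pnt x)) \<le> hom (pnt x) \<bullet> eh j"
    proof (cases "j < i")
      case True
      have "tail j y \<le> tail j (hom z)"
        unfolding tail_def using y by (intro real_sqrt_le_mono sum_mono) auto
      then have "tail j x \<le> tail j (hom z) + r * tail j u"
        using tail_triangle[of j y "r *\<^sub>R u"] r(1) by (simp add: x_def tail_scale)
      then have "cos \<delta> * tail j x \<le> cos \<delta> * (tail j (hom z) + r * tail j u)"
        using delta(3) by simp
      also have "\<dots> < hom z \<bullet> eh j" using bspec[OF r(2), of j] True j
        by (simp add: d_def algebra_simps)
      finally show ?thesis using q xlo[OF True] by simp
    next
      case False
      have "x - r *\<^sub>R u \<in> Vh j" using yV Vh_mono[of i j] False by (auto simp: x_def)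
      then have "tail j x = r * tail j u" "x \<bullet> eh j = r * (u \<bullet> eh j)"
        using tail_Vh[of x "r *\<^sub>R u" j] r(1) Vh_inner[of "x - r *\<^sub>R u" j j] j
        by (auto simp: tail_scale inner_diff_left)
      moreover have "cos \<delta> * tail j u \<le> u \<bullet> eh j" using u j False by (simp add: sector_dirs_def)
      ultimately show ?thesis using q r(1) mult_left_mono[of "cos \<delta> * tail j u" "u \<bullet> eh j" r]
        by (simp add: mult.left_commute)
    qed
  qed
  ultimately show ?thesis by blast
qed

lemma half_flat_generic:
  assumes u: "u \<in> sector_dirs i" and i: "1 \<le> i" "i \<le> CARD('n)"
  shows "half_flat p e i (ang u) \<inter> closure (sector p e \<delta>) \<noteq> {}"
    and "q \<in> half_flat p e i (ang u) \<longleftrightarrow> i = CARD('n) \<or> q \<in> cone i u"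
proof -
  have c: "half_flat p e i (ang u) = cone i u" if "i < CARD('n)"
    using half_flat_eq_cone[OF that, of u "ang u"] u sector_dirs_lpos[OF u] i
      by (auto simp: sector_dirs_def)
  obtain z where "hom z \<in> sec_cone" by (rule sec_cone_nonempty)
  then have "z \<in> closure (sector p e \<delta>)"
    by (intro subsetD[OF closure_subset]) (simp add: sector_eq)
  then show "half_flat p e i (ang u) \<inter> closure (sector p e \<delta>) \<noteq> {}"
    using c cone_meets_closure_sector[OF u i(1)] i(2)
      by (cases "i = CARD('n)") (auto simp: half_flat_def)
  show "q \<in> half_flat p e i (ang u) \<longleftrightarrow> i = CARD('n) \<or> q \<in> cone i u"
    using c i by (cases "i = CARD('n)") (auto simp: half_flat_def)
qed

text \<open>For codimension \<open>k = i\<close> the dimension condition makes the flat and the span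
  of the half-flat meet in a single point.\<close>

lemma generic_point:
  assumes u: "u \<in> sector_dirs i" and i: "1 \<le> i" "i \<le> CARD('n)" and B: "B \<in> codim_fam i"
  obtains q s where "hom q \<in> Lh B" "0 < s" "hom q - s *\<^sub>R u \<in> Vh i" "q \<in> closure (sector p e \<delta>)"
    "half_flat p e i (ang u) \<inter> \<Inter>B = {q}"
proof -
  let ?n = "CARD('n)" and ?V = "half_flat p e i (ang u)"
  have fl: "\<Inter>B \<in> flats A" using codim_famD[OF B] by (auto simp: flats_def)
  have "?V \<inter> \<Inter>B \<inter> closure (sector p e \<delta>) \<noteq> {} \<and> aff_dim (affine hull ?V \<inter> \<Inter>B) = int i - int i"
    using gen half_flat_generic(1)[OF u i] fl codim_famD(3)[OF B] i(2)
    unfolding generic_polar_def by blast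
  then obtain q where q: "q \<in> ?V" "q \<in> \<Inter>B" "q \<in> closure (sector p e \<delta>)"
    and "aff_dim (affine hull ?V \<inter> \<Inter>B) = 0" by auto
  then obtain a where a: "affine hull ?V \<inter> \<Inter>B = {a}" using aff_dim_eq_0 by blast
  have "?V \<inter> \<Inter>B \<subseteq> {a}" unfolding a[symmetric] by (intro Int_mono hull_subset order_refl)
  moreover have "q \<in> ?V \<inter> \<Inter>B" using q by (rule_tac IntI)
  ultimately have 1: "?V \<inter> \<Inter>B = {q}" by (metis singletonD subset_singletonD empty_iff)
  have 2: "hom q \<in> Lh B" using Inter_iff[OF codim_famD(1)[OF B]] q by blast
  have "\<exists>s>0. hom q - s *\<^sub>R u \<in> Vh i"
  proof (cases "i = ?n")
    case True
    \<comment> \<open>For \<open>i = n\<close> the half-flat is all of space and prescribes no sign;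
      positivity comes from the vertex lying in the sector.\<close>
    have qn: "0 < hom q \<bullet> eh ?n"
      using vertex_in_sector(1)[of B q] B True q by (simp add: sec_cone_def)
    have u': "u \<in> Dh ?n" using u True by (simp add: sector_dirs_def)
    have un: "0 < u \<bullet> eh ?n"
    proof -
      have "u \<notin> Vh ?n" using Dh_Int_Vh[OF u'] u by (auto simp: sector_dirs_def)
      then have "u \<bullet> eh ?n \<noteq> 0" using Vh_SucD[of u ?n] Vh_top[of "Suc ?n"] by auto
      moreover have "0 \<le> u \<bullet> eh ?n" using u by (simp add: sector_dirs_def)
      ultimately show ?thesis by simp
    qed
    let ?s = "hom q \<bullet> eh ?n / (u \<bullet> eh ?n)"
    have "hom q - ?s *\<^sub>R u \<in> Vh ?n"
      using un by (auto simp: Vh_def inner_diff_left)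
    then show ?thesis using True qn un by (intro exI[of _ ?s]) simp
  next
    case False
    then show ?thesis using q(1) half_flat_generic(2)[OF u i] by (auto simp: cone_def)
  qed
  then show ?thesis using that 1 2 q(3) by blast
qed

text \<open>A nonzero vector in both spaces, added to the lift of the intersection point with V_i(0,
  ..., 0), would produce a second intersection point; a mere rescaling of the first is excluded by
  coordinate \<open>i\<close>.\<close>

lemma Lh_Int_Vh:
  assumes B: "B \<in> codim_fam i" and i: "i \<le> CARD('n)" and z: "z \<in> Lh B" "z \<in> Vh i"
  shows "z = 0"
proof (cases "i = 0")
  case True
  then show ?thesis using z Vh_0 by simp
next
  case False
  then have i1: "1 \<le> i" by simp
  have D: "eh i \<in> sector_dirs i" by (rule eh_sector_dirs[OF i])
  obtain q s where q: "hom q \<in> Lh B" "0 < s" "hom q - s *\<^sub>R eh i \<in> Vh i"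
    "half_flat p e i (ang (eh i)) \<inter> \<Inter>B = {q}"
    using generic_point[OF D i1 i B] by metis
  \<comment> \<open>The sign keeps the first coordinate of \<open>x\<close> at least 1, so that
    \<open>x\<close> again lies over a point.\<close>
  define t :: real where "t = (if 0 \<le> fst z then 1 else - 1)"
  define x where "x = hom q + t *\<^sub>R z"
  have f: "0 < fst x" by (auto simp: x_def t_def)
  have hx: "hom (pnt x) = (1 / fst x) *\<^sub>R x" using hom_pnt[of x] f by (simp add: divide_inverse)
  have xL: "x \<in> Lh B" using Lh_add[OF q(1) Lh_scale[OF z(1)]] by (simp add: x_def)
  then have "pnt x \<in> \<Inter>B" using Inter_iff[OF codim_famD(1)[OF B]] hx Lh_scale by simp
  moreover have "x - s *\<^sub>R eh i \<in> Vh i"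
    using Vh_add[OF q(3) Vh_scale[OF z(2), of t]] by (simp add: x_def algebra_simps)
  then have "hom (pnt x) - (s / fst x) *\<^sub>R eh i \<in> Vh i"
    using Vh_scale[of "x - s *\<^sub>R eh i" i "1 / fst x"] by (simp add: hx algebra_simps)
  then have "pnt x \<in> cone i (eh i)" using q(2) f
    by (auto simp: cone_def intro!: exI[of _ "s / fst x"])
  then have "pnt x \<in> half_flat p e i (ang (eh i))" using half_flat_generic(2)[OF D i1 i] by simp
  ultimately have "pnt x = q" using q(4) by blast
  then have "fst x *\<^sub>R hom q = x" using hx f by simp
  then have *: "t *\<^sub>R z = (fst x - 1) *\<^sub>R hom q" by (simp add: x_def algebra_simps)
  have "hom q \<bullet> eh i = s" using Vh_inner[OF q(3), of i] i
    by (simp add: inner_diff_left eh_orthonormal)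
  moreover have "t * (z \<bullet> eh i) = (fst x - 1) * (hom q \<bullet> eh i)" using * by (metis inner_scaleR_left)
  moreover have "z \<bullet> eh i = 0" using Vh_inner[OF z(2)] i by simp
  ultimately have "fst x = 1" using q(2) by simp
  then show ?thesis using * by (auto simp: t_def split: if_splits)
qed

text \<open>\<open>Lh B\<close> contains the directions of the flat at height 0 and in addition the
  lift of one of its points.\<close>

lemma dim_Lh:
  assumes B: "B \<in> codim_fam i"
  shows "int (dim (Lh B)) \<ge> int CARD('n) - int i + 1"
proof -
  obtain q where q: "q \<in> \<Inter>B" using codim_famD(2)[OF B] by blast
  have qL: "hom q \<in> Lh B" using q Inter_iff[OF codim_famD(1)[OF B]] by blast
  let ?S = "{v. (0, v) \<in> Lh B}"
  have sub: "subspace ?S"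
    using Lh_zero[of B] Lh_add[of "(0, _)" B "(0, _)"] Lh_scale[of "(0, _)" B]
    by (auto simp: subspace_def zero_prod_def)
  have "\<Inter>B = (+) q ` ?S"
  proof -
    have "r \<in> \<Inter>B \<longleftrightarrow> r - q \<in> ?S" for r
    proof -
      have *: "hom r = hom q + (0, r - q)" "(0, r - q) = hom r - hom q" by (auto simp: hom_def)
      then have "hom r \<in> Lh B \<longleftrightarrow> (0, r - q) \<in> Lh B"
        using Lh_add[OF qL] Lh_diff[OF _ qL] by metis
      then show ?thesis using Inter_iff[OF codim_famD(1)[OF B]] by simp
    qed
    then show ?thesis by (force simp: image_iff intro: bexI[of _ "_ - q"])
  qed
  then have "aff_dim (\<Inter>B) = int (dim ?S)"
    using aff_dim_translation_eq[of q ?S] aff_dim_subspace[OF sub] by simp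
  then have d: "int (dim ?S) = int CARD('n) - int i" using codim_famD(3)[OF B] by simp
  have lin: "linear (Pair (0::real) :: real^'n \<Rightarrow> _)"
    by (rule linearI) auto
  have "dim (Pair (0::real) ` ?S) = dim ?S"
    by (rule dim_image_eq[OF lin]) (auto simp: inj_on_def)
  moreover have "hom q \<notin> span (Pair 0 ` ?S)"
  proof
    assume "hom q \<in> span (Pair 0 ` ?S)"
    moreover have "span (Pair (0::real) ` ?S) \<subseteq> {x. fst x = 0}"
      by (rule span_minimal) (auto simp: subspace_def)
    ultimately show False by auto
  qed
  ultimately have "dim (insert (hom q) (Pair 0 ` ?S)) = dim ?S + 1"
    by (simp add: dim_insert)
  moreover have "dim (insert (hom q) (Pair 0 ` ?S)) \<le> dim (Lh B)"
    using qL by (intro dim_subset) auto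
  ultimately show ?thesis using d by simp
qed

text \<open>The two spaces meet trivially and their dimensions add up to at least n + 1.\<close>

lemma Lh_plus_Vh:
  assumes B: "B \<in> codim_fam i" and i: "i \<le> CARD('n)"
  shows "\<exists>z\<in>Lh B. z - u \<in> Vh i"
proof -
  let ?S = "{x + y |x y. x \<in> Lh B \<and> y \<in> Vh i}"
  have "Lh B \<inter> Vh i = {0}" using Lh_Int_Vh[OF B i] Lh_zero Vh_zero by auto
  then have "dim ?S = dim (Lh B) + dim (Vh i)"
    using dim_sums_Int[OF subspace_Lh subspace_Vh, of B i] by simp
  then have "int (dim ?S) \<ge> int CARD('n) + 1" using dim_Lh[OF B] dim_Vh[of i] i by simp
  then have "dim ?S \<ge> DIM(real \<times> (real^'n))" by simp
  then have "?S = UNIV"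
    using subspace_sums[OF subspace_Lh subspace_Vh, of B i] dim_eq_full[of ?S]
      dim_subset_UNIV[of ?S] span_eq_iff by (metis (no_types, lifting) le_antisym)
  then have "u \<in> ?S" by simp
  then obtain x y where "x \<in> Lh B" "y \<in> Vh i" "u = x + y" by blast
  then show ?thesis using Vh_scale[of y i "-1"] by (intro bexI[of _ x]) auto
qed

section \<open>Vertices and minimum points\<close>

text \<open>For \<open>B \<in> codim_fam i\<close> the vector \<open>flat_proj B i u\<close> spans the line over the single point in which the flat
  meets \<open>V\<^sub>i(u)\<close>. It depends linearly on \<open>u\<close>, and this makes the polar ordering semilinear in \<open>u\<close>.

  The vector \<open>u + c *\<^sub>R eh i\<close> in the definition of \<open>adm_cone (Suc i)\<close> is the direction of the half-flat of
  dimension \<open>i\<close> through that point. The cones are open, so an angle equal to \<open>\<delta>\<close> can still be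
  increased by \<open>\<epsilon>\<close>.\<close>

definition flat_proj :: "(real^'n) set set \<Rightarrow> nat \<Rightarrow> real \<times> (real^'n) \<Rightarrow> real \<times> (real^'n)" where
  "flat_proj B i u = (THE z. z \<in> Lh B \<and> z - u \<in> Vh i)"

primrec adm_cone :: "nat \<Rightarrow> (real \<times> (real^'n)) set" where
  "adm_cone 0 = {u. 0 < fst u}"
| "adm_cone (Suc i) = {u. \<forall>B\<in>codim_fam (Suc i). u + ((flat_proj B (Suc i) u - u) \<bullet> eh i) *\<^sub>R eh i
  \<in> adm_cone i}"

definition good_dirs :: "nat \<Rightarrow> (real \<times> (real^'n)) set" where
  "good_dirs i = Dh i \<inter> adm_cone i \<inter> lpos"

text \<open>The closed facet within V_k(v), each point being represented by the multiple whose
  coordinates from \<open>k\<close> on are those of \<open>v\<close>. After this normalisation a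
  minimal angle is the extremum of a linear form.\<close>

definition slice :: "real \<times> (real^'n) \<Rightarrow> nat \<Rightarrow> real \<times> (real^'n) \<Rightarrow> (real \<times> (real^'n)) set" where
  "slice y k v = {x. x - v \<in> Vh k \<and> 0 < fst x \<and> weak_conf y x}"

text \<open>All elements of a slice have the same tail from \<open>k\<close> on, so the largest
  coordinate \<open>k - 1\<close> is the smallest angle \<theta>_(k-1).\<close>

definition top_vertex :: "real \<times> (real^'n) \<Rightarrow> nat \<Rightarrow> real \<times> (real^'n) \<Rightarrow> real \<times> (real^'n) \<Rightarrow> bool" where
  "top_vertex y k v x \<longleftrightarrow> x \<in> slice y k v \<and> (\<forall>z\<in>slice y k v. z \<bullet> eh (k - 1) \<le> x \<bullet> eh (k - 1))"

text \<open>For the representative of a facet: the closure misses V_(k-1), so the index of the facet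
  is at least \<open>k\<close>.\<close>

definition avoids :: "real \<times> (real^'n) \<Rightarrow> nat \<Rightarrow> bool" where
  "avoids y k \<longleftrightarrow> (\<forall>x\<in>Vh k. 0 < fst x \<longrightarrow> \<not> weak_conf y x)"

section \<open>Projections to flats and admissible directions\<close>

lemma flat_proj_eqI:
  assumes "B \<in> codim_fam i" "i \<le> CARD('n)" "z \<in> Lh B" "z - u \<in> Vh i"
  shows "flat_proj B i u = z"
  unfolding flat_proj_def
proof (rule the_equality)
  show "z \<in> Lh B \<and> z - u \<in> Vh i" using assms by simp
next
  fix w assume w: "w \<in> Lh B \<and> w - u \<in> Vh i"
  have "w - z \<in> Vh i" using Vh_diff[OF conjunct2[OF w] assms(4)] by simp
  then have "w - z = 0"
    using Lh_Int_Vh[OF assms(1,2)] Lh_diff[OF conjunct1[OF w] assms(3)] by blast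
  then show "w = z" by simp
qed

lemma flat_proj_props:
  assumes "B \<in> codim_fam i" "i \<le> CARD('n)"
  shows "flat_proj B i u \<in> Lh B" "flat_proj B i u - u \<in> Vh i"
proof -
  obtain z where z: "z \<in> Lh B" "z - u \<in> Vh i" using Lh_plus_Vh[OF assms] by blast
  then have "flat_proj B i u = z" by (intro flat_proj_eqI assms)
  with z show "flat_proj B i u \<in> Lh B" "flat_proj B i u - u \<in> Vh i" by simp_all
qed

lemma flat_proj_coord:
  assumes "B \<in> codim_fam i" "i \<le> j" "j \<le> CARD('n)"
  shows "flat_proj B i u \<bullet> eh j = u \<bullet> eh j"
  using Vh_inner[OF flat_proj_props(2), of B i j u] assms by (simp add: inner_diff_left)

lemma linear_flat_proj:
  assumes "B \<in> codim_fam i" "i \<le> CARD('n)"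
  shows "linear (flat_proj B i)"
proof (rule linearI)
  note p = flat_proj_props[OF assms]
  fix x y :: "real \<times> (real^'n)" and c :: real
  have "flat_proj B i x + flat_proj B i y - (x + y) \<in> Vh i"
    using Vh_add[OF p(2)[of x] p(2)[of y]] by (simp add: algebra_simps)
  then show "flat_proj B i (x + y) = flat_proj B i x + flat_proj B i y"
    using Lh_add p(1) by (intro flat_proj_eqI[OF assms]) auto
  have "c *\<^sub>R flat_proj B i x - c *\<^sub>R x \<in> Vh i"
    using Vh_scale[OF p(2)[of x], of c] by (simp add: algebra_simps)
  then show "flat_proj B i (c *\<^sub>R x) = c *\<^sub>R flat_proj B i x"
    using Lh_scale p(1) by (intro flat_proj_eqI[OF assms]) auto
qed

text \<open>Passing to the half-flat of dimension \<open>i\<close> through the vertex does not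
  change the vertex, whichever subfamily of codimension \<open>i\<close> is used.\<close>

lemma flat_proj_step:
  assumes "B \<in> codim_fam (Suc i)" "Suc i \<le> CARD('n)" "B' \<in> codim_fam i" "B' \<subseteq> B"
  shows "flat_proj B' i (u + ((flat_proj B (Suc i) u - u) \<bullet> eh i) *\<^sub>R eh i) = flat_proj B (Suc i) u"
proof (rule flat_proj_eqI[OF assms(3)])
  let ?z = "flat_proj B (Suc i) u" and ?c = "(flat_proj B (Suc i) u - u) \<bullet> eh i"
  show "i \<le> CARD('n)" using assms by simp
  show "?z \<in> Lh B'" using flat_proj_props(1)[OF assms(1,2)] Lh_antimono[OF assms(4)] by blast
  have "?z - u - ?c *\<^sub>R eh i \<in> Vh (Suc i)"
    using assms(2) by (intro Vh_diff[OF flat_proj_props(2)[OF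
      assms(1,2)]] Vh_scale eh_in_Vh) simp_all
  moreover have "(?z - u - ?c *\<^sub>R eh i) \<bullet> eh i = 0"
    using assms(2) by (simp add: inner_diff_left eh_orthonormal)
  ultimately have "?z - u - ?c *\<^sub>R eh i \<in> Vh i" by (rule Vh_SucD)
  then show "?z - (u + ?c *\<^sub>R eh i) \<in> Vh i" by (simp add: diff_diff_eq)
qed

lemma linear_shift:
  assumes "B \<in> codim_fam i" "i \<le> CARD('n)"
  shows "linear (\<lambda>u. u + ((flat_proj B i u - u) \<bullet> eh j) *\<^sub>R eh j)"
proof -
  interpret linear "flat_proj B i" by (rule linear_flat_proj[OF assms])
  show ?thesis
    by (rule linearI) (auto simp: add scaleR algebra_simps inner_add_left inner_diff_left)
qed

lemma open_adm_cone: "i \<le> CARD('n) \<Longrightarrow> open (adm_cone i)"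
proof (induction i)
  case 0
  show ?case by (simp add: open_Collect_less continuous_intros)
next
  case (Suc i)
  have "open ((\<lambda>u. u + ((flat_proj B (Suc i) u - u) \<bullet> eh i) *\<^sub>R eh i) -` adm_cone i)"
    if "B \<in> codim_fam (Suc i)" for B
    using Suc linear_continuous_on[OF linear_conv_bounded_linear[THEN iffD1,
      OF linear_shift[OF that Suc.prems]]]
    by (intro open_vimage) auto
  then have "open (\<Inter>B\<in>codim_fam (Suc i). (\<lambda>u. u + ((flat_proj B (Suc i) u - u) \<bullet> eh i) *\<^sub>R eh i) -` adm_cone i)"
    using finite_codim_fam by (intro open_INT) auto
  moreover have "adm_cone (Suc i)
    = (\<Inter>B\<in>codim_fam (Suc i). (\<lambda>u. u + ((flat_proj B (Suc i) u - u) \<bullet> eh i) *\<^sub>R eh i) -` adm_cone i)"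
    by auto
  ultimately show ?case by simp
qed

text \<open>By \<open>flat_proj_step\<close> the vector is the same on every lower level, and on
  level 0 it is the direction itself.\<close>

lemma adm_cone_pos:
  "i \<le> CARD('n) \<Longrightarrow> u \<in> adm_cone i \<Longrightarrow> B \<in> codim_fam i \<Longrightarrow> 0 < fst (flat_proj B i u)"
proof (induction i arbitrary: u B)
  case 0
  have "flat_proj B 0 u = u" using flat_proj_props(2)[OF 0(3,1), of u] by (simp add: Vh_0)
  then show ?case using 0 by simp
next
  case (Suc i)
  obtain B' where B': "B' \<in> codim_fam i" "B' \<subseteq> B" using codim_fam_superset[OF Suc.prems(3), of i]
    by auto
  let ?u = "u + ((flat_proj B (Suc i) u - u) \<bullet> eh i) *\<^sub>R eh i"
  have "?u \<in> adm_cone i" using Suc.prems by simp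
  then have "0 < fst (flat_proj B' i ?u)" using Suc.IH[of ?u B'] B' Suc.prems by simp
  then show ?case using flat_proj_step[OF Suc.prems(3,1) B'] by simp
qed

text \<open>Genericity places the vertex in the closed sector, so the direction of the lower
  half-flat through it again has its angles in [0, \<delta>], and the induction hypothesis
  applies.\<close>

lemma sector_dirs_subset_adm_cone: "i \<le> CARD('n) \<Longrightarrow> u \<in> sector_dirs i \<Longrightarrow> u \<in> adm_cone i"
proof (induction i arbitrary: u)
  case 0
  then show ?case by (simp add: sector_dirs_def)
next
  case (Suc i)
  have u: "u \<in> Dh (Suc i)" "u \<noteq> 0" using Suc.prems by (auto simp: sector_dirs_def)
  show ?case
    unfolding adm_cone.simps mem_Collect_eq
  proof
    fix B assume B: "B \<in> codim_fam (Suc i)"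
    have i1: "1 \<le> Suc i" by simp
    obtain q s where q: "hom q \<in> Lh B" "0 < s" "hom q - s *\<^sub>R u \<in> Vh (Suc i)"
      "q \<in> closure (sector p e \<delta>)"
      using generic_point[OF Suc.prems(2) i1 Suc.prems(1) B] by metis
    have "(1 / s) *\<^sub>R hom q - u \<in> Vh (Suc i)"
      using Vh_scale[OF q(3), of "1 / s"] q(2) by (simp add: algebra_simps)
    then have flat_proj: "flat_proj B (Suc i) u = (1 / s) *\<^sub>R hom q"
      using Lh_scale[OF q(1)] by (intro flat_proj_eqI[OF B Suc.prems(1)]) auto
    define c where "c = (flat_proj B (Suc i) u - u) \<bullet> eh i"
    define u' where "u' = u + c *\<^sub>R eh i"
    have ui: "u \<bullet> eh i = 0" using Dh_inner[OF u(1)] by simp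
    have c: "c = (hom q \<bullet> eh i) / s" using flat_proj ui by (simp add: c_def inner_diff_left)
    have u'i: "u' \<bullet> eh i = c" using ui Suc.prems(1)
      by (simp add: u'_def inner_add_left eh_orthonormal)
    have d: "u' - (1 / s) *\<^sub>R hom q \<in> Vh i"
    proof -
      have "(1 / s) *\<^sub>R hom q - u - c *\<^sub>R eh i \<in> Vh (Suc i)"
        using Suc.prems(1)
        by (intro Vh_diff[OF \<open>(1 / s) *\<^sub>R hom q - u \<in> Vh (Suc i)\<close>] Vh_scale eh_in_Vh) simp_all
      moreover have "((1 / s) *\<^sub>R hom q - u - c *\<^sub>R eh i) \<bullet> eh i = 0"
        using ui c Suc.prems(1) by (simp add: inner_diff_left eh_orthonormal)
      ultimately have "(1 / s) *\<^sub>R hom q - u - c *\<^sub>R eh i \<in> Vh i" by (rule Vh_SucD)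
      from Vh_scale[OF this, of "-1"] show ?thesis by (simp add: u'_def algebra_simps)
    qed
    have ang: "cos \<delta> * tail j u' \<le> u' \<bullet> eh j" if j: "1 \<le> j" "i \<le> j" "j < CARD('n)" for j
    proof -
      have dj: "u' - (1 / s) *\<^sub>R hom q \<in> Vh j" using d Vh_mono[OF j(2)] by blast
      have "tail j u' = 1 / s * tail j (hom q)" "u' \<bullet> eh j = 1 / s * (hom q \<bullet> eh j)"
        using tail_Vh[OF dj] q(2) Vh_inner[OF dj, of j] j by (auto simp: tail_scale inner_diff_left)
      then show ?thesis
        using mult_left_mono[OF closure_sectorD(2)[OF q(4) j(1,3)], of "1 / s"] q(2)
        by (simp add: mult.left_commute)
    qed
    have "u' \<in> Dh i"
      using u(1) Dh_mono[of i "Suc i"] eh_in_Dh[of i i] Suc.prems(1)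
      unfolding u'_def by (intro subspace_add[OF subspace_Dh] subspace_scale[OF subspace_Dh]) auto
    moreover have "u' \<noteq> 0"
    proof
      assume "u' = 0"
      then have "c = 0" using u'i by simp
      then show False using \<open>u' = 0\<close> u(2) by (simp add: u'_def)
    qed
    moreover have "0 < fst u'" if "i = 0" using u'i c q(2) that by (simp add: eh_0)
    moreover have "0 \<le> u' \<bullet> eh CARD('n)"
      using Suc.prems by (simp add: u'_def inner_add_left eh_orthonormal sector_dirs_def)
    ultimately have "u' \<in> sector_dirs i" using ang by (simp add: sector_dirs_def)
    then have "u' \<in> adm_cone i" using Suc.IH Suc.prems by simp
    then show "u + ((flat_proj B (Suc i) u - u) \<bullet> eh i) *\<^sub>R eh i \<in> adm_cone i"
      by (simp add: u'_def c_def)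
  qed
qed

lemma eh_adm_cone: "i \<le> CARD('n) \<Longrightarrow> eh i \<in> adm_cone i"
  by (simp add: sector_dirs_subset_adm_cone eh_sector_dirs)

lemma eh_good_dirs: "i \<le> CARD('n) \<Longrightarrow> eh i \<in> good_dirs i"
  by (simp add: good_dirs_def eh_adm_cone eh_lpos eh_in_Dh)

lemma sector_dirs_good_dirs: "i \<le> CARD('n) \<Longrightarrow> u \<in> sector_dirs i \<Longrightarrow> u \<in> good_dirs i"
  using sector_dirs_subset_adm_cone[of i u] sector_dirs_lpos[of u i]
    by (simp add: good_dirs_def sector_dirs_def)

text \<open>At the value belonging to the vertex the shifted direction is admissible by the
  recursion for \<open>adm_cone\<close>, and openness extends this to nearby values. The limit is
  taken from the left because a smaller coordinate means a larger angle.\<close>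

lemma good_dirs_step:
  assumes "v \<in> good_dirs k" "1 \<le> k" "k \<le> CARD('n)" "B \<in> codim_fam k"
  shows "\<forall>\<^sub>F r in at_left (flat_proj B k v \<bullet> eh (k - 1)). v + r *\<^sub>R eh (k - 1) \<in> good_dirs (k - 1)"
proof -
  obtain j where k: "k = Suc j" using assms(2) by (cases k) auto
  let ?c = "flat_proj B k v \<bullet> eh j"
  have v: "v \<in> Dh k" "v \<in> lpos" "v \<in> adm_cone k" using assms by (auto simp: good_dirs_def)
  have "v \<bullet> eh j = 0" using Dh_inner[OF v(1)] k by simp
  then have "v + ?c *\<^sub>R eh j \<in> adm_cone j"
    using v(3) assms(4) unfolding k by (simp add: inner_diff_left)
  moreover have "((\<lambda>r. v + r *\<^sub>R eh j) \<longlongrightarrow> v + ?c *\<^sub>R eh j) (at_left ?c)"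
    by (intro tendsto_intros)
  ultimately have "\<forall>\<^sub>F r in at_left ?c. v + r *\<^sub>R eh j \<in> adm_cone j"
    using open_adm_cone[of j] assms(3) k by (intro topological_tendstoD) auto
  moreover have "v + r *\<^sub>R eh j \<in> Dh j" for r
    using v(1) Dh_mono[of j k] eh_in_Dh[of j j] assms(3) k
    by (intro subspace_add[OF subspace_Dh] subspace_scale[OF subspace_Dh]) auto
  moreover have "v + r *\<^sub>R eh j \<in> lpos" for r
    by (rule lpos_Vh[OF v(2,1), of _ 1]) (use eh_in_Vh[of j k] assms(3) k in \<open>auto intro: Vh_scale\<close>)
  ultimately show ?thesis unfolding good_dirs_def k by (auto elim: eventually_mono)
qed

text \<open>The ratio test of the simplex method. Hyperplanes through \<open>x\<close> stay active;
  only those on which \<open>w\<close> has a forbidden sign can stop the motion, and the smallest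
  ratio belongs to the first one reached.\<close>

lemma hit_hyperplane:
  assumes x: "weak_conf y x" and w: "\<not> weak_conf y w" "w \<in> Lh (active x)"
  shows "\<exists>t>0. weak_conf y (x + t *\<^sub>R w) \<and> active x \<subset> active (x + t *\<^sub>R w)"
proof -
  let ?Bad = "{H\<in>A. hform H \<bullet> w \<noteq> 0 \<and> sgn (hform H \<bullet> w) \<noteq> sgn (hform H \<bullet> y)}"
  let ?r = "\<lambda>H. - (hform H \<bullet> x) / (hform H \<bullet> w)"
  have fin: "finite (?r ` ?Bad)" and ne: "?r ` ?Bad \<noteq> {}"
    using finite_A w(1) by (auto simp: weak_conf_def)
  define t where "t = Min (?r ` ?Bad)"
  have bad: "(0 < hform H \<bullet> x \<and> hform H \<bullet> w < 0 \<and> 0 < hform H \<bullet> y) \<or>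
      (hform H \<bullet> x < 0 \<and> 0 < hform H \<bullet> w \<and> hform H \<bullet> y < 0)" if H: "H \<in> ?Bad" for H
  proof -
    have "H \<notin> active x" using H w(2) by (auto simp: Lh_def)
    then have "hform H \<bullet> x \<noteq> 0" using H by (simp add: active_def)
    moreover from this have "sgn (hform H \<bullet> x) = sgn (hform H \<bullet> y)" using x H
      by (auto simp: weak_conf_def)
    ultimately show ?thesis using H by (auto simp: sgn_if split: if_splits)
  qed
  obtain H0 where H0: "H0 \<in> ?Bad" "t = ?r H0"
    using Min_in[OF fin ne] by (auto simp: t_def)
  have t: "0 < t" using bad[OF H0(1)] H0(2) by (auto simp: zero_less_divide_iff divide_less_0_iff)
  have le: "t \<le> ?r H" if "H \<in> ?Bad" for H
    unfolding t_def using fin that by (intro Min_le) auto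
  have "weak_conf y (x + t *\<^sub>R w)"
    unfolding weak_conf_def
  proof
    fix H assume H: "H \<in> A"
    have wx: "hform H \<bullet> x = 0 \<or> sgn (hform H \<bullet> x) = sgn (hform H \<bullet> y)" using x H
      by (simp add: weak_conf_def)
    have e: "hform H \<bullet> (x + t *\<^sub>R w) = hform H \<bullet> x + t * (hform H \<bullet> w)"
      by (simp add: inner_add_right)
    show "hform H \<bullet> (x + t *\<^sub>R w) = 0 \<or> sgn (hform H \<bullet> (x + t *\<^sub>R w)) = sgn (hform H \<bullet> y)"
    proof (cases "H \<in> ?Bad")
      case True
      have "0 \<le> hform H \<bullet> x + t * (hform H \<bullet> w)" if "hform H \<bullet> w < 0"
        using le[OF True] that by (simp add: field_simps)
      moreover have "hform H \<bullet> x + t * (hform H \<bullet> w) \<le> 0" if "0 < hform H \<bullet> w"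
        using le[OF True] that by (simp add: field_simps)
      ultimately show ?thesis using bad[OF True] unfolding e by (auto simp: sgn_if)
    next
      case False
      then consider "hform H \<bullet> w = 0" | "sgn (hform H \<bullet> w) = sgn (hform H \<bullet> y)" "hform H \<bullet> w \<noteq> 0"
        using H by auto
      then show ?thesis
      proof cases
        case 2
        have "sgn (hform H \<bullet> x + t * (hform H \<bullet> w)) = sgn (hform H \<bullet> y)"
        proof (cases "0 < hform H \<bullet> w")
          case True
          then have "0 \<le> hform H \<bullet> x" "0 < hform H \<bullet> y" using 2 wx
            by (auto simp: sgn_if split: if_splits)
          then show ?thesis using True t by (simp add: add_nonneg_pos)
        next
          case False
          then have "hform H \<bullet> x \<le> 0" "hform H \<bullet> y < 0" "hform H \<bullet> w < 0"
            using 2 wx by (auto simp: sgn_if split: if_splits)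
          then show ?thesis using t by (simp add: add_nonpos_neg mult_pos_neg)
        qed
        then show ?thesis unfolding e by simp
      qed (use wx e in auto)
    qed
  qed
  moreover have "active x \<subseteq> active (x + t *\<^sub>R w)"
    using w(2) by (auto simp: active_def Lh_def inner_add_right)
  moreover have "H0 \<in> active (x + t *\<^sub>R w)"
    using H0 by (simp add: active_def inner_add_right inner_diff_right)
  moreover have "H0 \<notin> active x" using bad[OF H0(1)] by (auto simp: active_def)
  ultimately show ?thesis using t by blast
qed

section \<open>Climbing to vertices and the optimal vertex of a slice\<close>

lemma card_active_less: "active x \<subset> active z \<Longrightarrow> card (A - active z) < card (A - active x)"
  using finite_A by (intro psubset_card_mono) (auto simp: active_def)

lemma vertex_eq_flat_proj:
  assumes "x \<in> slice y k v" "B \<in> codim_fam k" "B \<subseteq> active x" "k \<le> CARD('n)"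
  shows "x = flat_proj B k v"
  using flat_proj_eqI[OF assms(2,4) in_Lh_active[OF assms(3)]] assms(1) by (simp add: slice_def)

text \<open>At a point that is not a vertex one moves along \<open>flat_proj B (k - 1) (eh (k - 1))\<close>. This decreases the
  angle \<open>\<theta>\<^sub>k\<^sub>-\<^sub>1\<close> and must reach another hyperplane, as otherwise the direction itself would be a point of
  the closed facet in \<open>V\<^sub>k\<^sub>-\<^sub>1\<close>.\<close>

lemma climb_to_vertex:
  assumes "avoids y k" "1 \<le> k" "k \<le> CARD('n)"
  shows "x \<in> slice y k v \<Longrightarrow> \<exists>z\<in>slice y k v. (\<exists>B\<in>codim_fam k. B \<subseteq> active z) \<and>
    (z = x \<or> x \<bullet> eh (k - 1) < z \<bullet> eh (k - 1))"
proof (induction "card (A - active x)" arbitrary: x rule: less_induct)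
  case less
  show ?case
  proof (cases "\<exists>B\<in>codim_fam k. B \<subseteq> active x")
    case True
    then show ?thesis using less.prems by blast
  next
    case False
    obtain B where B: "B \<in> codim_fam (k - 1)" "active x \<subseteq> B"
      using active_dichotomy[of x k] False less.prems assms by (auto simp: slice_def)
    let ?w = "flat_proj B (k - 1) (eh (k - 1))"
    have k1: "k - 1 \<le> CARD('n)" using assms by simp
    have wL: "?w \<in> Lh (active x)" using flat_proj_props(1)[OF B(1) k1] Lh_antimono[OF B(2)] by blast
    have "?w - eh (k - 1) \<in> Vh k"
      by (rule subsetD[OF Vh_mono flat_proj_props(2)[OF B(1) k1]]) simp
    then have wV: "?w \<in> Vh k"
      using Vh_add[OF _ eh_in_Vh[of "k - 1" k]] assms by fastforce
    have w1: "?w \<bullet> eh (k - 1) = 1" using flat_proj_coord[OF B(1) _ k1] k1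
      by (simp add: eh_orthonormal)
    have wf: "0 < fst ?w" using adm_cone_pos[OF k1 eh_adm_cone[OF k1] B(1)] .
    then have "\<not> weak_conf y ?w" using assms(1) wV by (simp add: avoids_def)
    then obtain t where t: "0 < t" "weak_conf y (x + t *\<^sub>R ?w)" "active x \<subset> active (x + t *\<^sub>R ?w)"
      using hit_hyperplane[OF _ _ wL, of y] less.prems by (auto simp: slice_def)
    let ?x = "x + t *\<^sub>R ?w"
    have "?x - v \<in> Vh k"
      using Vh_add[OF _ Vh_scale[OF wV, of t], of "x - v"] less.prems
        by (simp add: slice_def algebra_simps)
    moreover have "0 < fst ?x" using less.prems t wf by (simp add: slice_def add_pos_pos)
    ultimately have xc: "?x \<in> slice y k v" using t by (simp add: slice_def)
    then obtain z where z: "z \<in> slice y k v" "\<exists>B\<in>codim_fam k. B \<subseteq> active z"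
      "z = ?x \<or> ?x \<bullet> eh (k - 1) < z \<bullet> eh (k - 1)"
      using less.hyps[OF card_active_less[OF t(3)] xc] by blast
    have "x \<bullet> eh (k - 1) < ?x \<bullet> eh (k - 1)" using t w1 by (simp add: inner_add_left)
    then show ?thesis using z by (intro bexI[OF _ z(1)]) auto
  qed
qed

lemma slice_midpoint:
  assumes "x \<in> slice y k v" "z \<in> slice y k v"
  shows "(1/2) *\<^sub>R x + (1/2) *\<^sub>R z \<in> slice y k v"
proof -
  have "(1/2) *\<^sub>R (x - v) + (1/2) *\<^sub>R (z - v) \<in> Vh k"
    using assms by (intro Vh_add Vh_scale) (auto simp: slice_def)
  moreover have "(1/2) *\<^sub>R (x - v) + (1/2) *\<^sub>R (z - v) = (1/2) *\<^sub>R x + (1/2) *\<^sub>R z - v"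
    by (simp add: algebra_simps flip: scaleR_add_left)
  ultimately show ?thesis using assms weak_conf_add[of y x z "1/2" "1/2"] by (auto simp: slice_def)
qed

text \<open>No hyperplane has opposite signs at \<open>x\<close> and \<open>z\<close>, so a zero at
  the midpoint cannot come from cancellation.\<close>

lemma active_midpoint:
  assumes "weak_conf y x" "weak_conf y z"
  shows "active ((1/2) *\<^sub>R x + (1/2) *\<^sub>R z) \<subseteq> active x"
proof
  fix H assume H: "H \<in> active ((1/2) *\<^sub>R x + (1/2) *\<^sub>R z)"
  then have "H \<in> A" "hform H \<bullet> x = - (hform H \<bullet> z)" by (auto simp: active_def inner_add_right)
  moreover from this have "hform H \<bullet> x = 0 \<or> sgn (hform H \<bullet> x) = sgn (hform H \<bullet> y)"
    "hform H \<bullet> z = 0 \<or> sgn (hform H \<bullet> z) = sgn (hform H \<bullet> y)" using assms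
      by (auto simp: weak_conf_def)
  ultimately show "H \<in> active x" by (auto simp: active_def sgn_if split: if_splits)
qed

text \<open>Climbing from the midpoint of two maxima cannot gain anything, so the midpoint is a
  vertex. The hyperplanes through it contain both maxima, which are therefore the same
  \<open>flat_proj B k v\<close>.\<close>

lemma top_vertex_unique:
  assumes "avoids y k" "1 \<le> k" "k \<le> CARD('n)" "top_vertex y k v x" "top_vertex y k v z"
  shows "x = z"
proof -
  let ?m = "(1/2) *\<^sub>R x + (1/2) *\<^sub>R z"
  have x: "x \<in> slice y k v" and z: "z \<in> slice y k v" and eq: "x \<bullet> eh (k - 1) = z \<bullet> eh (k - 1)"
    using assms(4,5) by (auto simp: top_vertex_def intro: antisym)
  have m: "?m \<in> slice y k v" by (rule slice_midpoint[OF x z])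
  obtain w where w: "w \<in> slice y k v" "\<exists>B\<in>codim_fam k. B \<subseteq> active w"
    "w = ?m \<or> ?m \<bullet> eh (k - 1) < w \<bullet> eh (k - 1)"
    using climb_to_vertex[OF assms(1-3) m] by blast
  have "?m \<bullet> eh (k - 1) = x \<bullet> eh (k - 1)" using eq by (simp add: inner_add_left)
  then have "w = ?m" using w assms(4) by (force simp: top_vertex_def)
  then obtain B where B: "B \<in> codim_fam k" "B \<subseteq> active ?m" using w by blast
  have xz: "weak_conf y x" "weak_conf y z" using x z by (auto simp: slice_def)
  have "B \<subseteq> active x" "B \<subseteq> active z"
    using B active_midpoint[OF xz] active_midpoint[OF xz(2,1)] by (auto simp: add.commute)
  then show ?thesis using vertex_eq_flat_proj[OF x B(1) _
    assms(3)] vertex_eq_flat_proj[OF z B(1) _ assms(3)] by simp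
qed

lemma top_vertex_vertex:
  assumes "avoids y k" "1 \<le> k" "k \<le> CARD('n)" "top_vertex y k v x"
  shows "\<exists>B\<in>codim_fam k. B \<subseteq> active x \<and> x = flat_proj B k v"
proof -
  have x: "x \<in> slice y k v" using assms(4) by (simp add: top_vertex_def)
  obtain w where w: "w \<in> slice y k v" "\<exists>B\<in>codim_fam k. B \<subseteq> active w"
    "w = x \<or> x \<bullet> eh (k - 1) < w \<bullet> eh (k - 1)"
    using climb_to_vertex[OF assms(1-3) x] by blast
  then have "w = x" using assms(4) by (force simp: top_vertex_def)
  then show ?thesis using w vertex_eq_flat_proj[OF x _ _ assms(3)] by blast
qed

text \<open>Every element is dominated by one of the finitely many candidates
  \<open>flat_proj B k v\<close> in the slice, so a maximum exists although the slice may be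
  unbounded.\<close>

lemma top_vertex_exists:
  assumes "avoids y k" "1 \<le> k" "k \<le> CARD('n)" "slice y k v \<noteq> {}"
  shows "\<exists>x. top_vertex y k v x"
proof -
  let ?V = "(\<lambda>B. flat_proj B k v) ` codim_fam k \<inter> slice y k v"
  have vert: "\<exists>z\<in>?V. x \<bullet> eh (k - 1) \<le> z \<bullet> eh (k - 1)" if x: "x \<in> slice y k v" for x
  proof -
    obtain z B where z: "z \<in> slice y k v" "B \<in> codim_fam k" "B \<subseteq> active z"
      "z = x \<or> x \<bullet> eh (k - 1) < z \<bullet> eh (k - 1)"
      using climb_to_vertex[OF assms(1-3) x] by blast
    then have "z \<in> ?V" using vertex_eq_flat_proj[OF z(1-3) assms(3)] by blast
    then show ?thesis using z(4) by (intro bexI[of _ z]) auto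
  qed
  let ?r = "(\<lambda>z. z \<bullet> eh (k - 1)) ` ?V"
  have "finite ?r" using finite_codim_fam by simp
  moreover have "?r \<noteq> {}" using vert assms(4) by blast
  ultimately have "Max ?r \<in> ?r" by (rule Max_in)
  then obtain x where x: "x \<in> ?V" "Max ?r = x \<bullet> eh (k - 1)" by (rule imageE)
  have "z \<bullet> eh (k - 1) \<le> x \<bullet> eh (k - 1)" if z: "z \<in> slice y k v" for z
  proof -
    obtain w where w: "w \<in> ?V" "z \<bullet> eh (k - 1) \<le> w \<bullet> eh (k - 1)" using vert[OF z] by blast
    have "w \<bullet> eh (k - 1) \<le> Max ?r" using \<open>finite ?r\<close> w(1) by (intro Max_ge) auto
    then show ?thesis using w x by simp
  qed
  then have "top_vertex y k v x" using x(1) unfolding top_vertex_def by blast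
  then show ?thesis by blast
qed

text \<open>The candidates are linear in the direction, so a vertex over \<open>- v\<close> would
  have negative first coordinate.\<close>

lemma slice_negative_empty:
  assumes "avoids y k" "1 \<le> k" "k \<le> CARD('n)" "v \<in> adm_cone k"
  shows "slice y k (- v) = {}"
proof (rule ccontr)
  assume "slice y k (- v) \<noteq> {}"
  then obtain x where x: "top_vertex y k (- v) x" using top_vertex_exists[OF assms(1-3)] by blast
  obtain B where B: "B \<in> codim_fam k" "x = flat_proj B k (- v)"
    using top_vertex_vertex[OF assms(1-3) x] by blast
  have "x = - flat_proj B k v" using B(2) linear_neg[OF linear_flat_proj[OF B(1) assms(3)]] by simp
  then have "fst x < 0" using adm_cone_pos[OF assms(3,4) B(1)] by simp
  then show False using x by (simp add: top_vertex_def slice_def)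
qed

text \<open>An ascent in the last coordinate, as in \<open>climb_to_vertex\<close>. If nothing stops
  it, the direction of motion \<open>?w\<close> weakly conforms and is itself the required
  vector.\<close>

lemma exists_positive_vertex:
  "weak_conf y x \<Longrightarrow> 0 < fst x \<Longrightarrow> \<exists>z. weak_conf y z \<and> 0 < fst z \<and> 0 < z \<bullet> eh CARD('n)"
proof (induction "card (A - active x)" arbitrary: x rule: less_induct)
  case less
  obtain B where B: "B \<in> codim_fam CARD('n)" "active x \<subseteq> B"
    using active_subset_codim_fam_top[OF less.prems(2)] by blast
  let ?n = "CARD('n)"
  let ?w = "flat_proj B ?n (eh ?n)"
  have wL: "?w \<in> Lh (active x)" using flat_proj_props(1)[OF B(1)] Lh_antimono[OF B(2)] by blast
  have w: "0 < fst ?w" "?w \<bullet> eh ?n = 1"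
    using adm_cone_pos[OF _ eh_adm_cone B(1)] flat_proj_coord[OF B(1)]
      by (auto simp: eh_orthonormal)
  show ?case
  proof (cases "weak_conf y ?w")
    case True
    then show ?thesis using w by (intro exI[of _ ?w]) simp
  next
    case False
    then obtain t where t: "0 < t" "weak_conf y (x + t *\<^sub>R ?w)" "active x \<subset> active (x + t *\<^sub>R ?w)"
      using hit_hyperplane[OF less.prems(1) False wL] by blast
    have "0 < fst (x + t *\<^sub>R ?w)" using less.prems t w by (simp add: add_pos_pos)
    then show ?thesis using less.hyps[OF card_active_less[OF t(3)] t(2)] by blast
  qed
qed

text \<open>In dimension n no half-flat prescribes the sign of the last coordinate. If it were
  nonpositive, a nonnegative combination with a vector of positive last coordinate would give a
  point of the closed facet in V_(n-1).\<close>

lemma avoids_top_positive: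
  assumes "avoids y CARD('n)" "weak_conf y x" "0 < fst x"
  shows "0 < x \<bullet> eh CARD('n)"
proof (rule ccontr)
  let ?n = "CARD('n)" and ?a = "x \<bullet> eh CARD('n)"
  assume "\<not> 0 < ?a"
  then have a: "0 \<le> - ?a" by simp
  obtain z where z: "weak_conf y z" "0 < fst z" "0 < z \<bullet> eh ?n"
    using exists_positive_vertex[OF assms(2,3)] by blast
  let ?x = "(z \<bullet> eh ?n) *\<^sub>R x + (- ?a) *\<^sub>R z"
  have "weak_conf y ?x" using z a by (intro weak_conf_add assms) auto
  moreover have "0 < (z \<bullet> eh ?n) * fst x + (- ?a) * fst z"
    using z a assms(3) by (intro add_pos_nonneg mult_pos_pos mult_nonneg_nonneg) auto
  then have "0 < fst ?x" by simp
  moreover have "?x \<in> Vh ?n" by (auto simp: Vh_def inner_diff_left)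
  ultimately show False using assms(1) unfolding avoids_def by blast
qed

end

lemma convex_combination_eq_max:
  fixes l a b x :: real
  assumes "0 < l" "l < 1" "x = (1 - l) * a + l * b" "a \<le> x" "b \<le> x"
  shows "a = x" "b = x"
proof -
  have "(1 - l) * (x - a) + l * (x - b) = 0" using assms(3) by (simp add: algebra_simps)
  moreover have "0 \<le> (1 - l) * (x - a)" "0 \<le> l * (x - b)" using assms by auto
  ultimately have "(1 - l) * (x - a) = 0" "l * (x - b) = 0" by linarith+
  then show "a = x" "b = x" using assms(1,2) by auto
qed

context generic_arrangement
begin

section \<open>One step of the polar ordering\<close>

definition rep :: "(real^'n) set \<Rightarrow> real \<times> (real^'n)" where
  "rep F = hom (SOME q. q \<in> F)"

definition flag_index :: "(real^'n) set \<Rightarrow> nat" where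
  "flag_index F = (LEAST j. flag p e j \<inter> closure F \<noteq> {})"

text \<open>At \<open>i = n\<close> the half-flat is all of space for every \<open>th\<close>, and
  \<open>eh n\<close> is a fixed stand-in for the missing direction.\<close>

definition half_flat_dir :: "nat \<Rightarrow> (nat \<Rightarrow> real) \<Rightarrow> real \<times> (real^'n) \<Rightarrow> bool" where
  "half_flat_dir i th u \<longleftrightarrow> u \<in> good_dirs i \<and>
     (i < CARD('n) \<and> half_flat p e i th = cone i u \<or> i = CARD('n) \<and> u = eh i)"

text \<open>\<open>min_data i u F k v x\<close>: the minimum point of the section of \<open>F\<close> by \<open>V\<^sub>i(u)\<close> is \<open>pnt x\<close>,
  computed in \<open>V\<^sub>k(v)\<close>; here \<open>k = i\<close> if the index of the section is at least \<open>i\<close>, and \<open>k\<close> is the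
  index otherwise.\<close>

definition min_data :: "nat \<Rightarrow> real \<times> (real^'n) \<Rightarrow> (real^'n) set \<Rightarrow> nat \<Rightarrow>
    real \<times> (real^'n) \<Rightarrow> real \<times> (real^'n) \<Rightarrow> bool" where
  "min_data i u F k v x \<longleftrightarrow>
     (if avoids (rep F) i then k = i \<and> v = u \<and> top_vertex (rep F) k v x
      else k = flag_index F \<and> v = eh k \<and> (if k = 0 then x = eh 0 else top_vertex (rep F) k v x))"

section \<open>Representatives and indices of facets\<close>

lemma some_in_facet: "F \<in> facets A \<Longrightarrow> (SOME q. q \<in> F) \<in> F"
  using facets_nonempty by (simp add: some_in_eq)

lemma facet_rep: "F \<in> facets A \<Longrightarrow> F = {r. sign_eq (rep F) (hom r)}"
  unfolding rep_def by (rule facet_eq[OF _ some_in_facet])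

lemma closure_facet_rep: "F \<in> facets A \<Longrightarrow> closure F = {r. weak_conf (rep F) (hom r)}"
  unfolding rep_def by (rule closure_facet[OF _ some_in_facet])

lemma mem_facet_iff: "F \<in> facets A \<Longrightarrow> r \<in> F \<longleftrightarrow> sign_eq (rep F) (hom r)"
  using facet_rep by (metis (no_types, lifting) mem_Collect_eq)

lemma mem_closure_facet_iff: "F \<in> facets A \<Longrightarrow> r \<in> closure F \<longleftrightarrow> weak_conf (rep F) (hom r)"
  by (simp add: closure_facet_rep)

lemma sign_eq_pnt: "0 < fst x \<Longrightarrow> sign_eq y (hom (pnt x)) \<longleftrightarrow> sign_eq y x"
  by (simp add: hom_pnt sign_eq_scale)

lemma weak_conf_pnt: "0 < fst x \<Longrightarrow> weak_conf y (hom (pnt x)) \<longleftrightarrow> weak_conf y x"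
  by (simp add: hom_pnt weak_conf_scale)

lemma pnt_eh_0: "pnt (eh 0) = p" and hom_p: "hom p = eh 0"
  by (auto simp: pnt_def hom_def eh_def)

lemma avoids_iff:
  assumes "F \<in> facets A" "1 \<le> k"
  shows "avoids (rep F) k \<longleftrightarrow> flag p e (k - 1) \<inter> closure F = {}"
proof
  assume av: "avoids (rep F) k"
  have "q \<notin> closure F" if q: "q \<in> flag p e (k - 1)" for q
  proof
    assume "q \<in> closure F"
    then have "weak_conf (rep F) (hom q)" using closure_facet_rep[OF assms(1)] by blast
    moreover have "hom q \<in> Vh k" using q assms(2) by (simp add: flag_eq)
    ultimately show False using av by (simp add: avoids_def)
  qed
  then show "flag p e (k - 1) \<inter> closure F = {}" by blast
next
  assume e: "flag p e (k - 1) \<inter> closure F = {}"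
  show "avoids (rep F) k"
    unfolding avoids_def
  proof (intro ballI impI notI)
    fix x assume x: "x \<in> Vh k" "0 < fst x" "weak_conf (rep F) x"
    then have "hom (pnt x) \<in> Vh k" by (simp add: hom_pnt Vh_scale)
    then have "pnt x \<in> flag p e (k - 1)" using assms(2) by (simp add: flag_eq)
    moreover have "pnt x \<in> closure F" using x closure_facet_rep[OF assms(1)]
      by (simp add: weak_conf_pnt)
    ultimately show False using e by blast
  qed
qed

lemma flag_index_props:
  assumes "F \<in> facets A"
  shows "flag p e (flag_index F) \<inter> closure F \<noteq> {}" "flag_index F \<le> CARD('n)"
    "0 < flag_index F \<Longrightarrow> avoids (rep F) (flag_index F)"
    "flag p e j \<inter> closure F \<noteq> {} \<Longrightarrow> flag_index F \<le> j"
proof -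
  have top: "flag p e CARD('n) \<inter> closure F \<noteq> {}"
    using flag_top facets_nonempty[OF assms] closure_subset by fastforce
  show 1: "flag p e (flag_index F) \<inter> closure F \<noteq> {}" unfolding flag_index_def
    by (rule LeastI) (rule top)
  show 2: "flag_index F \<le> j" if "flag p e j \<inter> closure F \<noteq> {}" for j
    unfolding flag_index_def by (rule Least_le) (rule that)
  show "flag_index F \<le> CARD('n)" by (rule 2[OF top])
  show "avoids (rep F) (flag_index F)" if "0 < flag_index F"
    using avoids_iff[OF assms, of "flag_index F"] 2[of "flag_index F - 1"] that by fastforce
qed

lemma not_in_Vh_slice:
  assumes "v \<in> good_dirs k" "x - v \<in> Vh k"
  shows "x \<notin> Vh k"
proof
  assume "x \<in> Vh k"
  then have "v \<in> Vh k" using Vh_diff[OF _ assms(2), of x] by simp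
  then show False using assms(1) Dh_Int_Vh lpos_nonzero unfolding good_dirs_def by blast
qed

text \<open>Equal points have proportional lifts, and the factor is 1 because both vectors agree
  modulo \<open>Vh k\<close> with \<open>v\<close>, which is not in \<open>Vh k\<close>.\<close>

lemma pnt_inj:
  assumes "v \<in> good_dirs k" "x - v \<in> Vh k" "z - v \<in> Vh k" "0 < fst x" "0 < fst z" "pnt x = pnt z"
  shows "x = z"
proof -
  define h where "h = hom (pnt x)"
  define c where "c = fst z / fst x"
  have "h = x /\<^sub>R fst x" using assms(4) by (simp add: h_def hom_pnt)
  then have x: "fst x *\<^sub>R h = x" using assms(4) by simp
  have "h = z /\<^sub>R fst z" unfolding h_def assms(6) using assms(5) by (simp add: hom_pnt)
  then have zx: "fst z *\<^sub>R h = z" using assms(5) by simp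
  have "c *\<^sub>R (fst x *\<^sub>R h) = fst z *\<^sub>R h" using assms(4) by (simp add: c_def)
  then have z: "z = c *\<^sub>R x" using x zx by simp
  have "z - c *\<^sub>R v \<in> Vh k" using Vh_scale[OF assms(2), of c] z by (simp add: scaleR_diff_right)
  from Vh_diff[OF this assms(3)] have "(1 - c) *\<^sub>R v \<in> Vh k" by (simp add: algebra_simps)
  moreover have "v \<notin> Vh k" using not_in_Vh_slice[OF assms(1), of v] Vh_zero by simp
  ultimately have "1 - c = 0"
    using Vh_scale[of "(1 - c) *\<^sub>R v" k "1 / (1 - c)"] by (cases "1 - c = 0") auto
  then show ?thesis using z by simp
qed

section \<open>Minimising an angle over a closed section\<close>

context
  fixes y k v x K
  assumes k: "1 \<le> k" "k \<le> CARD('n)" and av: "avoids y k" and v: "v \<in> good_dirs k"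
    and mv: "top_vertex y k v x"
    and K: "K = {r. weak_conf y (hom r) \<and> (\<exists>s>0. hom r - s *\<^sub>R v \<in> Vh k)}"
begin

lemma K_normalize:
  assumes "r \<in> K"
  shows "\<exists>s>0. (1 / s) *\<^sub>R hom r \<in> slice y k v"
proof -
  obtain s where s: "0 < s" "hom r - s *\<^sub>R v \<in> Vh k" and w: "weak_conf y (hom r)" using assms K
    by blast
  have "(1 / s) *\<^sub>R hom r - v \<in> Vh k" using Vh_scale[OF s(2), of "1 / s"] s(1)
    by (simp add: algebra_simps)
  then show ?thesis using s w by (auto simp: slice_def weak_conf_scale intro!: exI[of _ s])
qed

lemma pnt_mv_in_K: "pnt x \<in> K"
proof -
  have x: "x - v \<in> Vh k" "0 < fst x" "weak_conf y x" using mv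
    by (auto simp: top_vertex_def slice_def)
  have "hom (pnt x) - (1 / fst x) *\<^sub>R v \<in> Vh k"
    using Vh_scale[OF x(1), of "1 / fst x"] x(2) by (simp add: hom_pnt algebra_simps divide_inverse)
  then show ?thesis using x K by (auto simp: weak_conf_pnt intro!: exI[of _ "1 / fst x"])
qed

lemma K_lpos: "r \<in> K \<Longrightarrow> hom r \<in> lpos"
proof -
  assume "r \<in> K"
  then obtain s where "0 < s" "hom r - s *\<^sub>R v \<in> Vh k" using K by blast
  then show ?thesis using lpos_Vh[of v k "hom r" s] v by (simp add: good_dirs_def)
qed

lemma mv_max:
  assumes "z \<in> slice y k v"
  shows "ang x (k - 1) \<le> ang z (k - 1)" "ang z (k - 1) \<le> ang x (k - 1) \<Longrightarrow> z = x"
proof -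
  have x: "x - v \<in> Vh k" "0 < fst x" and z: "z - v \<in> Vh k" "0 < fst z"
    using mv assms by (auto simp: top_vertex_def slice_def)
  have d: "z - x \<in> Vh (Suc (k - 1))" "x - z \<in> Vh (Suc (k - 1))"
    using Vh_diff[OF z(1) x(1)] Vh_diff[OF x(1) z(1)] k by auto
  have nV: "z \<notin> Vh (Suc (k - 1))" "x \<notin> Vh (Suc (k - 1))"
    using not_in_Vh_slice[OF v z(1)] not_in_Vh_slice[OF v x(1)] k by auto
  have kN: "k - 1 < CARD('n)" using k by linarith
  have le: "z \<bullet> eh (k - 1) \<le> x \<bullet> eh (k - 1)" using mv assms by (simp add: top_vertex_def)
  then show "ang x (k - 1) \<le> ang z (k - 1)"
    using ang_less_iff[OF d(1) nV(1) kN z(2) x(2)] by simp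
  assume "ang z (k - 1) \<le> ang x (k - 1)"
  then have "x \<bullet> eh (k - 1) \<le> z \<bullet> eh (k - 1)"
    using ang_less_iff[OF d(2) nV(2) kN x(2) z(2)] by simp
  then have "top_vertex y k v z" using mv assms by (force simp: top_vertex_def)
  then show "z = x" using top_vertex_unique[OF av k _ mv] by blast
qed

text \<open>\<open>K\<close> stands for the closed section when its index is at least the dimension,
  and for the part on the flag when the index is smaller; one minimisation covers both. Normalising
  to the slice turns it into \<open>top_vertex\<close>.\<close>

lemma min_iff: "(P \<in> K \<and> (\<forall>Q\<in>K. polar p e P (k - 1) \<le> polar p e Q (k - 1))) \<longleftrightarrow> P = pnt x"
proof -
  have pol: "polar p e r j = ang z j" if "r \<in> K" "z = (1 / s) *\<^sub>R hom r" "0 < s" for r s z j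
    using polar_eq_ang[OF K_lpos] ang_scale[of "1 / s" "hom r" j] that by simp
  have px: "pnt x \<in> K" by (rule pnt_mv_in_K)
  have fx: "0 < fst x" using mv by (simp add: top_vertex_def slice_def)
  have polx: "polar p e (pnt x) j = ang x j" for j
    using polar_eq_ang[OF K_lpos[OF px]] ang_scale[of "inverse (fst x)" x j] fx
      by (simp add: hom_pnt)
  show ?thesis
  proof
    assume P: "P \<in> K \<and> (\<forall>Q\<in>K. polar p e P (k - 1) \<le> polar p e Q (k - 1))"
    obtain s where s: "0 < s" "(1 / s) *\<^sub>R hom P \<in> slice y k v" using K_normalize P by blast
    have "ang ((1 / s) *\<^sub>R hom P) (k - 1) \<le> ang x (k - 1)"
      using P px pol[of P _ s] s polx by fastforce
    then have "(1 / s) *\<^sub>R hom P = x" using mv_max(2)[OF s(2)] by blast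
    then have "pnt x = pnt ((1 / s) *\<^sub>R hom P)" by simp
    then show "P = pnt x" using s(1) pnt_scale[of "1 / s" "hom P"] by simp
  next
    assume P: "P = pnt x"
    have "polar p e (pnt x) (k - 1) \<le> polar p e Q (k - 1)" if Q: "Q \<in> K" for Q
    proof -
      obtain s where s: "0 < s" "(1 / s) *\<^sub>R hom Q \<in> slice y k v" using K_normalize Q by blast
      show ?thesis using mv_max(1)[OF s(2)] pol[OF Q refl s(1)] polx by metis
    qed
    then show "P \<in> K \<and> (\<forall>Q\<in>K. polar p e P (k - 1) \<le> polar p e Q (k - 1))" using P px by blast
  qed
qed

text \<open>The minimum point is prescribed as a minimiser among the vertices of the closure. If it
  were inside a segment of \<open>K\<close>, both normalised ends would be maxima of the slice,
  against uniqueness.\<close>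

lemma mv_extreme: "pnt x extreme_point_of K"
  unfolding extreme_point_of_def
proof (intro conjI pnt_mv_in_K ballI notI)
  fix a b assume a: "a \<in> K" and b: "b \<in> K" and ab: "pnt x \<in> open_segment a b"
  then obtain t where t: "0 < t" "t < 1" "pnt x = (1 - t) *\<^sub>R a + t *\<^sub>R b" and ne: "a \<noteq> b"
    by (auto simp: in_segment)
  obtain r s where r: "0 < r" "(1 / r) *\<^sub>R hom a \<in> slice y k v" and s: "0 < s"
    "(1 / s) *\<^sub>R hom b \<in> slice y k v"
    using K_normalize a b by blast
  let ?a = "(1 / r) *\<^sub>R hom a" and ?b = "(1 / s) *\<^sub>R hom b"
  let ?m = "(1 - t) * r + t * s"
  have m: "0 < ?m" using t r s by (simp add: add_pos_pos)
  \<comment> \<open>The ends are divided by \<open>r\<close> and \<open>s\<close>, so the weight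
    \<open>t\<close> on the segment turns into \<open>l\<close> for the normalised
    representatives.\<close>
  define l where "l = t * s / ?m"
  have l: "0 < l" "l < 1" using t r s m by (auto simp: l_def field_simps)
  have l1: "1 - l = (1 - t) * r / ?m" using m by (simp add: l_def field_simps)
  have eq: "(1 - l) *\<^sub>R ?a + l *\<^sub>R ?b = (1 / ?m) *\<^sub>R hom (pnt x)"
  proof -
    have "(1 - l) * (1 / r) = 1 / ?m * (1 - t)" "l * (1 / s) = 1 / ?m * t"
      unfolding l1 using r(1) s(1) by (simp_all add: l_def)
    then show ?thesis unfolding t(3) hom_convex by (simp only: scaleR_scaleR scaleR_add_right)
  qed
  let ?z = "(1 - l) *\<^sub>R ?a + l *\<^sub>R ?b"
  have "(1 - l) *\<^sub>R (?a - v) + l *\<^sub>R (?b - v) \<in> Vh k"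
    using r(2) s(2) by (intro Vh_add Vh_scale) (auto simp: slice_def)
  moreover have "(1 - l) *\<^sub>R (?a - v) + l *\<^sub>R (?b - v) = ?z - v" by (simp add: algebra_simps)
  ultimately have zV: "?z - v \<in> Vh k" by simp
  have x: "x - v \<in> Vh k" "0 < fst x" using mv by (auto simp: top_vertex_def slice_def)
  have "0 < fst ?z" unfolding eq using m by simp
  moreover have "pnt x = pnt ?z" unfolding eq using m pnt_scale[of "1 / ?m" "hom (pnt x)"] by simp
  ultimately have "x = ?z" by (rule pnt_inj[OF v x(1) zV x(2)])
  then have "x \<bullet> eh (k - 1) = (1 - l) * (?a \<bullet> eh (k - 1)) + l * (?b \<bullet> eh (k - 1))"
    by (metis inner_add_left inner_scaleR_left)
  moreover have le: "?a \<bullet> eh (k - 1) \<le> x \<bullet> eh (k - 1)" "?b \<bullet> eh (k - 1) \<le> x \<bullet> eh (k - 1)"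
    using mv r(2) s(2) by (auto simp: top_vertex_def)
  ultimately have "?a \<bullet> eh (k - 1) = x \<bullet> eh (k - 1)" "?b \<bullet> eh (k - 1) = x \<bullet> eh (k - 1)"
    using convex_combination_eq_max[OF l] by blast+
  then have "top_vertex y k v ?a" "top_vertex y k v ?b" using mv r(2) s(2)
    unfolding top_vertex_def by metis+
  then have "?a = ?b" using top_vertex_unique[OF av k] by blast
  then have "pnt ?a = pnt ?b" by simp
  then have "a = b" using pnt_scale[of "1 / r" "hom a"] pnt_scale[of "1 / s" "hom b"] r s by simp
  then show False using ne by simp
qed

end

section \<open>Sections of facets and their minimum points\<close>

lemma half_flat_dirD: "half_flat_dir i th u \<Longrightarrow> u \<in> good_dirs i" "half_flat_dir i th u \<Longrightarrow> i \<le> CARD('n)"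
  by (auto simp: half_flat_dir_def)

lemma section_subset: "section_of p e i th F \<subseteq> F"
  by (auto simp: section_of_def)

text \<open>Points of V_j with j < i belong to the closed half-flat with factor 0. On these
  subspaces a nonempty section has the same closure as the facet, so an index below \<open>i\<close>
  and its minimum point do not depend on the angles.\<close>

lemma closure_section_low:
  assumes "half_flat_dir i th u" "F \<in> facets A" "section_of p e i th F \<noteq> {}" "j < i"
  shows "flag p e j \<inter> closure (section_of p e i th F) = flag p e j \<inter> closure F"
proof (cases "i = CARD('n)")
  case True
  then show ?thesis by (simp add: section_of_def half_flat_def)
next
  case False
  then have S: "section_of p e i th F = F \<inter> cone i u"
    using assms(1) by (auto simp: half_flat_dir_def section_of_def)
  obtain q where q: "q \<in> F" "q \<in> cone i u" using assms(3) S by blast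
  have u: "u \<in> Dh i" "u \<in> lpos" using half_flat_dirD[OF assms(1)] by (auto simp: good_dirs_def)
  have "\<exists>s\<ge>0. hom r - s *\<^sub>R u \<in> Vh i" if "r \<in> flag p e j" for r
    using that Vh_mono[of "Suc j" i] assms(4) by (intro exI[of _ 0]) (auto simp: flag_eq)
  then show ?thesis unfolding S closure_section[OF assms(2) q u] by blast
qed

text \<open>Factor 0 would put a closure point into V_(i-1), which is excluded; hence passing to the
  closure only weakens the signs. For \<open>i = n\<close> the positive factor comes from
  \<open>avoids_top_positive\<close>.\<close>

lemma section_avoids:
  assumes "half_flat_dir i th u" "F \<in> facets A" "section_of p e i th F \<noteq> {}" "1 \<le> i"
    "avoids (rep F) i"
  shows "section_of p e i th F = {r. sign_eq (rep F) (hom r) \<and> (\<exists>s>0. hom r - s *\<^sub>R u \<in> Vh i)}"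
    and "closure (section_of p e i th F) = {r. weak_conf (rep F) (hom r) \<and> (\<exists>s>0. hom r - s *\<^sub>R u
      \<in> Vh i)}"
proof -
  note F = mem_facet_iff[OF assms(2)] and cF = mem_closure_facet_iff[OF assms(2)]
  let ?S = "section_of p e i th F"
  have "?S = {r. sign_eq (rep F) (hom r) \<and> (\<exists>s>0. hom r - s *\<^sub>R u \<in> Vh i)} \<and>
      closure ?S = {r. weak_conf (rep F) (hom r) \<and> (\<exists>s>0. hom r - s *\<^sub>R u \<in> Vh i)}"
  proof (cases "i = CARD('n)")
    case True
    then have S: "?S = F" by (simp add: section_of_def half_flat_def)
    have u: "u = eh CARD('n)" using assms(1) True by (auto simp: half_flat_dir_def)
    have "\<exists>s>0. hom r - s *\<^sub>R u \<in> Vh i" if "weak_conf (rep F) (hom r)" for r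
    proof -
      have "0 < hom r \<bullet> eh CARD('n)"
        using avoids_top_positive[of "rep F" "hom r"] assms(5) True that by simp
      moreover have "hom r - (hom r \<bullet> eh CARD('n)) *\<^sub>R u \<in> Vh i"
        unfolding u True by (auto simp: Vh_def inner_diff_left eh_orthonormal)
      ultimately show ?thesis by blast
    qed
    then show ?thesis
      unfolding S by (auto simp: F cF sign_eq_imp_weak_conf)
  next
    case False
    then have S: "?S = F \<inter> cone i u"
      using assms(1) by (auto simp: half_flat_dir_def section_of_def)
    obtain q where q: "q \<in> F" "q \<in> cone i u" using assms(3) S by blast
    have u: "u \<in> Dh i" "u \<in> lpos" using half_flat_dirD[OF assms(1)] by (auto simp: good_dirs_def)
    have "0 < s" if "weak_conf (rep F) (hom r)" "0 \<le> s" "hom r - s *\<^sub>R u \<in> Vh i" for r s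
    proof (rule ccontr)
      assume "\<not> 0 < s"
      then have "hom r \<in> Vh i" using that by simp
      then show False using assms(5) that(1) by (simp add: avoids_def)
    qed
    then have "closure ?S = {r. weak_conf (rep F) (hom r) \<and> (\<exists>s>0. hom r - s *\<^sub>R u \<in> Vh i)}"
      unfolding S closure_section[OF assms(2) q u] by (auto simp: cF intro: less_imp_le)
    moreover have "?S = {r. sign_eq (rep F) (hom r) \<and> (\<exists>s>0. hom r - s *\<^sub>R u \<in> Vh i)}"
      unfolding S cone_def by (auto simp: F)
    ultimately show ?thesis by blast
  qed
  then show "?S = {r. sign_eq (rep F) (hom r) \<and> (\<exists>s>0. hom r - s *\<^sub>R u \<in> Vh i)}"
    and "closure ?S = {r. weak_conf (rep F) (hom r) \<and> (\<exists>s>0. hom r - s *\<^sub>R u \<in> Vh i)}" by auto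
qed

text \<open>V_(m-1) divides V_m into two halves. Coordinate \<open>m\<close> is nonzero because the
  closed facet misses V_(m-1), and the negative half is excluded by
  \<open>slice_negative_empty\<close>, so only V_m(0, ..., 0) remains.\<close>

lemma flag_closure_eq:
  assumes "F \<in> facets A" "1 \<le> m" "m \<le> CARD('n)" "avoids (rep F) m"
  shows "flag p e m \<inter> closure F = {r. weak_conf (rep F) (hom r) \<and> (\<exists>s>0. hom r - s *\<^sub>R eh m
    \<in> Vh m)}"
proof -
  have "hom r \<in> Vh (Suc m) \<longleftrightarrow> (\<exists>s>0. hom r - s *\<^sub>R eh m \<in> Vh m)"
    if w: "weak_conf (rep F) (hom r)" for r
  proof
    assume r: "hom r \<in> Vh (Suc m)"
    let ?s = "hom r \<bullet> eh m"
    have "hom r - ?s *\<^sub>R eh m \<in> Vh (Suc m)"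
      using Vh_diff[OF r Vh_scale[OF eh_in_Vh]] assms(3) by simp
    then have d: "hom r - ?s *\<^sub>R eh m \<in> Vh m"
      by (rule Vh_SucD) (use assms(3) in \<open>simp add: inner_diff_left eh_orthonormal\<close>)
    have "?s \<noteq> 0"
    proof
      assume "?s = 0"
      then have "hom r \<in> Vh m" using d by simp
      then show False using assms(4) w by (simp add: avoids_def)
    qed
    moreover have "\<not> ?s < 0"
    proof
      assume s: "?s < 0"
      have "(1 / - ?s) *\<^sub>R hom r - (- eh m) \<in> Vh m"
        using Vh_scale[OF d, of "1 / - ?s"] s by (simp add: algebra_simps)
      then have "(1 / - ?s) *\<^sub>R hom r \<in> slice (rep F) m (- eh m)"
        using w s weak_conf_scale[of "1 / - ?s"] by (simp add: slice_def)
      then show False using slice_negative_empty[OF assms(4,2,3) eh_adm_cone[OF assms(3)]] by blast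
    qed
    ultimately show "\<exists>s>0. hom r - s *\<^sub>R eh m \<in> Vh m" using d by (intro exI[of _ ?s]) auto
  next
    assume "\<exists>s>0. hom r - s *\<^sub>R eh m \<in> Vh m"
    then obtain s where "hom r - s *\<^sub>R eh m \<in> Vh m" by blast
    then have "hom r - s *\<^sub>R eh m \<in> Vh (Suc m)" using Vh_mono[of m "Suc m"] by auto
    then show "hom r \<in> Vh (Suc m)"
      using Vh_add[OF _ Vh_scale[OF eh_in_Vh[of m "Suc m"], of s], of
        "hom r - s *\<^sub>R eh m"] assms(3) by simp
  qed
  then show ?thesis unfolding flag_eq closure_facet_rep[OF assms(1)] by blast
qed

lemma slice_nonempty:
  assumes "weak_conf y (hom r)" "0 < s" "hom r - s *\<^sub>R v \<in> Vh k"
  shows "(1 / s) *\<^sub>R hom r \<in> slice y k v"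
  using Vh_scale[OF assms(3), of "1 / s"] assms
    by (simp add: slice_def weak_conf_scale algebra_simps)

lemma min_data_exists:
  assumes "half_flat_dir i th u" "F \<in> facets A" "section_of p e i th F \<noteq> {}" "1 \<le> i"
  shows "\<exists>k v x. min_data i u F k v x"
proof (cases "avoids (rep F) i")
  case True
  obtain r s where "weak_conf (rep F) (hom r)" "0 < s" "hom r - s *\<^sub>R u \<in> Vh i"
    using section_avoids(1)[OF assms True] assms(3) sign_eq_imp_weak_conf by blast
  then have "slice (rep F) i u \<noteq> {}" using slice_nonempty by blast
  then obtain x where "top_vertex (rep F) i u x"
    using top_vertex_exists[OF True assms(4) half_flat_dirD(2)[OF assms(1)]] by blast
  then have "min_data i u F i u x" using True by (simp add: min_data_def)
  then show ?thesis by blast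
next
  case False
  show ?thesis
  proof (cases "flag_index F = 0")
    case True
    then have "min_data i u F 0 (eh 0) (eh 0)" using False by (simp add: min_data_def)
    then show ?thesis by blast
  next
    case m: False
    note mf = flag_index_props[OF assms(2)]
    have a: "avoids (rep F) (flag_index F)" using mf(3) m by simp
    obtain r s where "weak_conf (rep F) (hom r)" "0 < s"
      "hom r - s *\<^sub>R eh (flag_index F) \<in> Vh (flag_index F)"
      using flag_closure_eq[OF assms(2) _ mf(2) a] mf(1) m by auto
    then have "slice (rep F) (flag_index F) (eh (flag_index F)) \<noteq> {}" using slice_nonempty by blast
    then obtain x where "top_vertex (rep F) (flag_index F) (eh (flag_index F)) x"
      using top_vertex_exists[OF a _ mf(2)] m by fastforce
    then have "min_data i u F (flag_index F) (eh (flag_index F)) x" using False m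
      by (simp add: min_data_def)
    then show ?thesis by blast
  qed
qed

lemma min_data_props:
  assumes "half_flat_dir i th u" "F \<in> facets A" "1 \<le> i" "min_data i u F k v x"
  shows "k \<le> i" "k < i \<longleftrightarrow> \<not> avoids (rep F) i" "0 < fst x" "v \<in> good_dirs k"
    "1 \<le> k \<Longrightarrow> avoids (rep F) k \<and> top_vertex (rep F) k v x" "k = 0 \<Longrightarrow> x = eh 0"
    "weak_conf (rep F) x" "k = 0 \<or> x - v \<in> Vh k" "x \<in> lpos"
proof -
  note mf = flag_index_props[OF assms(2)]
  have lt: "flag_index F < i" if "\<not> avoids (rep F) i"
    using avoids_iff[OF assms(2,3)] mf(4)[of "i - 1"] that assms(3) by fastforce
  then show "k \<le> i" "k < i \<longleftrightarrow> \<not> avoids (rep F) i"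
    using assms(4) by (auto simp: min_data_def split: if_splits)
  have i: "i \<le> CARD('n)" "u \<in> good_dirs i" using half_flat_dirD[OF assms(1)] by auto
  show kz: "k = 0 \<Longrightarrow> x = eh 0" using assms(3,4) by (auto simp: min_data_def split: if_splits)
  show vg: "v \<in> good_dirs k" using assms(4) i eh_good_dirs mf(2)
    by (auto simp: min_data_def split: if_splits)
  show kk: "1 \<le> k \<Longrightarrow> avoids (rep F) k \<and> top_vertex (rep F) k v x"
    using assms(4) mf(3) by (auto simp: min_data_def split: if_splits)
  have "0 < fst x \<and> weak_conf (rep F) x \<and> (k = 0 \<or> x - v \<in> Vh k) \<and> x \<in> lpos"
  proof (cases "k = 0")
    case True
    then have x: "x = eh 0" using kz by simp
    have "flag_index F = 0" using True assms(3,4) by (auto simp: min_data_def split: if_splits)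
    then have "p \<in> closure F" using mf(1) by (auto simp: flag_0)
    then have "weak_conf (rep F) (eh 0)" using closure_facet_rep[OF assms(2)] hom_p by auto
    then show ?thesis using x True eh_lpos[of 0] by (simp add: eh_def)
  next
    case False
    then have c: "x \<in> slice (rep F) k v" using kk by (simp add: top_vertex_def)
    then show ?thesis using lpos_Vh[of v k x 1] vg by (auto simp: slice_def good_dirs_def)
  qed
  then show "0 < fst x" "weak_conf (rep F) x" "k = 0 \<or> x - v \<in> Vh k" "x \<in> lpos" by auto
qed

lemma polar_pnt:
  assumes "0 < fst x" "x \<in> lpos"
  shows "polar p e (pnt x) j = ang x j"
proof -
  have "hom (pnt x) \<in> lpos"
    using assms by (auto simp: hom_pnt lpos_def Vh_scale)
  then show ?thesis
    using polar_eq_ang[of "pnt x"] ang_scale[of "inverse (fst x)" x j] assms(1)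
      by (simp add: hom_pnt)
qed

text \<open>The truncation in \<open>min_coords\<close> removes only entries that vanish at
  \<open>x\<close>, so \<Theta> is the full angle vector of \<open>x\<close> in every case.\<close>

lemma min_data_min:
  assumes h: "half_flat_dir i th u" "F \<in> facets A" "section_of p e i th F \<noteq> {}" "1 \<le> i" and d:
    "min_data i u F k v x"
  shows "min_point p e i th F = pnt x" (is ?A) "min_coords p e i th F = ang x" (is ?B)
    "k = i \<and> i \<le> min_index p e i th F \<or> k < i \<and> k = min_index p e i th F" (is ?C)
proof -
  let ?S = "section_of p e i th F"
  let ?m = "min_index p e i th F"
  note dp = min_data_props[OF h(1,2,4) d]
  note mf = flag_index_props[OF h(2)]
  have ig: "i \<le> CARD('n)" "u \<in> good_dirs i" using half_flat_dirD[OF h(1)] by auto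
  have "flag p e CARD('n) \<inter> closure ?S \<noteq> {}" using h(3) closure_subset flag_top by fastforce
  then have mS: "flag p e ?m \<inter> closure ?S \<noteq> {}"
    unfolding min_index_def by (rule LeastI)
  have slice: "closure ?S \<subseteq> closure F" using section_subset by (rule closure_mono)
  have "?A \<and> ?B \<and> ?C"
  proof (cases "avoids (rep F) i")
    case True
    then have k: "k = i" "v = u" and mv: "top_vertex (rep F) i u x" using d
      by (auto simp: min_data_def)
    note K = section_avoids(2)[OF h True]
    have im: "i \<le> ?m"
    proof (rule ccontr)
      assume "\<not> i \<le> ?m"
      then have "flag p e ?m \<subseteq> flag p e (i - 1)" by (intro flag_mono) simp
      then have "flag p e (i - 1) \<inter> closure F \<noteq> {}" using mS slice by blast
      then show False using True avoids_iff[OF h(2,4)] by blast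
    qed
    have "min_point p e i th F =
        (THE P. P extreme_point_of closure ?S
          \<and> (\<forall>Q\<in>closure ?S. polar p e P (i - 1) \<le> polar p e Q (i - 1)))"
      unfolding min_point_def Let_def using im h(4) by simp
    also have "\<dots> = pnt x"
    proof (rule the_equality)
      show "pnt x extreme_point_of closure ?S
        \<and> (\<forall>Q\<in>closure ?S. polar p e (pnt x) (i - 1) \<le> polar p e Q (i - 1))"
        using mv_extreme[OF h(4) ig(1) True ig(2) mv K] min_iff[OF h(4) ig(1) True ig(2) mv K, of
          "pnt x"] by blast
      fix P assume "P extreme_point_of closure ?S
        \<and> (\<forall>Q\<in>closure ?S. polar p e P (i - 1) \<le> polar p e Q (i - 1))"
      then show "P = pnt x"
        using min_iff[OF h(4) ig(1) True ig(2) mv K, of P] unfolding extreme_point_of_def by blast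
    qed
    finally have mp: ?A .
    \<comment> \<open>From coordinate \<open>i\<close> on \<open>x\<close> is proportional to any
      point of the closed section, in particular to one in V_m; as \<open>i \<le> m\<close>, its
      coordinates beyond \<open>m\<close> vanish.\<close>
    have xV: "x \<in> Vh (Suc ?m)"
    proof -
      obtain r where r: "hom r \<in> Vh (Suc ?m)" "r \<in> closure ?S" using mS by (auto simp: flag_eq)
      obtain s where s: "0 < s" "hom r - s *\<^sub>R u \<in> Vh i" using r(2) K by blast
      have "(1 / s) *\<^sub>R (hom r - s *\<^sub>R u) \<in> Vh i" using s(2) by (rule Vh_scale)
      moreover have "x - u \<in> Vh i" using mv by (simp add: top_vertex_def slice_def)
      ultimately have "(x - u) - (1 / s) *\<^sub>R (hom r - s *\<^sub>R u) \<in> Vh i" by (rule Vh_diff[rotated])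
      then have "x - (1 / s) *\<^sub>R hom r \<in> Vh i" using s(1) by (simp add: algebra_simps)
      then have "x - (1 / s) *\<^sub>R hom r \<in> Vh (Suc ?m)" using Vh_mono[of i "Suc ?m"] im by auto
      from Vh_add[OF this Vh_scale[OF r(1), of "1 / s"]] show ?thesis by simp
    qed
    have "min_coords p e i th F j = ang x j" for j
    proof (cases "j < ?m")
      case True
      then show ?thesis unfolding min_coords_def mp using polar_pnt dp by simp
    next
      case False
      then have "x \<in> Vh (Suc j)" using xV Vh_mono[of "Suc ?m" "Suc j"] by auto
      then show ?thesis unfolding min_coords_def using False by (simp add: ang_Vh)
    qed
    then show ?thesis using mp im k by auto
  next
    case False
    have k: "k = flag_index F" using False d by (auto simp: min_data_def)
    have ki: "k < i" using dp False by simp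
    have mk: "?m = k"
      unfolding min_index_def k
    proof (rule Least_equality)
      show "flag p e (flag_index F) \<inter> closure ?S \<noteq> {}"
        using closure_section_low[OF h(1-3), of "flag_index F"] ki k mf(1) by simp
      fix j assume "flag p e j \<inter> closure ?S \<noteq> {}"
      then show "flag_index F \<le> j" using mf(4)[of j] slice by blast
    qed
    show ?thesis
    proof (cases "k = 0")
      case True
      have "min_point p e i th F = p" unfolding min_point_def Let_def using mk True h(4) by simp
      moreover have "x = eh 0" using dp True by blast
      moreover have "ang (eh 0) j = 0" for j
        by (rule ang_Vh) (simp add: eh_in_Vh)
      moreover have "min_coords p e i th F = (\<lambda>_. 0)" unfolding min_coords_def using mk True by simp
      ultimately show ?thesis using mk ki pnt_eh_0 by auto
    next
      case k0: False
      then have k1: "1 \<le> k" by simp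
      have kN: "k \<le> CARD('n)" using ki ig by simp
      have av: "avoids (rep F) k" and mv: "top_vertex (rep F) k v x" using dp(5)[OF k1] by auto
      have v: "v = eh k" using d False by (simp add: min_data_def)
      have K: "closure ?S \<inter> flag p e k = {r. weak_conf (rep F) (hom r) \<and> (\<exists>s>0. hom r - s *\<^sub>R v
        \<in> Vh k)}"
        using closure_section_low[OF h(1-3) ki] flag_closure_eq[OF h(2) k1 kN av] v
          by (simp add: Int_commute)
      have "min_point p e i th F = (THE P. P \<in> closure ?S \<inter> flag p e k \<and>
          (\<forall>Q\<in>closure ?S \<inter> flag p e k. polar p e P (k - 1) \<le> polar p e Q (k - 1)))"
        unfolding min_point_def Let_def mk using ki k0 by simp
      also have "\<dots> = pnt x"
        unfolding min_iff[OF k1 kN av dp(4) mv K] by simp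
      finally have mp: ?A .
      have "x - v \<in> Vh (Suc k)" using dp(8) k0 Vh_mono[of k "Suc k"] by auto
      then have xV: "x \<in> Vh (Suc k)" using Vh_add[OF _ eh_in_Vh[of k "Suc k"], of "x - v"] v kN
        by simp
      have "min_coords p e i th F j = ang x j" for j
      proof (cases "j < k")
        case True
        then show ?thesis unfolding min_coords_def mp mk using polar_pnt dp by simp
      next
        case False
        then have "x \<in> Vh (Suc j)" using xV Vh_mono[of "Suc k" "Suc j"] by auto
        then show ?thesis unfolding min_coords_def mk using False by (simp add: ang_Vh)
      qed
      then show ?thesis using mp mk ki by auto
    qed
  qed
  then show ?A ?B ?C by auto
qed

text \<open>Since \<open>k\<close> is either \<open>i\<close> or the index below it, the two
  recursive clauses merge into one.\<close>

lemma polar_less_unfold: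
  assumes h: "half_flat_dir i th u" "F \<in> facets A" "section_of p e i th F \<noteq> {}" "1 \<le> i"
    "min_data i u F k v x"
    and g: "G \<in> facets A" "section_of p e i th G \<noteq> {}" "min_data i u G k' v' x'"
  shows "polar_less p e i th F G \<longleftrightarrow>
     pnt x \<noteq> pnt x' \<and> antilex_less CARD('n) (ang x) (ang x') \<or>
     pnt x = pnt x' \<and> aff_dim (section_of p e i th F) = 0
       \<and> section_of p e i th F \<noteq> section_of p e i th G \<or>
     pnt x = pnt x' \<and> 0 < aff_dim (section_of p e i th F) \<and> 0 < aff_dim (section_of p e i th G)
       \<and> 0 < k \<and>
       (\<forall>\<^sub>F \<epsilon> in at_right 0. polar_less p e (k - 1) ((ang x)(k - 1 := ang x (k - 1) + \<epsilon>)) F G)"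
  unfolding polar_less.simps[of p e i th F G] Let_def
    min_data_min(1,2)[OF h] min_data_min(1,2)[OF h(1) g(1,2) h(4) g(3)]
  using min_data_min(3)[OF h] h(3,4) g(2) by auto

lemma polar_less_irrefl: "\<not> polar_less p e i th F F"
proof (induction i arbitrary: th rule: less_induct)
  case (less i)
  show ?case
    unfolding polar_less.simps[of p e i th F F] Let_def
    using less by (auto simp: trivial_limit_at_right_real)
qed

text \<open>The angles enter only through the half-flat, so an angle vector may be replaced by the
  angles of a direction.\<close>

lemma polar_less_cong:
  assumes "half_flat p e i th = half_flat p e i th'"
  shows "polar_less p e i th F G = polar_less p e i th' F G"
proof -
  have s: "section_of p e i th = section_of p e i th'"
    using assms by (auto simp: section_of_def fun_eq_iff)
  have m: "min_index p e i th = min_index p e i th'"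
    by (simp add: min_index_def s fun_eq_iff)
  have q: "min_point p e i th = min_point p e i th'"
    by (intro ext) (unfold min_point_def s m, rule refl)
  have "min_coords p e i th = min_coords p e i th'"
    by (simp add: min_coords_def m q fun_eq_iff)
  then show ?thesis
    unfolding polar_less.simps[of p e i th] polar_less.simps[of p e i th'] by (simp only: s m q)
qed

section \<open>Small increases of one angle\<close>

lemma half_flat_ang:
  assumes "u \<in> good_dirs i" "i < CARD('n)" "\<And>j. i \<le> j \<Longrightarrow> j < CARD('n) \<Longrightarrow> th j = ang u j"
  shows "half_flat p e i th = cone i u"
  using assms by (intro half_flat_eq_cone) (auto simp: good_dirs_def)

lemma half_flat_dir_ang: "u \<in> good_dirs i \<Longrightarrow> i < CARD('n) \<Longrightarrow> half_flat_dir i (ang u) u"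
  by (simp add: half_flat_dir_def half_flat_ang)

text \<open>Along \<open>v + r *\<^sub>R eh (k - 1)\<close> the angles from \<open>k\<close> on are
  fixed and angle \<open>k - 1\<close> grows as \<open>r\<close> decreases. Solving for
  \<open>r\<close> converts small \<epsilon> into values of \<open>r\<close> that approach the
  coordinate of \<open>x\<close> from below.\<close>

lemma angle_path:
  assumes v: "v \<in> good_dirs k" and k: "1 \<le> k" "k \<le> CARD('n)" and x: "x - v \<in> Vh k" "0 < fst x"
    and g: "\<forall>\<^sub>F r in at_left (x \<bullet> eh (k - 1)). v + r *\<^sub>R eh (k - 1) \<in> good_dirs (k - 1)"
    and Q: "\<forall>\<^sub>F r in at_left (x \<bullet> eh (k - 1)). Q r"
  shows "\<forall>\<^sub>F \<epsilon> in at_right 0. \<exists>r. Q r \<and>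
    half_flat p e (k - 1) ((ang x)(k - 1 := ang x (k - 1) + \<epsilon>))
      = half_flat p e (k - 1) (ang (v + r *\<^sub>R eh (k - 1)))"
proof -
  define j where "j = k - 1"
  have kj: "k = Suc j" "j < CARD('n)" using k by (auto simp: j_def)
  define c where "c = x \<bullet> eh j"
  define T where "T = tail k v"
  define w where "w r = v + r *\<^sub>R eh j" for r
  have vD: "v \<in> Dh k" "v \<in> lpos" using v by (auto simp: good_dirs_def)
  have "v \<notin> Vh k" using not_in_Vh_slice[OF v, of v] Vh_zero by simp
  then have T: "0 < T" using tail_nonneg[of k v] tail_eq_0[of k v]
    by (auto simp: T_def order_le_less)
  have wj: "w r \<bullet> eh j = r" for r
    using Dh_inner[OF vD(1), of j] kj by (simp add: w_def inner_add_left eh_orthonormal)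
  have wT: "tail (Suc j) (w r) = T" for r
    using tail_Vh[of "w r" v "Suc j"] Vh_scale[OF eh_in_Vh[of j "Suc j"]] kj
      by (simp add: w_def T_def)
  have xT: "tail (Suc j) x = T" using tail_Vh[OF x(1)] kj by (simp add: T_def)
  have angw: "ang (w r) j = (if j = 0 then T / r else pi / 2 - arctan (r / T))" for r
    using T kj wT[of r] wj[of r] by (auto simp: ang_def eh_0)
  have angx: "ang x j = (if j = 0 then T / c else pi / 2 - arctan (c / T))"
    using T kj xT by (auto simp: ang_def eh_0 c_def)
  have c0: "j = 0 \<Longrightarrow> 0 < c" using x(2) by (simp add: c_def eh_0)
  \<comment> \<open>The inverse of the angle formula: at the coordinate
    \<open>\<rho> \<epsilon>\<close> the angle (the radius for \<open>j = 0\<close>) exceeds that of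
    \<open>x\<close> by \<epsilon>.\<close>
  define \<rho> where "\<rho> \<epsilon> = (if j = 0 then T / (T / c + \<epsilon>) else T * tan (arctan (c / T) - \<epsilon>))" for \<epsilon>
  have lim: "(\<rho> \<longlongrightarrow> c) (at_right 0)"
  proof (cases "j = 0")
    case True
    have "((\<lambda>\<epsilon>. T / (T / c + \<epsilon>)) \<longlongrightarrow> T / (T / c + 0)) (at_right 0)"
      using T c0[OF True] by (intro tendsto_intros) auto
    then show ?thesis using True T c0[OF True] by (simp add: \<rho>_def[abs_def])
  next
    case False
    have "((\<lambda>\<epsilon>. T * tan (arctan (c / T) - \<epsilon>)) \<longlongrightarrow> T * tan (arctan (c / T) - 0)) (at_right 0)"
      by (intro tendsto_intros) simp
    then show ?thesis using False T by (simp add: \<rho>_def[abs_def] tan_arctan)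
  qed
  \<comment> \<open>For \<open>j > 0\<close> this is the distance from the angle of \<open>x\<close>
    to pi.\<close>
  define \<epsilon>0 where "\<epsilon>0 = arctan (c / T) + pi / 2"
  have \<epsilon>0: "0 < \<epsilon>0" using arctan_lbound[of "c / T"] by (simp add: \<epsilon>0_def)
  have small: "\<forall>\<^sub>F \<epsilon> in at_right (0::real). 0 < \<epsilon> \<and> \<epsilon> < \<epsilon>0"
    using eventually_at_right[of 0 \<epsilon>0] \<epsilon>0 by (auto simp: eventually_at_right_field)
  have ang: "ang (w (\<rho> \<epsilon>)) j = ang x j + \<epsilon>" and lt: "\<rho> \<epsilon> < c" if \<epsilon>: "0 < \<epsilon> \<and> \<epsilon> < \<epsilon>0" for \<epsilon>
  proof -
    have "ang (w (\<rho> \<epsilon>)) j = ang x j + \<epsilon> \<and> \<rho> \<epsilon> < c"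
    proof (cases "j = 0")
      case True
      have "0 < T / c" using T c0[OF True] by simp
      then have "T / (T / c + \<epsilon>) < T / (T / c)" using T \<epsilon>
        by (intro divide_strict_left_mono mult_pos_pos add_pos_pos) auto
      then show ?thesis unfolding angw angx \<rho>_def using True T c0[OF True] \<epsilon> by simp
    next
      case False
      let ?a = "arctan (c / T)"
      have a: "- (pi / 2) < ?a - \<epsilon>" "?a - \<epsilon> < ?a" "?a < pi / 2"
        using \<epsilon> arctan_ubound[of "c / T"] by (auto simp: \<epsilon>0_def)
      have "tan (?a - \<epsilon>) < tan ?a" using a by (intro tan_monotone) auto
      then have "\<rho> \<epsilon> < c" using False T by (simp add: \<rho>_def tan_arctan field_simps)
      moreover have "arctan (tan (?a - \<epsilon>)) = ?a - \<epsilon>" using a by (intro arctan_tan) auto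
      then have "arctan (\<rho> \<epsilon> / T) = ?a - \<epsilon>" using False T by (simp add: \<rho>_def)
      ultimately show ?thesis unfolding angw angx using False by simp
    qed
    then show "ang (w (\<rho> \<epsilon>)) j = ang x j + \<epsilon>" "\<rho> \<epsilon> < c" by auto
  qed
  have "filterlim \<rho> (at_left c) (at_right 0)"
    using lim eventually_mono[OF small lt] by (rule tendsto_imp_filterlim_at_left)
  moreover have "\<forall>\<^sub>F r in at_left c. w r \<in> good_dirs j \<and> Q r"
    using eventually_conj[OF g Q] by (simp add: c_def w_def j_def)
  ultimately have "\<forall>\<^sub>F \<epsilon> in at_right 0. w (\<rho> \<epsilon>) \<in> good_dirs j \<and> Q (\<rho> \<epsilon>)"
    unfolding filterlim_iff by blast
  with small have "\<forall>\<^sub>F \<epsilon> in at_right 0. \<exists>r. Q r \<and>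
    half_flat p e j ((ang x)(j := ang x j + \<epsilon>)) = half_flat p e j (ang (w r))"
  proof eventually_elim
    case (elim \<epsilon>)
    let ?w = "w (\<rho> \<epsilon>)"
    have xw: "x - ?w \<in> Vh (Suc j)"
      using Vh_diff[OF x(1) Vh_scale[OF eh_in_Vh[of j k], of "\<rho> \<epsilon>"]] kj
        by (simp add: w_def algebra_simps)
    have "((ang x)(j := ang x j + \<epsilon>)) l = ang ?w l" if "j \<le> l" for l
    proof (cases "l = j")
      case True
      then show ?thesis using ang elim by simp
    next
      case False
      then have "x - ?w \<in> Vh l" using xw Vh_mono[of "Suc j" l] that by auto
      then show ?thesis using False ang_cong by simp
    qed
    then have "half_flat p e j ((ang x)(j := ang x j + \<epsilon>)) = cone j ?w"
      using elim kj by (intro half_flat_ang) auto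
    moreover have "half_flat p e j (ang ?w) = cone j ?w"
      using elim kj by (intro half_flat_ang) auto
    ultimately show ?case using elim by auto
  qed
  then show ?thesis by (simp add: j_def w_def)
qed

end

section \<open>The polar ordering depends semilinearly on the direction\<close>

lemma real_separation:
  fixes X Y :: "real set"
  assumes "finite X" "finite Y" "\<And>x y. x \<in> X \<Longrightarrow> y \<in> Y \<Longrightarrow> x < y"
  shows "\<exists>c. (\<forall>x\<in>X. x < c) \<and> (\<forall>y\<in>Y. c < y)"
proof (cases "X = {} \<or> Y = {}")
  case True
  then show ?thesis
  proof
    assume X: "X = {}"
    have "Min (insert 0 Y) - 1 < y" if "y \<in> Y" for y
    proof -
      have "Min (insert 0 Y) \<le> y" using assms(2) that by (intro Min_le) auto
      then show ?thesis by linarith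
    qed
    then show ?thesis using X by blast
  next
    assume Y: "Y = {}"
    have "x < Max (insert 0 X) + 1" if "x \<in> X" for x
    proof -
      have "x \<le> Max (insert 0 X)" using assms(1) that by (intro Max_ge) auto
      then show ?thesis by linarith
    qed
    then show ?thesis using Y by blast
  qed
next
  case False
  have "Max X < Min Y" using assms False by (simp add: Max_in Min_in)
  then obtain c where "Max X < c" "c < Min Y" using dense by blast
  then show ?thesis using assms False by (intro exI[of _ c]) auto
qed

definition same_signs :: "('a::real_vector \<Rightarrow> real) set \<Rightarrow> 'a \<Rightarrow> 'a \<Rightarrow> bool" where
  "same_signs \<Phi> x y \<longleftrightarrow> (\<forall>\<phi>\<in>\<Phi>. sgn (\<phi> x) = sgn (\<phi> y))"

definition linear_forms :: "('a::real_vector \<Rightarrow> real) set \<Rightarrow> bool" where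
  "linear_forms \<Phi> \<longleftrightarrow> finite \<Phi> \<and> (\<forall>\<phi>\<in>\<Phi>. linear \<phi>)"

lemma same_signs_Un: "same_signs (\<Phi> \<union> \<Psi>) x y \<longleftrightarrow> same_signs \<Phi> x y \<and> same_signs \<Psi> x y"
  by (auto simp: same_signs_def)

lemma linear_forms_Un: "linear_forms (\<Phi> \<union> \<Psi>) \<longleftrightarrow> linear_forms \<Phi> \<and> linear_forms \<Psi>"
  by (auto simp: linear_forms_def)

text \<open>The normalised forms \<open>\<phi> / \<phi> w\<close> have the same order at \<open>x\<close> and at \<open>y\<close>, so the position of \<open>t\<close>
  relative to their roots can be copied.\<close>

lemma Fourier_Motzkin:
  fixes \<Phi> :: "('a::real_vector \<Rightarrow> real) set"
  assumes "linear_forms \<Phi>"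
  shows "\<exists>\<Psi>. linear_forms \<Psi> \<and>
    (\<forall>x y t. same_signs \<Psi> x y \<longrightarrow> (\<exists>t'. same_signs \<Phi> (x + t *\<^sub>R w) (y + t' *\<^sub>R w)))"
proof -
  define \<Phi>1 where "\<Phi>1 = {\<phi>\<in>\<Phi>. \<phi> w \<noteq> 0}"
  define d where "d = (\<lambda>(\<phi> :: 'a \<Rightarrow> real, \<psi>) x. \<phi> x / \<phi> w - \<psi> x / \<psi> w)"
  define \<Psi> where "\<Psi> = {\<phi>\<in>\<Phi>. \<phi> w = 0} \<union> d ` (\<Phi>1 \<times> \<Phi>1)"
  have lin: "linear \<phi>" if "\<phi> \<in> \<Phi>" for \<phi> using assms that by (simp add: linear_forms_def)
  have fin: "finite \<Phi>1" using assms by (simp add: \<Phi>1_def linear_forms_def)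
  have "linear (d (\<phi>, \<psi>))" if "\<phi> \<in> \<Phi>1" "\<psi> \<in> \<Phi>1" for \<phi> \<psi>
  proof -
    have "linear \<phi>" "linear \<psi>" using that lin by (auto simp: \<Phi>1_def)
    then show ?thesis
      unfolding d_def by (auto simp: linear_iff add_divide_distrib diff_divide_distrib algebra_simps)
  qed
  then have 1: "linear_forms \<Psi>"
    using assms fin by (auto simp: \<Psi>_def linear_forms_def)
  have "\<exists>t'. same_signs \<Phi> (x + t *\<^sub>R w) (y + t' *\<^sub>R w)" if s: "same_signs \<Psi> x y" for x y t
  proof -
    define a where "a \<phi> = \<phi> x / \<phi> w" for \<phi> :: "'a \<Rightarrow> real"
    define b where "b \<phi> = \<phi> y / \<phi> w" for \<phi> :: "'a \<Rightarrow> real"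
    have ab: "sgn (a \<phi> - a \<psi>) = sgn (b \<phi> - b \<psi>)" if "\<phi> \<in> \<Phi>1" "\<psi> \<in> \<Phi>1" for \<phi> \<psi>
    proof -
      have "d (\<phi>, \<psi>) \<in> \<Psi>" using that by (auto simp: \<Psi>_def)
      then have "sgn (d (\<phi>, \<psi>) x) = sgn (d (\<phi>, \<psi>) y)" using s unfolding same_signs_def by blast
      then show ?thesis by (simp add: d_def a_def b_def)
    qed
    have "\<exists>t'. \<forall>\<phi>\<in>\<Phi>1. sgn (a \<phi> + t) = sgn (b \<phi> + t')"
    proof (cases "\<exists>\<psi>\<in>\<Phi>1. a \<psi> + t = 0")
      case True
      then obtain \<psi> where \<psi>: "\<psi> \<in> \<Phi>1" "t = - a \<psi>" by (auto simp: add_eq_0_iff)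
      then show ?thesis using ab by (intro exI[of _ "- b \<psi>"]) auto
    next
      case False
      have "\<exists>c. (\<forall>z\<in>b ` {\<phi>\<in>\<Phi>1. a \<phi> + t < 0}. z < c) \<and> (\<forall>z\<in>b ` {\<phi>\<in>\<Phi>1. 0 < a \<phi> + t}. c < z)"
      proof (rule real_separation)
        fix z z' assume "z \<in> b ` {\<phi>\<in>\<Phi>1. a \<phi> + t < 0}" "z' \<in> b ` {\<phi>\<in>\<Phi>1. 0 < a \<phi> + t}"
        then obtain \<phi> \<psi> where z: "\<phi> \<in> \<Phi>1" "a \<phi> + t < 0" "z = b \<phi>" "\<psi> \<in> \<Phi>1" "0 < a \<psi> + t" "z' = b \<psi>"
          by blast
        then have "sgn (b \<phi> - b \<psi>) = - 1" using ab[of \<phi> \<psi>] by simp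
        then show "z < z'" using z by (simp add: sgn_if split: if_splits)
      qed (use fin in auto)
      then obtain c where c: "\<And>\<phi>. \<phi> \<in> \<Phi>1 \<Longrightarrow> a \<phi> + t < 0 \<Longrightarrow> b \<phi> < c"
        "\<And>\<phi>. \<phi> \<in> \<Phi>1 \<Longrightarrow> 0 < a \<phi> + t \<Longrightarrow> c < b \<phi>" by auto
      have "sgn (a \<phi> + t) = sgn (b \<phi> + - c)" if "\<phi> \<in> \<Phi>1" for \<phi>
        using c[OF that] False that by (cases "a \<phi> + t" "0::real" rule: linorder_cases) auto
      then show ?thesis by blast
    qed
    then obtain t' where t': "\<And>\<phi>. \<phi> \<in> \<Phi>1 \<Longrightarrow> sgn (a \<phi> + t) = sgn (b \<phi> + t')" by blast
    have "sgn (\<phi> (x + t *\<^sub>R w)) = sgn (\<phi> (y + t' *\<^sub>R w))" if "\<phi> \<in> \<Phi>" for \<phi>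
    proof (cases "\<phi> w = 0")
      case True
      then have "\<phi> \<in> \<Psi>" using that by (simp add: \<Psi>_def)
      then show ?thesis
        using s True by (simp add: same_signs_def linear_add[OF lin[OF that]] linear_scale[OF lin[OF that]])
    next
      case False
      have "\<phi> (z + r *\<^sub>R w) = \<phi> w * (\<phi> z / \<phi> w + r)" for z r
        using False by (simp add: linear_add[OF lin[OF that]] linear_scale[OF lin[OF that]] distrib_left)
      moreover have "\<phi> \<in> \<Phi>1" using False that by (simp add: \<Phi>1_def)
      ultimately show ?thesis using t'[of \<phi>] by (simp add: sgn_mult a_def b_def)
    qed
    then show ?thesis by (auto simp: same_signs_def)
  qed
  then show ?thesis using 1 by blast
qed

context generic_arrangement
begin

abbreviation less :: "nat \<Rightarrow> real \<times> (real^'n) \<Rightarrow> (real^'n) set \<Rightarrow> (real^'n) set \<Rightarrow> bool" where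
  "less i u F G \<equiv> polar_less p e i (ang u) F G"

text \<open>Tameness is what makes the comparison of smaller sections constant for all small \<open>\<epsilon>\<close>.\<close>

definition tame :: "nat \<Rightarrow> (real \<times> (real^'n) \<Rightarrow> real) set \<Rightarrow> bool" where
  "tame i \<Phi> \<longleftrightarrow> linear_forms \<Phi> \<and> (\<forall>u\<in>good_dirs i. \<forall>u'\<in>good_dirs i. same_signs \<Phi> u u' \<longrightarrow>
     (\<forall>F\<in>facets A. \<forall>G\<in>facets A. less i u F G = less i u' F G))"

text \<open>The basis directions of \<open>Vh i\<close> are eliminated one at a time.\<close>

lemma Fourier_Motzkin_Vh:
  fixes \<Phi> :: "(real \<times> (real^'n) \<Rightarrow> real) set"
  assumes "i \<le> CARD('n)" "linear_forms \<Phi>"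
  shows "\<exists>\<Psi>. linear_forms \<Psi> \<and>
    (\<forall>x y. same_signs \<Psi> x y \<longrightarrow> (\<forall>z\<in>Vh i. \<exists>z'\<in>Vh i. same_signs \<Phi> (x + z) (y + z')))"
  using assms(1)
proof (induction i)
  case 0
  show ?case using assms(2) by (intro exI[of _ \<Phi>]) (auto simp: Vh_0)
next
  case (Suc i)
  then obtain \<Phi>1 where 1: "linear_forms \<Phi>1"
    "\<And>x y z. same_signs \<Phi>1 x y \<Longrightarrow> z \<in> Vh i \<Longrightarrow> \<exists>z'\<in>Vh i. same_signs \<Phi> (x + z) (y + z')"
    by (metis Suc_leD)
  obtain \<Psi> where 2: "linear_forms \<Psi>"
    "\<And>x y t. same_signs \<Psi> x y \<Longrightarrow> \<exists>t'. same_signs \<Phi>1 (x + t *\<^sub>R eh i) (y + t' *\<^sub>R eh i)"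
    using Fourier_Motzkin[OF 1(1), of "eh i"] by metis
  have "\<exists>z'\<in>Vh (Suc i). same_signs \<Phi> (x + z) (y + z')"
    if xy: "same_signs \<Psi> x y" and z: "z \<in> Vh (Suc i)" for x y z
  proof -
    have ei: "eh i \<in> Vh (Suc i)" using Suc.prems by (intro eh_in_Vh) auto
    let ?t = "z \<bullet> eh i"
    have "z - ?t *\<^sub>R eh i \<in> Vh i"
      by (rule Vh_SucD) (use z ei Suc.prems in \<open>auto intro: Vh_diff Vh_scale
        simp: inner_diff_left eh_orthonormal\<close>)
    moreover obtain t' where "same_signs \<Phi>1 (x + ?t *\<^sub>R eh i) (y + t' *\<^sub>R eh i)" using 2(2)[OF xy]
      by blast
    ultimately obtain z' where z': "z' \<in> Vh i"
      "same_signs \<Phi> (x + ?t *\<^sub>R eh i + (z - ?t *\<^sub>R eh i)) (y + t' *\<^sub>R eh i + z')"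
      using 1(2) by blast
    have "t' *\<^sub>R eh i + z' \<in> Vh (Suc i)"
      using ei z'(1) Vh_mono[of i "Suc i"] by (intro Vh_add Vh_scale) auto
    moreover have "x + ?t *\<^sub>R eh i + (z - ?t *\<^sub>R eh i) = x + z" by simp
    moreover have "y + t' *\<^sub>R eh i + z' = y + (t' *\<^sub>R eh i + z')" by simp
    ultimately show ?thesis using z'(2) by metis
  qed
  then show ?case using 2(1) by blast
qed

section \<open>Nonempty sections and the comparison in dimension 0\<close>

definition sign_forms :: "(real \<times> (real^'n) \<Rightarrow> real) set" where
  "sign_forms = insert fst ((\<lambda>H x. hform H \<bullet> x) ` A)"

lemma linear_inner_left: "linear (\<lambda>x. h \<bullet> (x :: real \<times> (real^'n)))"
  by (rule linearI) (auto simp: inner_add_right)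

lemma linear_forms_sign_forms: "linear_forms sign_forms"
  using finite_A linear_fst by (auto simp: linear_forms_def sign_forms_def linear_inner_left)

lemma sign_forms_sign_eq: "same_signs sign_forms x y \<Longrightarrow> sign_eq z x \<longleftrightarrow> sign_eq z y"
  by (simp add: same_signs_def sign_forms_def sign_eq_def)

lemma sign_forms_fst: "same_signs sign_forms x y \<Longrightarrow> 0 < fst x \<longleftrightarrow> 0 < fst y"
  by (auto simp: same_signs_def sign_forms_def sgn_if split: if_splits)

text \<open>Nonemptiness becomes the existence of a vector in \<open>Vh i\<close> with prescribed
  signs, the form that elimination can handle.\<close>

lemma section_nonempty_iff:
  assumes "F \<in> facets A"
  shows "F \<inter> cone i u \<noteq> {} \<longleftrightarrow> (\<exists>z\<in>Vh i. 0 < fst (u + z) \<and> sign_eq (rep F) (u + z))"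
proof
  assume "F \<inter> cone i u \<noteq> {}"
  then obtain q s where q: "sign_eq (rep F) (hom q)" "0 < s" "hom q - s *\<^sub>R u \<in> Vh i"
    using mem_facet_iff[OF assms] by (auto simp: cone_def)
  have "(1 / s) *\<^sub>R hom q - u \<in> Vh i"
    using Vh_scale[OF q(3), of "1 / s"] q(2) by (simp add: algebra_simps)
  then show "\<exists>z\<in>Vh i. 0 < fst (u + z) \<and> sign_eq (rep F) (u + z)"
    using q by (intro bexI[of _ "(1 / s) *\<^sub>R hom q - u"]) (auto simp: sign_eq_scale)
next
  assume "\<exists>z\<in>Vh i. 0 < fst (u + z) \<and> sign_eq (rep F) (u + z)"
  then obtain z where z: "z \<in> Vh i" "0 < fst (u + z)" "sign_eq (rep F) (u + z)" by blast
  have "hom (pnt (u + z)) - (1 / fst (u + z)) *\<^sub>R u \<in> Vh i"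
    using z(2) Vh_scale[OF z(1), of "1 / fst (u + z)"]
      by (simp add: hom_pnt divide_inverse algebra_simps)
  moreover have "0 < 1 / fst (u + z)" using z(2) by simp
  ultimately have "pnt (u + z) \<in> cone i u" unfolding cone_def by blast
  moreover have "pnt (u + z) \<in> F" using z mem_facet_iff[OF assms] by (simp add: sign_eq_pnt)
  ultimately show "F \<inter> cone i u \<noteq> {}" by blast
qed

lemma section_ang: "u \<in> good_dirs i \<Longrightarrow> i < CARD('n) \<Longrightarrow> section_of p e i (ang u) F = F \<inter> cone i u"
  by (simp add: section_of_def half_flat_ang)

lemma polar_less_empty:
  "section_of p e i th G = {} \<Longrightarrow> \<not> polar_less p e i th F G"
  "section_of p e i th G \<noteq> {} \<Longrightarrow> section_of p e i th F = {} \<Longrightarrow> polar_less p e i th F G"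
  by (simp_all add: polar_less.simps[of p e i th F G] Let_def)

lemma cone_0: "0 < fst u \<Longrightarrow> cone 0 u = {pnt u}"
proof -
  assume u: "0 < fst u"
  have "q \<in> cone 0 u \<longleftrightarrow> q = pnt u" for q
  proof
    assume "q \<in> cone 0 u"
    then obtain s where "0 < s" "hom q = s *\<^sub>R u" by (auto simp: cone_def Vh_0)
    then show "q = pnt u" using pnt_scale[of s u] by (metis less_irrefl pnt_hom)
  next
    assume "q = pnt u"
    then have "hom q - inverse (fst u) *\<^sub>R u \<in> Vh 0" using u by (simp add: hom_pnt Vh_0)
    then show "q \<in> cone 0 u" using u unfolding cone_def
      by (auto intro!: exI[of _ "inverse (fst u)"])
  qed
  then show ?thesis by blast
qed

lemma half_flat_0_section:
  assumes "half_flat_dir 0 th u"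
  shows "section_of p e 0 th F = F \<inter> {pnt u}"
  using assms cone_0 by (auto simp: half_flat_dir_def section_of_def good_dirs_def)

text \<open>Sections in dimension 0 are empty or the point \<open>pnt u\<close>, which lies in a
  single facet; what remains is the comparison of an empty section with a nonempty one.\<close>

lemma polar_less_0_iff:
  assumes "half_flat_dir 0 th u" "F \<in> facets A" "G \<in> facets A"
  shows "polar_less p e 0 th F G \<longleftrightarrow> pnt u \<in> G \<and> pnt u \<notin> F"
proof -
  note s = half_flat_0_section[OF assms(1)]
  show ?thesis
  proof (cases "pnt u \<in> G \<and> pnt u \<in> F")
    case True
    then have "F = G" using facets_disjoint assms by blast
    then show ?thesis using polar_less_irrefl True by blast
  next
    case False
    then show ?thesis
      using s[of F] s[of G] polar_less_empty[of 0 th] by (cases "pnt u \<in> G") auto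
  qed
qed

lemma tame_0: "tame 0 sign_forms"
  unfolding tame_def
proof (intro conjI ballI impI linear_forms_sign_forms)
  fix u u' F G assume u: "u \<in> good_dirs 0" "u' \<in> good_dirs 0" "same_signs sign_forms u u'"
    "F \<in> facets A" "G \<in> facets A"
  have "pnt u \<in> F \<longleftrightarrow> pnt u' \<in> F" if "F \<in> facets A" for F
    using u(1,2) sign_forms_sign_eq[OF u(3)] mem_facet_iff[OF that]
      by (simp add: sign_eq_pnt good_dirs_def)
  moreover have "half_flat_dir 0 (ang u) u" "half_flat_dir 0 (ang u') u'"
    using u half_flat_dir_ang by auto
  ultimately show "less 0 u F G = less 0 u' F G" using polar_less_0_iff u(4,5) by simp
qed

text \<open>On the line \<open>\<phi>\<close> is affine in \<open>r\<close>. At a root the sign to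
  the left is opposite to the slope \<open>\<phi> w\<close>, which does not depend on the base point
  \<open>v\<close>.\<close>

lemma eventually_sign:
  fixes \<phi> :: "'a::real_vector \<Rightarrow> real"
  assumes "linear \<phi>"
  shows "\<forall>\<^sub>F r in at_left c. sgn (\<phi> (v + r *\<^sub>R w)) =
    (if \<phi> (v + c *\<^sub>R w) = 0 then - sgn (\<phi> w) else sgn (\<phi> (v + c *\<^sub>R w)))"
proof -
  let ?a = "\<phi> (v + c *\<^sub>R w)"
  have lin: "\<phi> (v + r *\<^sub>R w) = \<phi> v + r * \<phi> w" for r
    by (simp add: linear_add[OF assms] linear_scale[OF assms])
  have lim: "((\<lambda>r. \<phi> (v + r *\<^sub>R w)) \<longlongrightarrow> ?a) (at_left c)"
    unfolding lin by (intro tendsto_intros)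
  consider "?a = 0" | "?a < 0" | "0 < ?a" by linarith
  then show ?thesis
  proof cases
    case 1
    have "\<forall>\<^sub>F r in at_left c. r < c" by (simp add: eventually_at_filter)
    then show ?thesis
    proof eventually_elim
      case (elim r)
      have "\<phi> (v + r *\<^sub>R w) = - ((c - r) * \<phi> w)" using 1 unfolding lin by (simp add: algebra_simps)
      then show ?case using 1 elim by (simp add: sgn_mult)
    qed
  next
    case 2
    have "\<forall>\<^sub>F r in at_left c. \<phi> (v + r *\<^sub>R w) < 0" using order_tendstoD(2)[OF lim 2] .
    then show ?thesis using 2 by (auto elim: eventually_mono)
  next
    case 3
    have "\<forall>\<^sub>F r in at_left c. 0 < \<phi> (v + r *\<^sub>R w)" using order_tendstoD(1)[OF lim 3] .
    then show ?thesis using 3 by (auto elim: eventually_mono)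
  qed
qed

text \<open>Equal signs at the two limit directions give equal signs to the left of them, as both
  lines run in the direction \<open>eh j\<close>. Two different lines serve the induction for
  tameness; one line taken twice shows that the comparison is eventually constant.\<close>

lemma eventually_constant:
  assumes t: "tame j \<Phi>" and F: "F \<in> facets A" "G \<in> facets A"
    and g: "\<forall>\<^sub>F r in at_left c. v + r *\<^sub>R eh j \<in> good_dirs j"
      "\<forall>\<^sub>F r in at_left c'. v' + r *\<^sub>R eh j \<in> good_dirs j"
    and s: "same_signs \<Phi> (v + c *\<^sub>R eh j) (v' + c' *\<^sub>R eh j)"
  shows "\<exists>b. (\<forall>\<^sub>F r in at_left c. less j (v + r *\<^sub>R eh j) F G = b) \<and>
    (\<forall>\<^sub>F r in at_left c'. less j (v' + r *\<^sub>R eh j) F G = b)"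
proof -
  have fin: "finite \<Phi>" and lin: "\<And>\<phi>. \<phi> \<in> \<Phi> \<Longrightarrow> linear \<phi>"
    using t by (auto simp: tame_def linear_forms_def)
  define \<sigma> where "\<sigma> \<phi> = (if \<phi> (v + c *\<^sub>R eh j)
    = 0 then - sgn (\<phi> (eh j)) else sgn (\<phi> (v + c *\<^sub>R eh j)))"
    for \<phi> :: "real \<times> (real^'n) \<Rightarrow> real"
  have e1: "\<forall>\<^sub>F r in at_left c. v + r *\<^sub>R eh j \<in> good_dirs j \<and> (\<forall>\<phi>\<in>\<Phi>. sgn (\<phi> (v + r *\<^sub>R eh j))
    = \<sigma> \<phi>)"
    using eventually_sign[OF lin] fin g(1) unfolding \<sigma>_def
    by (intro eventually_conj eventually_ball_finite) auto
  have \<sigma>': "\<sigma> \<phi> = (if \<phi> (v' + c' *\<^sub>R eh j)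
    = 0 then - sgn (\<phi> (eh j)) else sgn (\<phi> (v' + c' *\<^sub>R eh j)))"
    if "\<phi> \<in> \<Phi>" for \<phi>
  proof -
    have "sgn (\<phi> (v + c *\<^sub>R eh j)) = sgn (\<phi> (v' + c' *\<^sub>R eh j))" using s that
      by (simp add: same_signs_def)
    then show ?thesis unfolding \<sigma>_def by (metis sgn_zero_iff)
  qed
  have e2: "\<forall>\<^sub>F r in at_left c'. v' + r *\<^sub>R eh j \<in> good_dirs j \<and> (\<forall>\<phi>\<in>\<Phi>. sgn (\<phi> (v' + r *\<^sub>R eh j))
    = \<sigma> \<phi>)"
    using eventually_sign[OF lin] fin g(2) \<sigma>'
    by (intro eventually_conj eventually_ball_finite) auto
  obtain r0 where r0: "v + r0 *\<^sub>R eh j \<in> good_dirs j" "\<forall>\<phi>\<in>\<Phi>. sgn (\<phi> (v + r0 *\<^sub>R eh j)) = \<sigma> \<phi>"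
    using eventually_happens'[OF trivial_limit_at_left_real e1] by blast
  have *: "less j w F G = less j (v + r0 *\<^sub>R eh j) F G"
    if "w \<in> good_dirs j \<and> (\<forall>\<phi>\<in>\<Phi>. sgn (\<phi> w) = \<sigma> \<phi>)" for w
  proof -
    have "same_signs \<Phi> w (v + r0 *\<^sub>R eh j)" using that r0 by (simp add: same_signs_def)
    then show ?thesis using t that r0(1) F unfolding tame_def by blast
  qed
  show ?thesis
  proof (intro exI conjI)
    show "\<forall>\<^sub>F r in at_left c. less j (v + r *\<^sub>R eh j) F G = less j (v + r0 *\<^sub>R eh j) F G"
      using e1 by (rule eventually_mono) (rule *)
    show "\<forall>\<^sub>F r in at_left c'. less j (v' + r *\<^sub>R eh j) F G = less j (v + r0 *\<^sub>R eh j) F G"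
      using e2 by (rule eventually_mono) (rule *)
  qed
qed

text \<open>By \<open>angle_path\<close> the eventual truth value on the line of directions is also
  the one for small \<epsilon>. Truth for all small \<epsilon> is then equivalent to
  \<open>b\<close>, since the filter at 0 is nontrivial.\<close>

lemma recursion_constant:
  assumes v: "v \<in> good_dirs k" and k: "1 \<le> k" "k \<le> CARD('n)" and B: "B \<in> codim_fam k" and x:
    "x = flat_proj B k v"
    and b: "\<forall>\<^sub>F r in at_left (x \<bullet> eh (k - 1)). less (k - 1) (v + r *\<^sub>R eh (k - 1)) F G = b"
  shows "(\<forall>\<^sub>F \<epsilon> in at_right 0. polar_less p e (k - 1) ((ang x)(k - 1 := ang x (k - 1) + \<epsilon>)) F G)
    \<longleftrightarrow> b"
proof -
  have xV: "x - v \<in> Vh k" "0 < fst x"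
    using flat_proj_props(2)[OF B k(2)] adm_cone_pos[OF k(2) _ B, of v] v x
      by (auto simp: good_dirs_def)
  have "\<forall>\<^sub>F \<epsilon> in at_right 0. polar_less p e (k - 1) ((ang x)(k - 1 := ang x (k - 1) + \<epsilon>)) F G = b"
    using angle_path[OF v k xV good_dirs_step[OF v k B, folded x] b]
    by (rule eventually_mono) (metis polar_less_cong)
  then have "\<forall>\<^sub>F \<epsilon> in at_right (0::real). (polar_less p e (k - 1) ((ang x)(k - 1 := ang x (k - 1) + \<epsilon>)) F G) = b" .
  note ev = this
  show ?thesis
  proof
    assume "\<forall>\<^sub>F \<epsilon> in at_right 0. polar_less p e (k - 1) ((ang x)(k - 1 := ang x (k - 1) + \<epsilon>)) F G"
    with ev have "\<forall>\<^sub>F \<epsilon> in at_right (0::real). b" by eventually_elim simp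
    then show b using eventually_happens'[OF trivial_limit_at_right_real] by blast
  next
    assume b
    with ev show "\<forall>\<^sub>F \<epsilon> in at_right 0. polar_less p e (k - 1) ((ang x)(k - 1 := ang x (k - 1) + \<epsilon>)) F G"
      by (auto elim: eventually_mono)
  qed
qed

text \<open>All angles of \<open>x\<close> from \<open>i - 1\<close> on vanish, while at
  \<open>x'\<close> the angle \<theta>_(i-1) is positive and the later ones are nonnegative. A
  section of index below \<open>i\<close> thus precedes those of index at least \<open>i\<close>,
  whatever the direction.\<close>

lemma antilex_mixed:
  assumes "x \<in> Vh i" "x' \<notin> Vh i" "1 \<le> i" "i \<le> CARD('n)" "0 < fst x" "0 < fst x'"
  shows "pnt x \<noteq> pnt x'" "antilex_less CARD('n) (ang x) (ang x')"
    "\<not> antilex_less CARD('n) (ang x') (ang x)"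
proof -
  have Sx: "Suc (i - 1) = i" "i - 1 < CARD('n)" using assms by auto
  have x0: "ang x j = 0" if "i - 1 \<le> j" for j
  proof -
    have "i \<le> Suc j" using that by linarith
    then show ?thesis using ang_Vh[of x j] assms(1) Vh_mono[of i "Suc j"] by auto
  qed
  have x'p: "0 < ang x' (i - 1)" using ang_pos[OF assms(6) Sx(2)] assms(2) Sx(1) by simp
  have n: "\<not> antilex_less CARD('n) (ang x') (ang x)"
  proof
    assume "antilex_less CARD('n) (ang x') (ang x)"
    then obtain k where k: "k < CARD('n)" "ang x' k < ang x k"
      "\<And>j. k < j \<Longrightarrow> j < CARD('n) \<Longrightarrow> ang x' j = ang x j"
      by (auto simp: antilex_less_def)
    have "\<not> i - 1 \<le> k" using x0[of k] k(2) ang_nonneg[OF assms(6), of k] by auto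
    then have "ang x' (i - 1) = ang x (i - 1)" using k(3)[of "i - 1"] Sx(2) by simp
    then show False using x'p x0[of "i - 1"] by simp
  qed
  then show "\<not> antilex_less CARD('n) (ang x') (ang x)" .
  show "antilex_less CARD('n) (ang x) (ang x')"
    using antilex_less_total[OF Sx(2), of "ang x" "ang x'"] n x0[of "i - 1"] x'p by auto
  show "pnt x \<noteq> pnt x'"
  proof
    assume "pnt x = pnt x'"
    then have "x /\<^sub>R fst x = x' /\<^sub>R fst x'" using hom_pnt[of x] hom_pnt[of x'] assms(5,6) by simp
    moreover have "x /\<^sub>R fst x \<in> Vh i" using assms(1) by (rule Vh_scale)
    ultimately have "fst x' *\<^sub>R (x' /\<^sub>R fst x') \<in> Vh i" using Vh_scale by metis
    then show False using assms(2,6) by simp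
  qed
qed

text \<open>Whether a nonempty section is a point depends only on the hyperplanes containing
  \<open>F\<close>: if they extend to a family of codimension \<open>i - 1\<close>, a small move
  along its flat stays in the facet and in V_i(u).\<close>

lemma section_singleton_iff:
  assumes "half_flat_dir i th u" "F \<in> facets A" "section_of p e i th F \<noteq> {}" "1 \<le> i" "i < CARD('n)"
  shows "aff_dim (section_of p e i th F) = 0 \<longleftrightarrow> (\<exists>B\<in>codim_fam i. B \<subseteq> active (rep F))"
proof -
  let ?S = "section_of p e i th F"
  have i: "i \<le> CARD('n)" "u \<in> good_dirs i" using half_flat_dirD[OF assms(1)] by auto
  have S: "?S = F \<inter> cone i u" using assms(1,5) by (auto simp: half_flat_dir_def section_of_def)
  have mem: "r \<in> ?S \<Longrightarrow> \<exists>s>0. (1 / s) *\<^sub>R hom r - u \<in> Vh i \<and> sign_eq (rep F) ((1 / s) *\<^sub>R hom r)"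
    for r
  proof -
    assume "r \<in> ?S"
    then obtain s where s: "0 < s" "hom r - s *\<^sub>R u \<in> Vh i" "sign_eq (rep F) (hom r)"
      using S mem_facet_iff[OF assms(2)] by (auto simp: cone_def)
    then show ?thesis
      using Vh_scale[OF s(2), of "1 / s"]
        by (intro exI[of _ s]) (simp add: sign_eq_scale algebra_simps)
  qed
  have active: "active x = active (rep F)" if "sign_eq (rep F) x" for x
  proof -
    have "hform H \<bullet> x = 0 \<longleftrightarrow> hform H \<bullet> rep F = 0" if "H \<in> A" for H
      using \<open>sign_eq (rep F) x\<close> that unfolding sign_eq_def by (metis sgn_zero_iff)
    then show ?thesis by (auto simp: active_def)
  qed
  show ?thesis
  proof
    assume "\<exists>B\<in>codim_fam i. B \<subseteq> active (rep F)"
    then obtain B where B: "B \<in> codim_fam i" "B \<subseteq> active (rep F)" by blast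
    have "r = pnt (flat_proj B i u)" if r: "r \<in> ?S" for r
    proof -
      obtain s where s: "0 < s" "(1 / s) *\<^sub>R hom r - u \<in> Vh i" "sign_eq (rep F) ((1 / s) *\<^sub>R hom r)"
        using mem[OF r] by blast
      have "(1 / s) *\<^sub>R hom r \<in> Lh B" using B(2) active[OF s(3)] by (intro in_Lh_active) simp
      then have "flat_proj B i u = (1 / s) *\<^sub>R hom r" using s(2)
        by (intro flat_proj_eqI[OF B(1) i(1)])
      then show ?thesis using pnt_scale[of "1 / s" "hom r"] s(1) by simp
    qed
    then have "?S = {pnt (flat_proj B i u)}" using assms(3) by blast
    then show "aff_dim ?S = 0" by simp
  next
    assume "aff_dim ?S = 0"
    then obtain r where r: "?S = {r}" using aff_dim_eq_0 by blast
    then obtain s where s: "0 < s" "(1 / s) *\<^sub>R hom r - u \<in> Vh i"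
      "sign_eq (rep F) ((1 / s) *\<^sub>R hom r)"
      using mem by blast
    let ?x = "(1 / s) *\<^sub>R hom r"
    show "\<exists>B\<in>codim_fam i. B \<subseteq> active (rep F)"
    proof (rule ccontr)
      assume "\<not> ?thesis"
      then obtain B where B: "B \<in> codim_fam (i - 1)" "active ?x \<subseteq> B"
        using active_dichotomy[of ?x i] active[OF s(3)] s(1) assms(4) i(1) by auto
      have i1: "i - 1 \<le> CARD('n)" "i - 1 < i" using assms(4) i by auto
      let ?w = "flat_proj B (i - 1) (eh (i - 1))"
      have wL: "?w \<in> Lh (active ?x)" using flat_proj_props(1)[OF B(1) i1(1)] Lh_antimono[OF B(2)]
        by blast
      have "?w - eh (i - 1) \<in> Vh i"
        by (rule subsetD[OF Vh_mono flat_proj_props(2)[OF B(1) i1(1)]]) simp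
      then have wV: "?w \<in> Vh i"
        using Vh_add[OF _ eh_in_Vh[OF i1(2,1)], of "?w - eh (i - 1)"] by simp
      have w1: "?w \<bullet> eh (i - 1) = 1" using flat_proj_coord[OF B(1) _ i1(1)] i1
        by (simp add: eh_orthonormal)
      have wf: "0 < fst ?w" using adm_cone_pos[OF i1(1) eh_adm_cone[OF i1(1)] B(1)] .
      obtain t where t: "0 < t" "\<forall>H\<in>A - active ?x. t * \<bar>hform H \<bullet> ?w\<bar> < \<bar>hform H \<bullet> ?x\<bar>"
        using small_scaling[of "A - active ?x" "\<lambda>H. \<bar>hform H \<bullet> ?x\<bar>" "\<lambda>H. \<bar>hform H \<bullet> ?w\<bar>"] finite_A
        by (auto simp: active_def)
      let ?z = "?x + t *\<^sub>R ?w"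
      have "sgn (hform H \<bullet> ?z) = sgn (hform H \<bullet> ?x)" if H: "H \<in> A" for H
      proof (cases "H \<in> active ?x")
        case True
        then have "hform H \<bullet> ?w = 0" using wL by (simp add: Lh_def)
        then show ?thesis by (simp add: inner_add_right)
      next
        case False
        then have "\<bar>t * (hform H \<bullet> ?w)\<bar> < \<bar>hform H \<bullet> ?x\<bar>" using t H by (simp add: abs_mult)
        moreover have "hform H \<bullet> ?z = hform H \<bullet> ?x + t * (hform H \<bullet> ?w)"
          by (simp only: inner_add_right inner_scaleR_right)
        ultimately show ?thesis by (auto simp: sgn_if abs_if split: if_splits)
      qed
      then have ez: "sign_eq (rep F) ?z" using s(3) by (simp add: sign_eq_def)
      have fz: "0 < fst ?z" using s(1) t(1) wf by (simp add: add_pos_pos)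
      have zV: "?z - u \<in> Vh i"
        using Vh_add[OF s(2) Vh_scale[OF wV, of t]] by (simp add: algebra_simps)
      have "hom (pnt ?z) - (1 / fst ?z) *\<^sub>R u \<in> Vh i"
        using Vh_scale[OF zV, of "1 / fst ?z"] hom_pnt[of ?z] fz
        by (simp only: scaleR_diff_right divide_inverse mult_1)
      moreover have "0 < 1 / fst ?z" using fz by simp
      ultimately have "pnt ?z \<in> cone i u" unfolding cone_def by blast
      moreover have "pnt ?z \<in> F" using ez fz mem_facet_iff[OF assms(2)] sign_eq_pnt by blast
      ultimately have "pnt ?z = r" using r S by blast
      then have "pnt ?z = pnt ?x" using pnt_scale[of "1 / s" "hom r"] s(1) by simp
      moreover have "0 < fst ?x" using s(1) by simp
      ultimately have "?z = ?x" using pnt_inj[OF i(2) zV s(2) fz] by blast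
      then have "?w = 0" using t(1) by simp
      then show False using wf by simp
    qed
  qed
qed

text \<open>The first forms decide which candidate vertices belong to a closed facet; the second
  compare candidates, both for the optimum and for the order of the angle vectors.\<close>

definition vertex_forms :: "nat \<Rightarrow> (real \<times> (real^'n) \<Rightarrow> real) set" where
  "vertex_forms i = (\<lambda>(H, B) u. hform H \<bullet> flat_proj B i u) ` (A \<times> codim_fam i) \<union>
     (\<lambda>(j, B, B') u. (flat_proj B i u - flat_proj B' i u) \<bullet> eh j) ` ({..CARD('n)} \<times> codim_fam i \<times> codim_fam i)"

text \<open>The forms \<open>\<Phi>\<close> for dimension \<open>i - 1\<close>, evaluated at the
  limit direction of the smaller sections at each candidate vertex.\<close>

definition step_forms :: "nat \<Rightarrow> (real \<times> (real^'n) \<Rightarrow> real) set \<Rightarrow> (real \<times> (real^'n) \<Rightarrow> real) set" where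
  "step_forms i \<Phi> = (\<lambda>(\<phi>, B) u. \<phi> (u + (flat_proj B i u \<bullet> eh (i - 1)) *\<^sub>R eh (i - 1))) ` (\<Phi> \<times> codim_fam i)"

lemma linear_forms_vertex_forms:
  assumes "i \<le> CARD('n)"
  shows "linear_forms (vertex_forms i)"
proof -
  have "linear (\<lambda>u. hform H \<bullet> flat_proj B i u)" if "B \<in> codim_fam i" for H B
    using linear_compose[OF linear_flat_proj[OF that assms] linear_inner_left] by (simp add: o_def)
  moreover have "linear (\<lambda>u. (flat_proj B i u - flat_proj B' i u) \<bullet> eh j)"
    if "B \<in> codim_fam i" "B' \<in> codim_fam i" for B B' j
    using linear_compose[OF linear_compose_sub[OF linear_flat_proj[OF that(1)
      assms] linear_flat_proj[OF that(2) assms]]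
      linear_inner_left[of "eh j"]] by (simp add: o_def inner_commute)
  ultimately show ?thesis
    using finite_A finite_codim_fam by (auto simp: linear_forms_def vertex_forms_def)
qed

lemma linear_forms_step_forms:
  assumes "i \<le> CARD('n)" "linear_forms \<Phi>"
  shows "linear_forms (step_forms i \<Phi>)"
proof -
  have "linear (\<lambda>u. \<phi> (u + (flat_proj B i u \<bullet> eh (i - 1)) *\<^sub>R eh (i - 1)))"
    if "\<phi> \<in> \<Phi>" "B \<in> codim_fam i" for \<phi> B
  proof -
    have l: "linear (flat_proj B i)" by (rule linear_flat_proj[OF that(2) assms(1)])
    have "linear (\<lambda>u. u + (flat_proj B i u \<bullet> eh (i - 1)) *\<^sub>R eh (i - 1))"
      by (rule linearI) (auto simp: linear_add[OF l] linear_scale[OF l] algebra_simps inner_add_left)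
    moreover have "linear \<phi>" using that assms(2) by (simp add: linear_forms_def)
    ultimately show ?thesis using linear_compose[of _ \<phi>] by (simp add: o_def)
  qed
  then show ?thesis
    using assms(2) finite_codim_fam by (auto simp: linear_forms_def step_forms_def)
qed

lemma vertex_forms_weak_conf:
  assumes "same_signs (vertex_forms i) u u'" "B \<in> codim_fam i"
  shows "weak_conf y (flat_proj B i u) \<longleftrightarrow> weak_conf y (flat_proj B i u')"
proof -
  have *: "sgn (hform H \<bullet> flat_proj B i u) = sgn (hform H \<bullet> flat_proj B i u')" if "H \<in> A" for H
  proof -
    have "(\<lambda>u. hform H \<bullet> flat_proj B i u) \<in> vertex_forms i"
      unfolding vertex_forms_def
        by (rule UnI1, rule image_eqI[of _ _ "(H, B)"]) (simp_all add: assms that)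
    from bspec[OF assms(1)[unfolded same_signs_def] this] show ?thesis .
  qed
  then have "hform H \<bullet> flat_proj B i u = 0 \<longleftrightarrow> hform H \<bullet> flat_proj B i u' = 0" if "H \<in> A" for H
    using that by (metis sgn_zero_iff)
  then show ?thesis using * unfolding weak_conf_def by auto
qed

lemma vertex_forms_coord:
  assumes "same_signs (vertex_forms i) u u'" "B \<in> codim_fam i" "B' \<in> codim_fam i" "j \<le> CARD('n)"
  shows "flat_proj B i u \<bullet> eh j < flat_proj B' i u \<bullet> eh j
    \<longleftrightarrow> flat_proj B i u' \<bullet> eh j < flat_proj B' i u' \<bullet> eh j"
    and "flat_proj B i u \<bullet> eh j = flat_proj B' i u \<bullet> eh j \<longleftrightarrow> flat_proj B i u' \<bullet> eh j
      = flat_proj B' i u' \<bullet> eh j"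
proof -
  have "(\<lambda>u. (flat_proj B i u - flat_proj B' i u) \<bullet> eh j) \<in> vertex_forms i"
    unfolding vertex_forms_def
    by (rule UnI2, rule image_eqI[of _ _ "(j, B, B')"]) (simp_all add: assms)
  from bspec[OF assms(1)[unfolded same_signs_def] this]
  have "sgn ((flat_proj B i u - flat_proj B' i u) \<bullet> eh j)
    = sgn ((flat_proj B i u' - flat_proj B' i u') \<bullet> eh j)" .
  then show "flat_proj B i u \<bullet> eh j < flat_proj B' i u \<bullet> eh j
    \<longleftrightarrow> flat_proj B i u' \<bullet> eh j < flat_proj B' i u' \<bullet> eh j"
    and "flat_proj B i u \<bullet> eh j = flat_proj B' i u \<bullet> eh j \<longleftrightarrow> flat_proj B i u' \<bullet> eh j
      = flat_proj B' i u' \<bullet> eh j"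
    by (auto simp: inner_diff_left sgn_if split: if_splits)
qed

text \<open>Any competitor over \<open>u'\<close> is dominated by a candidate
  \<open>flat_proj B' i u'\<close>; the same family gives a competitor over \<open>u\<close>, where
  the comparison has the same outcome.\<close>

lemma top_vertex_transfer:
  assumes u: "u \<in> good_dirs i" "u' \<in> good_dirs i" "same_signs (vertex_forms i) u u'"
    and i: "1 \<le> i" "i \<le> CARD('n)" and av: "avoids y i" and B: "B \<in> codim_fam i" and mv:
      "top_vertex y i u (flat_proj B i u)"
  shows "top_vertex y i u' (flat_proj B i u')"
proof -
  have in_slice: "flat_proj B i v \<in> slice y i v \<longleftrightarrow> weak_conf y (flat_proj B i v)"
    if "B \<in> codim_fam i" "v \<in> good_dirs i" for B v
    using flat_proj_props(2)[OF that(1) i(2), of v] adm_cone_pos[OF i(2) _ that(1), of v] that(2)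
    by (simp add: slice_def good_dirs_def)
  have "z \<bullet> eh (i - 1) \<le> flat_proj B i u' \<bullet> eh (i - 1)" if z: "z \<in> slice y i u'" for z
  proof -
    obtain w B' where w: "w \<in> slice y i u'" "B' \<in> codim_fam i" "B' \<subseteq> active w"
      "w = z \<or> z \<bullet> eh (i - 1) < w \<bullet> eh (i - 1)"
      using climb_to_vertex[OF av i z] by blast
    have w': "w = flat_proj B' i u'" using vertex_eq_flat_proj[OF w(1-3) i(2)] .
    then have "flat_proj B' i u \<in> slice y i u"
      using in_slice[OF w(2)] u w(1) vertex_forms_weak_conf[OF u(3) w(2)] by simp
    then have "\<not> flat_proj B i u \<bullet> eh (i - 1) < flat_proj B' i u \<bullet> eh (i - 1)" using mv
      by (auto simp: top_vertex_def)
    then have "\<not> flat_proj B i u' \<bullet> eh (i - 1) < flat_proj B' i u' \<bullet> eh (i - 1)"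
      using vertex_forms_coord(1)[OF u(3) B w(2), of "i - 1"] i by simp
    then show ?thesis using w(4) w' by auto
  qed
  moreover have "flat_proj B i u' \<in> slice y i u'"
    using in_slice[OF B] u vertex_forms_weak_conf[OF u(3) B] mv by (simp add: top_vertex_def)
  ultimately show ?thesis by (simp add: top_vertex_def)
qed

end

section \<open>Tameness passes from dimension i - 1 to dimension i\<close>

lemma same_signs_sym: "same_signs \<Phi> x y \<Longrightarrow> same_signs \<Phi> y x"
  by (simp add: same_signs_def)

context generic_arrangement
begin

lemma section_eq_iff:
  assumes "F \<in> facets A" "G \<in> facets A" "section_of p e i th F \<noteq> {}"
  shows "section_of p e i th F = section_of p e i th G \<longleftrightarrow> F = G"
proof
  assume eq: "section_of p e i th F = section_of p e i th G"
  obtain q where "q \<in> section_of p e i th F" using assms(3) by blast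
  then have "q \<in> F" "q \<in> G" using eq section_subset by blast+
  then show "F = G" using facets_disjoint assms by blast
qed simp

lemma aff_dim_pos_iff: "S \<noteq> {} \<Longrightarrow> 0 < aff_dim S \<longleftrightarrow> aff_dim S \<noteq> 0"
  for S :: "(real^'n) set"
  using aff_dim_negative_iff[of S] by linarith

lemma pnt_eq_proportional:
  assumes "0 < fst x" "0 < fst y" "pnt x = pnt y"
  shows "x \<in> Vh j \<longleftrightarrow> y \<in> Vh j" "ang x = ang y"
proof -
  have eq: "inverse (fst x) *\<^sub>R x = inverse (fst y) *\<^sub>R y"
    using assms hom_pnt[of x] hom_pnt[of y] by simp
  have "x \<in> Vh j \<longleftrightarrow> inverse (fst x) *\<^sub>R x \<in> Vh j" if "0 < fst x" for x
    using Vh_scale[of x j "inverse (fst x)"] Vh_scale[of "inverse (fst x) *\<^sub>R x" j "fst x"] that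
      by auto
  then show "x \<in> Vh j \<longleftrightarrow> y \<in> Vh j" using eq assms by metis
  have "ang x j = ang (inverse (fst x) *\<^sub>R x) j" if "0 < fst x" for x j
    using ang_scale[of "inverse (fst x)" x j] that by simp
  then show "ang x = ang y" using eq assms by (metis ext)
qed

lemma min_data_Vh:
  assumes "half_flat_dir i th u" "F \<in> facets A" "1 \<le> i" "min_data i u F k v x"
  shows "x \<notin> Vh k" "k < i \<Longrightarrow> x \<in> Vh (Suc k)"
proof -
  note dp = min_data_props[OF assms]
  show "x \<notin> Vh k"
  proof (cases "k = 0")
    case True
    then show ?thesis using dp(3) by (auto simp: Vh_0)
  next
    case False
    then show ?thesis using not_in_Vh_slice[OF dp(4)] dp(8) by simp
  qed
  assume ki: "k < i"
  then have v: "v = eh k" using assms(4) dp(2) by (simp add: min_data_def)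
  have ev: "eh k \<in> Vh (Suc k)" using ki half_flat_dirD(2)[OF assms(1)] by (intro eh_in_Vh) auto
  show "x \<in> Vh (Suc k)"
  proof (cases "k = 0")
    case True
    then show ?thesis using dp(6) ev by simp
  next
    case False
    then have "x - v \<in> Vh (Suc k)" using dp(8) Vh_mono[of k "Suc k"] by auto
    then show ?thesis using Vh_add[OF _ ev] v by fastforce
  qed
qed

text \<open>The point determines \<open>k\<close>: the vector is outside \<open>Vh k\<close>, and
  inside \<open>Vh (Suc k)\<close> when \<open>k < i\<close>. The direction and the normalised lift
  follow.\<close>

lemma min_data_same_point:
  assumes "half_flat_dir i th u" "1 \<le> i" and F: "F \<in> facets A" "min_data i u F k v x" and G:
    "G \<in> facets A" "min_data i u G k' v' x'"
    and eq: "pnt x = pnt x'"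
  shows "k = k'" "v = v'" "x = x'"
proof -
  note df = min_data_props[OF assms(1) F(1) assms(2) F(2)]
    and dg = min_data_props[OF assms(1) G(1) assms(2) G(2)]
  note vf = min_data_Vh[OF assms(1) F(1) assms(2) F(2)]
    and vg = min_data_Vh[OF assms(1) G(1) assms(2) G(2)]
  note pe = pnt_eq_proportional(1)[OF df(3) dg(3) eq]
  have "\<not> k < k'"
  proof
    assume l: "k < k'"
    then have "x \<in> Vh (Suc k)" using vf(2) dg(1) by simp
    then have "x \<in> Vh k'" using Vh_mono[of "Suc k" k'] l by auto
    then show False using pe vg(1) by blast
  qed
  moreover have "\<not> k' < k"
  proof
    assume l: "k' < k"
    then have "x' \<in> Vh (Suc k')" using vg(2) df(1) by simp
    then have "x' \<in> Vh k" using Vh_mono[of "Suc k'" k] l by auto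
    then show False using pe vf(1) by blast
  qed
  ultimately show k: "k = k'" by simp
  have "avoids (rep F) i \<longleftrightarrow> avoids (rep G) i" using df(2) dg(2) k by simp
  then show v: "v = v'" using F(2) G(2) k by (auto simp: min_data_def split: if_splits)
  show "x = x'"
  proof (cases "k = 0")
    case True
    then show ?thesis using df(6) dg(6) k by simp
  next
    case False
    then show ?thesis using pnt_inj[OF df(4) _ _ df(3) dg(3) eq] df(8) dg(8) k v by simp
  qed
qed

lemma min_data_vertex:
  assumes "half_flat_dir i th u" "F \<in> facets A" "1 \<le> i" "min_data i u F k v x" "1 \<le> k"
  shows "\<exists>B\<in>codim_fam k. x = flat_proj B k v" "k \<le> CARD('n)" "k - 1 < CARD('n)"
proof -
  note dp = min_data_props[OF assms(1-4)]
  show k: "k \<le> CARD('n)" using dp(1) half_flat_dirD(2)[OF assms(1)] by simp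
  then show "k - 1 < CARD('n)" using assms(5) by simp
  show "\<exists>B\<in>codim_fam k. x = flat_proj B k v"
    using top_vertex_vertex[of "rep F" k v x] dp(5)[OF assms(5)] assms(5) k by blast
qed

lemma tame_step:
  assumes i: "1 \<le> i" "i < CARD('n)" and t: "tame (i - 1) \<Phi>"
  shows "\<exists>\<Psi>. tame i \<Psi>"
proof -
  have iN: "i \<le> CARD('n)" using i by simp
  obtain \<Psi> where \<Psi>: "linear_forms \<Psi>"
    "\<And>x y z. same_signs \<Psi> x y \<Longrightarrow> z \<in> Vh i \<Longrightarrow> \<exists>z'\<in>Vh i. same_signs sign_forms (x + z) (y + z')"
    using Fourier_Motzkin_Vh[OF iN linear_forms_sign_forms] by metis
  have lf: "linear_forms \<Phi>" using t by (simp add: tame_def)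
  \<comment> \<open>In this order the forms control which sections are empty, where the minimum
    points lie, and the outcome of the recursion at those points.\<close>
  let ?\<Phi> = "\<Psi> \<union> (vertex_forms i \<union> step_forms i \<Phi>)"
  have "less i u F G = less i u' F G"
    if u: "u \<in> good_dirs i" "u' \<in> good_dirs i" and ss: "same_signs ?\<Phi> u u'" and FG: "F \<in> facets A"
      "G \<in> facets A" for u u' F G
  proof -
    have vf: "same_signs (vertex_forms i) u u'" using ss by (simp add: same_signs_Un)
    have half_flat_dir: "half_flat_dir i (ang u) u" "half_flat_dir i (ang u') u'"
      using half_flat_dir_ang u i by auto
    have ne1: "section_of p e i (ang w') H \<noteq> {}"
      if w: "section_of p e i (ang w) H \<noteq> {}" "H \<in> facets A" "same_signs \<Psi> w w'" "w \<in> good_dirs i"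
        "w' \<in> good_dirs i" for w w' H
    proof -
      obtain z where z: "z \<in> Vh i" "0 < fst (w + z)" "sign_eq (rep H) (w + z)"
        using w(1) section_nonempty_iff[OF w(2), of i w] section_ang[OF w(4) i(2)] by auto
      obtain z' where "z' \<in> Vh i" "same_signs sign_forms (w + z) (w' + z')"
        using \<Psi>(2)[OF w(3) z(1)] by blast
      then show ?thesis
        using z sign_forms_sign_eq sign_forms_fst section_nonempty_iff[OF w(2), of i w'] section_ang[OF w(5) i(2)] by metis
    qed
    have ne: "section_of p e i (ang u) H \<noteq> {} \<longleftrightarrow> section_of p e i (ang u') H \<noteq> {}"
      if "H \<in> facets A" for H
      using ne1[of u H u'] ne1[of u' H u] that u ss same_signs_sym by (metis same_signs_Un)
    show ?thesis
    proof (cases "section_of p e i (ang u) F = {} \<or> section_of p e i (ang u) G = {}")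
      case True
      then show ?thesis using ne[OF FG(1)] ne[OF FG(2)] polar_less_empty[of i] by metis
    next
      case False
      then have n: "section_of p e i (ang u) F \<noteq> {}" "section_of p e i (ang u) G \<noteq> {}"
        "section_of p e i (ang u') F \<noteq> {}" "section_of p e i (ang u') G \<noteq> {}" using ne FG by auto
      \<comment> \<open>An index below \<open>i\<close> gives the same minimum point over
        \<open>u\<close> and \<open>u'\<close>; otherwise the minimum point is one candidate
        evaluated at both directions.\<close>
      have tr: "\<exists>k v x v' x'. min_data i u H k v x \<and> min_data i u' H k v' x' \<and>
          (if avoids (rep H) i then k = i \<and> v = u \<and> v' = u' \<and> (\<exists>B\<in>codim_fam i. x = flat_proj B i u
            \<and> x' = flat_proj B i u')
           else v = v' \<and> x = x' \<and> x \<in> Vh i)"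
        if H: "H \<in> facets A" "section_of p e i (ang u) H \<noteq> {}" for H
      proof -
        obtain k v x where d: "min_data i u H k v x"
          using min_data_exists[OF half_flat_dir(1) H i(1)] by blast
        show ?thesis
        proof (cases "avoids (rep H) i")
          case True
          then have k: "k = i" "v = u" "top_vertex (rep H) i u x" using d
            by (auto simp: min_data_def)
          then obtain B where B: "B \<in> codim_fam i" "x = flat_proj B i u"
            using top_vertex_vertex[OF True i(1) iN] by blast
          have "top_vertex (rep H) i u' (flat_proj B i u')"
            using top_vertex_transfer[OF u vf i(1) iN True B(1)] k(3) B(2) by simp
          then have "min_data i u' H i u' (flat_proj B i u')" using True by (simp add: min_data_def)
          then show ?thesis using True d k B
            by (intro exI[of _ i] exI[of _ u] exI[of _ x] exI[of _ u'] exI[of _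
              "flat_proj B i u'"]) auto
        next
          case False
          then have "min_data i u' H k v x \<longleftrightarrow> min_data i u H k v x" unfolding min_data_def
            by (simp only: if_False)
          then have "min_data i u' H k v x" using d by blast
          moreover have "x \<in> Vh i"
            using min_data_Vh(2)[OF half_flat_dir(1) H(1) i(1) d] min_data_props(2)[OF half_flat_dir(1) H(1) i(1) d] False Vh_mono[of "Suc k" i] by auto
          ultimately show ?thesis using False d
            by (intro exI[of _ k] exI[of _ v] exI[of _ x] exI[of _ v] exI[of _ x]) simp
        qed
      qed
      obtain k v x v' x' where dF: "min_data i u F k v x" "min_data i u' F k v' x'" and
        rF: "if avoids (rep F) i then k = i \<and> v = u \<and> v' = u' \<and> (\<exists>B\<in>codim_fam i. x
          = flat_proj B i u \<and> x' = flat_proj B i u')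
           else v = v' \<and> x = x' \<and> x \<in> Vh i" using tr[OF FG(1) n(1)] by blast
      obtain l w y w' y' where dG: "min_data i u G l w y" "min_data i u' G l w' y'" and
        rG: "if avoids (rep G) i then l = i \<and> w = u \<and> w' = u' \<and> (\<exists>B\<in>codim_fam i. y
          = flat_proj B i u \<and> y' = flat_proj B i u')
           else w = w' \<and> y = y' \<and> y \<in> Vh i" using tr[OF FG(2) n(2)] by blast
      note pF = min_data_props[OF half_flat_dir(1) FG(1) i(1) dF(1)]
        and pF' = min_data_props[OF half_flat_dir(2) FG(1) i(1) dF(2)]
      note pG = min_data_props[OF half_flat_dir(1) FG(2) i(1) dG(1)]
        and pG' = min_data_props[OF half_flat_dir(2) FG(2) i(1) dG(2)]
      have off: "flat_proj B i u \<notin> Vh i" "flat_proj B i u' \<notin> Vh i" if "B \<in> codim_fam i" for B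
        using not_in_Vh_slice[OF u(1) flat_proj_props(2)[OF that iN]] not_in_Vh_slice[OF u(2) flat_proj_props(2)[OF that iN]] .
      \<comment> \<open>If exactly one index is below \<open>i\<close>, \<open>antilex_mixed\<close>
        forces the order; if none is, the order is read off from signs of coordinate
        differences.\<close>
      have PL: "(pnt x = pnt y \<longleftrightarrow> pnt x' = pnt y') \<and>
          (antilex_less CARD('n) (ang x) (ang y) \<longleftrightarrow> antilex_less CARD('n) (ang x') (ang y'))"
      proof (cases "avoids (rep F) i"; cases "avoids (rep G) i")
        assume "\<not> avoids (rep F) i" "\<not> avoids (rep G) i"
        then show ?thesis using rF rG by simp
      next
        assume a: "\<not> avoids (rep F) i" "avoids (rep G) i"
        then have "x \<in> Vh i" "y \<notin> Vh i" "x' \<in> Vh i" "y' \<notin> Vh i" using rF rG off u by auto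
        then show ?thesis
          using antilex_mixed[OF _ _ i(1) iN pF(3) pG(3)] antilex_mixed[OF _ _ i(1) iN pF'(3) pG'(3)] by simp
      next
        assume a: "avoids (rep F) i" "\<not> avoids (rep G) i"
        then have "x \<notin> Vh i" "y \<in> Vh i" "x' \<notin> Vh i" "y' \<in> Vh i" using rF rG off u by auto
        then show ?thesis
          using antilex_mixed[OF _ _ i(1) iN pG(3) pF(3)] antilex_mixed[OF _ _ i(1) iN pG'(3) pF'(3)] by metis
      next
        assume a: "avoids (rep F) i" "avoids (rep G) i"
        obtain B where B: "B \<in> codim_fam i" "x = flat_proj B i u" "x' = flat_proj B i u'"
          using a(1) rF by auto
        obtain C where C: "C \<in> codim_fam i" "y = flat_proj C i u" "y' = flat_proj C i u'"
          using a(2) rG by auto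
        have D: "x - u \<in> Vh i" "y - u \<in> Vh i" "x' - u' \<in> Vh i" "y' - u' \<in> Vh i"
          using flat_proj_props(2)[OF _ iN] B C by auto
        have c1: "y \<bullet> eh j < x \<bullet> eh j \<longleftrightarrow> y' \<bullet> eh j < x' \<bullet> eh j" and c2:
          "x \<bullet> eh j = y \<bullet> eh j \<longleftrightarrow> x' \<bullet> eh j = y' \<bullet> eh j"
          if "j \<le> CARD('n)" for j
          using vertex_forms_coord(1)[OF vf C(1) B(1) that] vertex_forms_coord(2)[OF vf B(1) C(1) that] B C by auto
        have "pnt x = pnt y \<longleftrightarrow> x = y" "pnt x' = pnt y' \<longleftrightarrow> x' = y'"
          using pnt_inj[OF u(1) D(1,2) pF(3) pG(3)] pnt_inj[OF u(2) D(3,4) pF'(3) pG'(3)] by auto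
        moreover have "x = y \<longleftrightarrow> x' = y'"
        proof
          assume "x = y"
          then show "x' = y'" by (intro eh_eqI) (simp add: c2[symmetric])
        next
          assume "x' = y'"
          then show "x = y" by (intro eh_eqI) (simp add: c2)
        qed
        moreover have "x - y \<in> Vh i" "x' - y' \<in> Vh i"
          using Vh_diff[OF D(1,2)] Vh_diff[OF D(3,4)] by auto
        note al = antilex_ang_iff[OF iN this(1) _ pF(3) pG(3)] antilex_ang_iff[OF iN this(2) _ pF'(3) pG'(3)]
        have "antilex_less CARD('n) (ang x) (ang y) \<longleftrightarrow> antilex_less CARD('n) (ang x') (ang y')"
        proof -
          have nV: "x \<notin> Vh i" "x' \<notin> Vh i" using off B u by auto
          have lt: "j \<le> CARD('n)" if "j < i" for j using that iN by simp
          show ?thesis unfolding al(1)[OF nV(1)] al(2)[OF nV(2)]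
            by (rule ex_cong1, rule conj_cong[OF refl], rule conj_cong) (auto simp: c1 c2 lt)
        qed
        ultimately show ?thesis by blast
      qed
      \<comment> \<open>If the index is below \<open>i\<close>, both sides are the same recursion;
        otherwise the limit directions have equal signs by \<open>step_forms\<close>.\<close>
      have R: "(\<forall>\<^sub>F \<epsilon> in at_right 0. polar_less p e (k - 1) ((ang x)(k - 1 := ang x (k - 1) + \<epsilon>)) F G) \<longleftrightarrow>
          (\<forall>\<^sub>F \<epsilon> in at_right 0. polar_less p e (k - 1) ((ang x')(k - 1 := ang x' (k - 1) + \<epsilon>)) F G)"
      proof (cases "avoids (rep F) i")
        case False
        then show ?thesis using rF by simp
      next
        case True
        then obtain B where B: "B \<in> codim_fam i" "x = flat_proj B i u" "x' = flat_proj B i u'"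
          "k = i" using rF by auto
        have "same_signs \<Phi> (u + (x \<bullet> eh (i - 1)) *\<^sub>R eh (i - 1)) (u' + (x' \<bullet> eh (i - 1)) *\<^sub>R eh (i - 1))"
          unfolding same_signs_def
        proof
          fix \<phi> assume \<phi>: "\<phi> \<in> \<Phi>"
          have m: "(\<lambda>u. \<phi> (u + (flat_proj B i u \<bullet> eh (i - 1)) *\<^sub>R eh (i - 1))) \<in> step_forms i \<Phi>"
            unfolding step_forms_def by (rule image_eqI[of _ _ "(\<phi>, B)"]) (simp_all add: \<phi> B)
          have "same_signs (step_forms i \<Phi>) u u'" using ss by (simp add: same_signs_Un)
          from bspec[OF this[unfolded same_signs_def] m]
          show "sgn (\<phi> (u + (x \<bullet> eh (i - 1)) *\<^sub>R eh (i - 1)))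
            = sgn (\<phi> (u' + (x' \<bullet> eh (i - 1)) *\<^sub>R eh (i - 1)))"
            unfolding B(2,3) .
        qed
        then obtain b where b: "\<forall>\<^sub>F r in at_left (x \<bullet> eh (i - 1)). less (i - 1) (u + r *\<^sub>R eh (i - 1)) F G = b"
          "\<forall>\<^sub>F r in at_left (x' \<bullet> eh (i - 1)). less (i - 1) (u' + r *\<^sub>R eh (i - 1)) F G = b"
          using eventually_constant[OF t FG good_dirs_step[OF u(1) i(1) iN B(1), folded B(2)] good_dirs_step[OF u(2) i(1) iN B(1), folded B(3)]]
          by blast
        show ?thesis
          unfolding B(4) recursion_constant[OF u(1) i(1) iN B(1,2) b(1)] recursion_constant[OF u(2) i(1) iN B(1,3) b(2)] ..
      qed
      have dim: "aff_dim (section_of p e i (ang u) H) = 0 \<longleftrightarrow> aff_dim (section_of p e i (ang u') H)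
        = 0"
        if "H \<in> facets A" "section_of p e i (ang u) H \<noteq> {}" "section_of p e i (ang u') H \<noteq> {}" for H
        using section_singleton_iff[OF half_flat_dir(1) that(1,2) i] section_singleton_iff[OF half_flat_dir(2) that(1,3) i] by simp
      show ?thesis
        unfolding polar_less_unfold[OF half_flat_dir(1) FG(1) n(1) i(1) dF(1) FG(2) n(2) dG(1)]
          polar_less_unfold[OF half_flat_dir(2) FG(1) n(3) i(1) dF(2) FG(2) n(4) dG(2)]
          aff_dim_pos_iff[OF n(1)] aff_dim_pos_iff[OF n(2)] aff_dim_pos_iff[OF n(3)] aff_dim_pos_iff[OF n(4)]
          section_eq_iff[OF FG n(1)] section_eq_iff[OF FG n(3)] dim[OF FG(1) n(1,3)] dim[OF FG(2) n(2,4)] R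
        using PL by blast
    qed
  qed
  then have "tame i ?\<Phi>"
    unfolding tame_def
    using \<Psi>(1) linear_forms_vertex_forms[OF iN] linear_forms_step_forms[OF iN lf]
      by (simp add: linear_forms_Un)
  then show ?thesis by blast
qed

lemma tame_exists: "i < CARD('n) \<Longrightarrow> \<exists>\<Phi>. tame i \<Phi>"
proof (induction i)
  case 0
  then show ?case using tame_0 by blast
next
  case (Suc i)
  then show ?case using tame_step[of "Suc i"] by auto
qed

text \<open>Point sections with the same minimum point coincide; transitivity uses this for
  comparisons that start with a point.\<close>

lemma section_point:
  assumes "half_flat_dir i th u" "F \<in> facets A" "section_of p e i th F \<noteq> {}" "1 \<le> i"
    "min_data i u F k v x"
    and "aff_dim (section_of p e i th F) = 0"
  shows "section_of p e i th F = {pnt x}"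
proof -
  obtain a where a: "section_of p e i th F = {a}" using assms(6) aff_dim_eq_0 by blast
  let ?m = "min_index p e i th F"
  have K: "closure (section_of p e i th F) = {a}" by (simp add: a)
  have pol: "polar p e P l \<le> polar p e Q l" if "P \<in> {a}" "Q \<in> {a}" for P Q l using that by simp
  have "flag p e CARD('n) \<inter> closure (section_of p e i th F) \<noteq> {}" by (simp add: a flag_top)
  then have "flag p e ?m \<inter> closure (section_of p e i th F) \<noteq> {}"
    unfolding min_index_def by (rule LeastI)
  then have am: "a \<in> flag p e ?m" using K by auto
  have ext: "P extreme_point_of {a} \<longleftrightarrow> P = a" for P by (auto simp: extreme_point_of_def)
  have "min_point p e i th F = a"
  proof (cases "?m = 0")
    case True
    then show ?thesis using am assms(4) by (simp add: min_point_def flag_0 Let_def)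
  next
    case False
    then show ?thesis using am assms(4) unfolding min_point_def Let_def K
      by (auto simp: ext intro!: the_equality)
  qed
  then show ?thesis using min_data_min(1)[OF assms(1-5)] a by simp
qed

text \<open>By uniqueness \<open>z\<close> is strictly below the maximum \<open>x\<close>. The
  segment from \<open>z\<close> towards \<open>x\<close>, without \<open>x\<close>, stays in the
  relatively open facet and crosses every level just below that of \<open>x\<close>.\<close>

lemma eventually_section_nonempty:
  assumes v: "v \<in> good_dirs k" and k: "1 \<le> k" "k \<le> CARD('n)" and F: "F \<in> facets A"
    "avoids (rep F) k"
    and x: "top_vertex (rep F) k v x" and z: "z \<in> slice (rep F) k v" "sign_eq (rep F) z" "z \<noteq> x"
  shows "\<forall>\<^sub>F r in at_left (x \<bullet> eh (k - 1)). F \<inter> cone (k - 1) (v + r *\<^sub>R eh (k - 1)) \<noteq> {}"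
proof -
  let ?c = "x \<bullet> eh (k - 1)" and ?d = "z \<bullet> eh (k - 1)"
  have kk: "Suc (k - 1) = k" "k - 1 \<le> CARD('n)" using k by auto
  have xc: "x \<in> slice (rep F) k v" using x by (simp add: top_vertex_def)
  have "?d \<le> ?c" using x z(1) by (simp add: top_vertex_def)
  moreover have "?d \<noteq> ?c"
  proof
    assume "?d = ?c"
    then have "top_vertex (rep F) k v z" using x z(1) by (simp add: top_vertex_def)
    then show False using top_vertex_unique[OF F(2) k x] z(3) by blast
  qed
  ultimately have dc: "?d < ?c" by simp
  have "\<forall>\<^sub>F r in at_left ?c. ?d < r \<and> r < ?c"
    using eventually_at_left[OF dc] dc by blast
  then show ?thesis
  proof eventually_elim
    case (elim r)
    \<comment> \<open>The parameter at which coordinate \<open>k - 1\<close> on the segment equals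
      \<open>r\<close>.\<close>
    define t where "t = (?c - r) / (?c - ?d)"
    have t: "0 < t" "t < 1" using elim dc by (auto simp: t_def field_simps)
    let ?w = "(1 - t) *\<^sub>R x + t *\<^sub>R z"
    have "sign_eq (rep F) ?w" using xc z(2) t by (intro sign_eq_add) (auto simp: slice_def)
    moreover have "0 < fst ?w" using xc z(1) t by (simp add: slice_def add_pos_pos)
    moreover have "?w - (v + r *\<^sub>R eh (k - 1)) \<in> Vh (k - 1)"
    proof (rule Vh_SucD)
      have A: "(1 - t) *\<^sub>R (x - v) + t *\<^sub>R (z - v) - r *\<^sub>R eh (k - 1) \<in> Vh k"
        using Vh_diff[OF Vh_add[OF Vh_scale[of "x - v" k "1 - t"] Vh_scale[of "z - v" k t]]
            Vh_scale[OF eh_in_Vh[of "k - 1" k], of r]] xc z(1) k by (simp add: slice_def)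
      have E: "(1 - t) *\<^sub>R (x - v) + t *\<^sub>R (z - v) - r *\<^sub>R eh (k - 1) = ?w - (v + r *\<^sub>R eh (k - 1))"
        by (simp add: algebra_simps)
      show "?w - (v + r *\<^sub>R eh (k - 1)) \<in> Vh (Suc (k - 1))" using A unfolding E kk .
      have "v \<bullet> eh (k - 1) = 0" using v k by (intro Dh_inner[of v k]) (auto simp: good_dirs_def)
      moreover have "t * (?c - ?d) = ?c - r" using dc by (simp add: t_def)
      then have "(1 - t) * ?c + t * ?d = r" by (simp add: algebra_simps)
      ultimately show "(?w - (v + r *\<^sub>R eh (k - 1))) \<bullet> eh (k - 1) = 0"
        using kk by (simp add: inner_diff_left inner_add_left eh_orthonormal)
    qed
    ultimately show ?case
      unfolding section_nonempty_iff[OF F(1)]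
      by (intro bexI[of _ "?w - (v + r *\<^sub>R eh (k - 1))"]) auto
  qed
qed

text \<open>If the minimum point lies on a smaller flag and not in the facet itself, then transversality
  of the flag to the hyperplanes through that point gives points of the facet on the flag.\<close>

lemma facet_meets_flag_direction:
  assumes F: "F \<in> facets A" and x: "weak_conf (rep F) x" "0 < fst x" "\<not> sign_eq (rep F) x"
    and k: "k < CARD('n)" "x \<in> Vh (Suc k)" "x - v \<in> Vh k"
  shows "\<exists>z\<in>slice (rep F) k v. sign_eq (rep F) z"
proof -
  \<comment> \<open>The lifted flats of codimension k + 1 meet \<open>Vh (Suc k)\<close> only in 0,
    so none of them contains \<open>x\<close>.\<close>
  have nB: "\<not> B \<subseteq> active x" if "B \<in> codim_fam (Suc k)" for B
  proof
    assume "B \<subseteq> active x"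
    then have "x \<in> Lh B" by (rule in_Lh_active)
    then have "x = 0" using Lh_Int_Vh[OF that _ _ k(2)] k(1) by simp
    then show False using x(2) by simp
  qed
  obtain B where B: "B \<in> codim_fam k" "active x \<subseteq> B"
    using active_dichotomy[OF x(2), of "Suc k"] nB k(1) by auto
  have kN: "k \<le> CARD('n)" using k by simp
  let ?y = "rep F"
  \<comment> \<open>Subtracting the projection puts the vector into \<open>Vh k\<close> without
    changing its values on the hyperplanes through \<open>x\<close>; a small move along it gives
    these the signs of \<open>F\<close>.\<close>
  let ?w = "?y - flat_proj B k ?y"
  have wV: "?w \<in> Vh k"
    using Vh_scale[OF flat_proj_props(2)[OF B(1) kN, of ?y], of "-1"] by simp
  have wact: "hform H \<bullet> ?w = hform H \<bullet> ?y" if "H \<in> active x" for H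
  proof -
    have "flat_proj B k ?y \<in> Lh B" by (rule flat_proj_props(1)[OF B(1) kN])
    then have "hform H \<bullet> flat_proj B k ?y = 0" using B(2) that by (auto simp: Lh_def)
    then show ?thesis by (simp add: inner_diff_right)
  qed
  \<comment> \<open>\<open>eh 0\<close> is included so that the first coordinate stays
    positive.\<close>
  let ?J = "insert (eh 0) (hform ` (A - active x))"
  have "0 < \<bar>h \<bullet> x\<bar>" if "h \<in> ?J" for h
    using that x(2) eh_0[of x] by (auto simp: active_def inner_commute)
  then obtain t where t: "0 < t" "\<forall>h\<in>?J. t * \<bar>h \<bullet> ?w\<bar> < \<bar>h \<bullet> x\<bar>"
    using small_scaling[of ?J "\<lambda>h. \<bar>h \<bullet> x\<bar>" "\<lambda>h. \<bar>h \<bullet> ?w\<bar>"] finite_A by auto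
  let ?z = "x + t *\<^sub>R ?w"
  have pert: "sgn (h \<bullet> ?z) = sgn (h \<bullet> x)" if "h \<in> ?J" for h
  proof -
    have "\<bar>t * (h \<bullet> ?w)\<bar> < \<bar>h \<bullet> x\<bar>" using bspec[OF t(2) that] t(1) by (simp add: abs_mult)
    moreover have "h \<bullet> ?z = h \<bullet> x + t * (h \<bullet> ?w)" by (simp only: inner_add_right inner_scaleR_right)
    ultimately show ?thesis by (auto simp: sgn_if abs_if split: if_splits)
  qed
  have "sgn (hform H \<bullet> ?z) = sgn (hform H \<bullet> ?y)" if H: "H \<in> A" for H
  proof (cases "H \<in> active x")
    case True
    then have "hform H \<bullet> x = 0" by (simp add: active_def)
    then have "hform H \<bullet> ?z = t * (hform H \<bullet> ?y)" using wact[OF True]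
      by (simp add: inner_add_right)
    then show ?thesis using t(1) by (simp add: sgn_mult)
  next
    case False
    then have "sgn (hform H \<bullet> x) = sgn (hform H \<bullet> ?y)" using x(1) H
      by (auto simp: weak_conf_def active_def)
    then show ?thesis using pert[of "hform H"] False H by auto
  qed
  then have e: "sign_eq ?y ?z" by (simp add: sign_eq_def)
  have eh0: "eh 0 \<bullet> y = fst y" for y using eh_0[of y] by (simp only: inner_commute)
  have "sgn (fst ?z) = sgn (fst x)" using pert[of "eh 0"] unfolding eh0 by blast
  then have "0 < fst ?z" using x(2) by (simp add: sgn_if split: if_splits)
  moreover have "?z - v \<in> Vh k" using Vh_add[OF k(3) Vh_scale[OF wV, of t]]
    by (simp add: algebra_simps)
  ultimately have "?z \<in> slice ?y k v" using e sign_eq_imp_weak_conf by (simp add: slice_def)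
  then show ?thesis using e by blast
qed

lemma eventually_half_flat_dir:
  assumes v: "v \<in> good_dirs k" and k: "1 \<le> k" "k \<le> CARD('n)" and B: "B \<in> codim_fam k" and x:
    "x = flat_proj B k v"
  shows "\<forall>\<^sub>F \<epsilon> in at_right 0. \<exists>w. half_flat_dir (k - 1) ((ang x)(k - 1 := ang x (k - 1) + \<epsilon>)) w"
proof -
  have xV: "x - v \<in> Vh k" "0 < fst x"
    using flat_proj_props(2)[OF B k(2)] adm_cone_pos[OF k(2) _ B, of v] v x
      by (auto simp: good_dirs_def)
  note g = good_dirs_step[OF v k B, folded x]
  have k1: "k - 1 < CARD('n)" using k by simp
  show ?thesis
    using angle_path[OF v k xV g g]
  proof (rule eventually_mono)
    fix \<epsilon> assume "\<exists>r. v + r *\<^sub>R eh (k - 1) \<in> good_dirs (k - 1) \<and>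
      half_flat p e (k - 1) ((ang x)(k - 1 := ang x (k - 1) + \<epsilon>))
        = half_flat p e (k - 1) (ang (v + r *\<^sub>R eh (k - 1)))"
    then obtain r where "half_flat_dir (k - 1) (ang (v + r *\<^sub>R eh (k - 1))) (v + r *\<^sub>R eh (k - 1))"
      "half_flat p e (k - 1) ((ang x)(k - 1 := ang x (k - 1) + \<epsilon>))
        = half_flat p e (k - 1) (ang (v + r *\<^sub>R eh (k - 1)))"
      using half_flat_dir_ang k1 by blast
    then have "half_flat_dir (k - 1) ((ang x)(k - 1 := ang x (k - 1) + \<epsilon>)) (v + r *\<^sub>R eh (k - 1))"
      by (simp add: half_flat_dir_def)
    then show "\<exists>w. half_flat_dir (k - 1) ((ang x)(k - 1 := ang x (k - 1) + \<epsilon>)) w" by blast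
  qed
qed

section \<open>Totality and transitivity\<close>

text \<open>A chamber has full dimension, so the origin lies on no hyperplane, and weak agreement of
  signs there is agreement. Hence only one facet has index 0.\<close>

lemma chamber_origin:
  assumes "F \<in> facets A" "p \<in> closure F"
  shows "p \<in> F"
proof -
  obtain C where C: "chamber A C" "p \<in> C" using gen by (auto simp: generic_polar_def)
  have nz: "hform H \<bullet> eh 0 \<noteq> 0" if H: "H \<in> A" for H
  proof
    assume z: "hform H \<bullet> eh 0 = 0"
    have Cf: "C \<in> facets A" using C by (simp add: chamber_def)
    have "C \<subseteq> H"
    proof
      fix r assume "r \<in> C"
      then have "sgn (hform H \<bullet> hom r) = sgn (hform H \<bullet> hom p)" using facet_eq[OF Cf C(2)] H
        by (auto simp: sign_eq_def)
      then show "r \<in> H" using mem_A_iff[OF H] z by (simp add: hom_p sgn_zero_iff)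
    qed
    obtain a b where ab: "a \<noteq> 0" "H = {x. a \<bullet> x = b}" using arr H unfolding arrangement_def by blast
    have "aff_dim C \<le> aff_dim H" using \<open>C \<subseteq> H\<close> by (rule aff_dim_subset)
    also have "\<dots> = int CARD('n) - 1" using aff_dim_hyperplane[OF ab(1), of b] ab(2) by simp
    finally show False using C(1) by (simp add: chamber_def)
  qed
  have "weak_conf (rep F) (eh 0)" using assms mem_closure_facet_iff hom_p by metis
  then have "sign_eq (rep F) (eh 0)" using nz by (simp add: weak_conf_def sign_eq_def)
  then show ?thesis using mem_facet_iff[OF assms(1)] hom_p by metis
qed

text \<open>Transitivity has to include empty sections, since at an index below the dimension the
  smaller sections may be empty. Totality asks for one nonempty section, because two empty ones are
  incomparable.\<close>

lemma polar_less_total_and_trans: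
  assumes "half_flat_dir i th u"
  shows "(\<forall>F\<in>facets A. \<forall>G\<in>facets A. \<forall>H\<in>facets A.
      polar_less p e i th F G \<longrightarrow> polar_less p e i th G H \<longrightarrow> polar_less p e i th F H) \<and>
    (\<forall>F\<in>facets A. \<forall>G\<in>facets A. F \<noteq> G \<longrightarrow> section_of p e i th F \<noteq> {} \<or> section_of p e i th G \<noteq> {} \<longrightarrow>
      polar_less p e i th F G \<or> polar_less p e i th G F)"
  using assms
proof (induction i arbitrary: th u rule: less_induct)
  case (less i)
  note half_flat_dir = less.prems
  show ?case
  proof (cases "i = 0")
    case True
    note l0 = polar_less_0_iff[OF half_flat_dir[unfolded True]]
      and s0 = half_flat_0_section[OF half_flat_dir[unfolded True]]
    show ?thesis
    proof (intro conjI ballI impI)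
      fix F G H assume "F \<in> facets A" "G \<in> facets A" "H \<in> facets A" "polar_less p e i th F G"
        "polar_less p e i th G H"
      then show "polar_less p e i th F H" using l0 True by simp
    next
      fix F G assume FG: "F \<in> facets A" "G \<in> facets A" "F \<noteq> G" and ne:
        "section_of p e i th F \<noteq> {} \<or> section_of p e i th G \<noteq> {}"
      have "pnt u \<in> F \<or> pnt u \<in> G" using ne s0 True by auto
      moreover have "\<not> (pnt u \<in> F \<and> pnt u \<in> G)" using facets_disjoint FG by blast
      ultimately show "polar_less p e i th F G \<or> polar_less p e i th G F" using l0 FG True by auto
    qed
  next
    case False
    then have i: "1 \<le> i" by simp
    have iN: "i \<le> CARD('n)" using half_flat_dirD(2)[OF half_flat_dir] .
    let ?S = "section_of p e i th"
    let ?R = "\<lambda>k x F G. \<forall>\<^sub>F \<epsilon> in at_right 0. polar_less p e (k - 1) ((ang x)(k - 1 := ang x (k - 1) + \<epsilon>)) F G"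
    show ?thesis
    proof (intro conjI ballI impI)
      fix F G H assume FGH: "F \<in> facets A" "G \<in> facets A" "H \<in> facets A"
        and fg: "polar_less p e i th F G" and gh: "polar_less p e i th G H"
      have nG: "?S G \<noteq> {}" and nH: "?S H \<noteq> {}" using polar_less_empty(1) fg gh by blast+
      show "polar_less p e i th F H"
      proof (cases "?S F = {}")
        case True
        then show ?thesis using polar_less_empty(2)[OF nH] by blast
      next
        case nF: False
        obtain k v x where dF: "min_data i u F k v x"
          using min_data_exists[OF half_flat_dir FGH(1) nF i] by blast
        obtain k' v' y where dG: "min_data i u G k' v' y"
          using min_data_exists[OF half_flat_dir FGH(2) nG i] by blast
        obtain k'' v'' z where dH: "min_data i u H k'' v'' z"
          using min_data_exists[OF half_flat_dir FGH(3) nH i] by blast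
        note pF = min_data_props[OF half_flat_dir FGH(1) i dF]
          and pG = min_data_props[OF half_flat_dir FGH(2) i dG]
            and pH = min_data_props[OF half_flat_dir FGH(3) i dH]
        note UFG = polar_less_unfold[OF half_flat_dir FGH(1) nF i dF FGH(2) nG dG]
        note UGH = polar_less_unfold[OF half_flat_dir FGH(2) nG i dG FGH(3) nH dH]
        note UFH = polar_less_unfold[OF half_flat_dir FGH(1) nF i dF FGH(3) nH dH]
        let ?al = "antilex_less CARD('n)"
        have al_ne: "pnt a \<noteq> pnt b" if "?al (ang a) (ang b)" "0 < fst a" "0 < fst b" for a b
          using pnt_eq_proportional(2)[OF that(2,3)] antilex_less_irrefl that(1) by metis
        show ?thesis
        proof (cases "pnt x = pnt y")
          case xy: False
          then have 1: "?al (ang x) (ang y)" using fg UFG by simp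
          have "?al (ang x) (ang z)"
          proof (cases "pnt y = pnt z")
            case True
            then show ?thesis using 1 pnt_eq_proportional(2)[OF pG(3) pH(3)] by simp
          next
            case False
            then have "?al (ang y) (ang z)" using gh UGH by simp
            then show ?thesis using antilex_less_trans[OF 1] by blast
          qed
          then show ?thesis using al_ne[OF _ pF(3) pH(3)] UFH by blast
        next
          case xy: True
          show ?thesis
          proof (cases "pnt y = pnt z")
            case yz: False
            then have "?al (ang y) (ang z)" using gh UGH by simp
            then have "?al (ang x) (ang z)" using pnt_eq_proportional(2)[OF pF(3) pG(3) xy] by simp
            then show ?thesis using al_ne[OF _ pF(3) pH(3)] UFH by blast
          next
            case yz: True
            note sFG = min_data_same_point[OF half_flat_dir i FGH(1) dF FGH(2) dG xy]
            have gh': "aff_dim (?S G) = 0 \<and> ?S G \<noteq> ?S H \<or>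
                0 < aff_dim (?S G) \<and> 0 < aff_dim (?S H) \<and> 0 < k \<and> ?R k x G H"
              using gh yz UGH sFG by simp
            have fg': "aff_dim (?S F) = 0 \<and> ?S F \<noteq> ?S G \<or>
                0 < aff_dim (?S F) \<and> 0 < aff_dim (?S G) \<and> 0 < k \<and> ?R k x F G"
              using fg xy UFG by simp
            show ?thesis
            proof (cases "aff_dim (?S F) = 0")
              case True
              \<comment> \<open>Otherwise the section of \<open>G\<close> would be a point too, at
                the same minimum point, and hence equal to that of \<open>F\<close>.\<close>
              have "?S F \<noteq> ?S H"
              proof
                assume eq: "?S F = ?S H"
                then have "aff_dim (?S G) = 0" using gh' True by simp
                then have "?S G = {pnt y}" using section_point[OF half_flat_dir FGH(2) nG i dG]
                  by simp
                moreover have "?S F = {pnt x}"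
                  using section_point[OF half_flat_dir FGH(1) nF i dF True] .
                ultimately show False using xy fg' True by simp
              qed
              then show ?thesis using True xy yz UFH by simp
            next
              case dF0: False
              then have d: "0 < aff_dim (?S F)" "0 < aff_dim (?S G)" "0 < aff_dim (?S H)" "0 < k"
                and R: "?R k x F G" "?R k x G H" using fg' gh' by auto
              have k1: "1 \<le> k" using d by simp
              obtain B where B: "B \<in> codim_fam k" "x = flat_proj B k v"
                using min_data_vertex(1)[OF half_flat_dir FGH(1) i dF k1] by blast
              have kN: "k \<le> CARD('n)" using min_data_vertex(2)[OF half_flat_dir FGH(1) i dF k1] .
              have lt: "k - 1 < i" using pF(1) k1 by simp
              have "?R k x F H"
                using R eventually_half_flat_dir[OF pF(4) k1 kN B]
              proof eventually_elim
                case (elim \<epsilon>)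
                then obtain w where w:
                  "half_flat_dir (k - 1) ((ang x)(k - 1 := ang x (k - 1) + \<epsilon>)) w" by blast
                show ?case using conjunct1[OF less.IH[OF lt w]] elim FGH by blast
              qed
              then show ?thesis using d xy yz UFH by simp
            qed
          qed
        qed
      qed
    next
      fix F G assume FG: "F \<in> facets A" "G \<in> facets A" "F \<noteq> G" and ne: "?S F \<noteq> {} \<or> ?S G \<noteq> {}"
      show "polar_less p e i th F G \<or> polar_less p e i th G F"
      proof (cases "?S F = {} \<or> ?S G = {}")
        case True
        then show ?thesis using ne polar_less_empty(2) by blast
      next
        case False
        then have nF: "?S F \<noteq> {}" and nG: "?S G \<noteq> {}" by auto
        obtain k v x where dF: "min_data i u F k v x"
          using min_data_exists[OF half_flat_dir FG(1) nF i] by blast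
        obtain k' v' y where dG: "min_data i u G k' v' y"
          using min_data_exists[OF half_flat_dir FG(2) nG i] by blast
        note pF = min_data_props[OF half_flat_dir FG(1) i dF]
          and pG = min_data_props[OF half_flat_dir FG(2) i dG]
        note UFG = polar_less_unfold[OF half_flat_dir FG(1) nF i dF FG(2) nG dG]
        note UGF = polar_less_unfold[OF half_flat_dir FG(2) nG i dG FG(1) nF dF]
        have Sne: "?S F \<noteq> ?S G" using section_eq_iff[OF FG(1,2) nF] FG(3) by simp
        show ?thesis
        proof (cases "pnt x = pnt y")
          case xy: False
          have "\<exists>j<CARD('n). ang x j \<noteq> ang y j"
          proof (rule ccontr)
            assume "\<not> ?thesis"
            then have "ang (hom (pnt x)) j = ang (hom (pnt y)) j" if "j < CARD('n)" for j
              using that pF(3) pG(3) ang_scale by (simp add: hom_pnt)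
            moreover have "hom (pnt a) \<in> lpos" if "0 < fst a" "a \<in> lpos" for a
              using that by (auto simp: hom_pnt lpos_def Vh_scale)
            ultimately show False using ang_inj[of "pnt x" "pnt y"] xy pF(3,9) pG(3,9) by blast
          qed
          then show ?thesis using antilex_less_total UFG UGF xy by metis
        next
          case xy: True
          show ?thesis
          proof (cases "aff_dim (?S F) = 0 \<or> aff_dim (?S G) = 0")
            case True
            then show ?thesis using UFG UGF xy Sne by auto
          next
            case False
            then have d: "0 < aff_dim (?S F)" "0 < aff_dim (?S G)"
              using aff_dim_pos_iff[OF nF] aff_dim_pos_iff[OF nG] by auto
            note same = min_data_same_point[OF half_flat_dir i FG(1) dF FG(2) dG xy]
            have k0: "k \<noteq> 0"
            proof
              assume "k = 0"
              then have "x = eh 0" "y = eh 0" using pF(6) pG(6) same by auto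
              then have "p \<in> closure F" "p \<in> closure G"
                using pF(7) pG(7) mem_closure_facet_iff FG hom_p by metis+
              then show False using chamber_origin facets_disjoint FG by metis
            qed
            then have k1: "1 \<le> k" by simp
            obtain B where B: "B \<in> codim_fam k" "x = flat_proj B k v"
              using min_data_vertex(1)[OF half_flat_dir FG(1) i dF k1] by blast
            have kN: "k \<le> CARD('n)" and kN1: "k - 1 < CARD('n)"
              using min_data_vertex(2,3)[OF half_flat_dir FG(1) i dF k1] .
            have lt: "k - 1 < i" using pF(1) k1 by simp
            note g = good_dirs_step[OF pF(4) k1 kN B(1), folded B(2)]
            obtain \<Phi> where t: "tame (k - 1) \<Phi>" using tame_exists[OF kN1] by blast
            have ss: "same_signs \<Phi> z z" for z by (simp add: same_signs_def)
            let ?c = "x \<bullet> eh (k - 1)" and ?w = "\<lambda>r. v + r *\<^sub>R eh (k - 1)"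
            obtain b where b: "\<forall>\<^sub>F r in at_left ?c. less (k - 1) (?w r) F G = b"
              using eventually_constant[OF t FG(1,2) g g ss] by blast
            obtain b' where b': "\<forall>\<^sub>F r in at_left ?c. less (k - 1) (?w r) G F = b'"
              using eventually_constant[OF t FG(2,1) g g ss] by blast
            \<comment> \<open>For \<open>k = i\<close> positive dimension supplies a second point of
              the section. For \<open>k < i\<close> the section by V_k may be just the minimum
              point; this is excluded if the facet does not contain that point.\<close>
            have nonempty: "\<forall>\<^sub>F r in at_left ?c. H \<inter> cone (k - 1) (?w r) \<noteq> {}"
              if H: "H \<in> facets A" "?S H \<noteq> {}" "min_data i u H k v x" "0 < aff_dim (?S H)"
                "k = i \<or> \<not> sign_eq (rep H) x" for H
            proof -
              note pH = min_data_props[OF half_flat_dir H(1) i H(3)]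
              have av: "avoids (rep H) k" and mv: "top_vertex (rep H) k v x" using pH(5)[OF k1]
                by auto
              have "\<exists>z\<in>slice (rep H) k v. sign_eq (rep H) z \<and> z \<noteq> x"
              proof (cases "k = i")
                case True
                then have avi: "avoids (rep H) i" and vu: "v = u" using pH(2) H(3)
                  by (auto simp: min_data_def)
                have "\<not> (\<exists>a. ?S H = {a})" using H(4) aff_dim_eq_0[of "?S H"] by auto
                then obtain q where q: "q \<in> ?S H" "q \<noteq> pnt x" using H(2) by blast
                then obtain s where s: "sign_eq (rep H) (hom q)" "0 < s" "hom q - s *\<^sub>R u \<in> Vh i"
                  using section_avoids(1)[OF half_flat_dir H(1,2) i avi] by blast
                have "(1 / s) *\<^sub>R hom q \<in> slice (rep H) k v"
                  using slice_nonempty[OF sign_eq_imp_weak_conf[OF s(1)] s(2,3)] True vu by simp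
                moreover have "sign_eq (rep H) ((1 / s) *\<^sub>R hom q)" using s
                  by (simp add: sign_eq_scale)
                moreover have "(1 / s) *\<^sub>R hom q \<noteq> x"
                  using q(2) pnt_scale[of "1 / s" "hom q"] s(2) by auto
                ultimately show ?thesis by blast
              next
                case False
                then have ki: "k < i" using pH(1) by simp
                have "\<not> sign_eq (rep H) x" using H(5) False by simp
                then show ?thesis
                  using facet_meets_flag_direction[OF H(1) pH(7,3), of k v] min_data_Vh(2)[OF half_flat_dir H(1) i H(3) ki] ki iN pH(8) k0
                  by fastforce
              qed
              then show ?thesis using eventually_section_nonempty[OF pH(4) k1 kN H(1) av mv]
                by blast
            qed
            \<comment> \<open>Distinct facets are disjoint, so at most one of them contains the
              minimum point; the other has nonempty smaller sections.\<close>
            have neFG: "\<forall>\<^sub>F r in at_left ?c. F \<inter> cone (k - 1) (?w r) \<noteq> {}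
              \<or> G \<inter> cone (k - 1) (?w r) \<noteq> {}"
            proof (cases "sign_eq (rep F) x")
              case True
              have "\<not> sign_eq (rep G) x"
              proof
                assume "sign_eq (rep G) x"
                then have "pnt x \<in> F" "pnt x \<in> G" using True mem_facet_iff FG pF(3) sign_eq_pnt
                  by blast+
                then show False using facets_disjoint FG by blast
              qed
              then have "\<forall>\<^sub>F r in at_left ?c. G \<inter> cone (k - 1) (?w r) \<noteq> {}"
                using nonempty[OF FG(2) nG _ d(2)] dG same by simp
              then show ?thesis by (rule eventually_mono) blast
            next
              case False
              then have "\<forall>\<^sub>F r in at_left ?c. F \<inter> cone (k - 1) (?w r) \<noteq> {}"
                using nonempty[OF FG(1) nF dF d(1)] by simp
              then show ?thesis by (rule eventually_mono) blast
            qed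
            have "b \<or> b'"
            proof -
              have "\<forall>\<^sub>F r in at_left ?c. b \<or> b'"
                using b b' g neFG
              proof eventually_elim
                case (elim r)
                have "less (k - 1) (?w r) F G \<or> less (k - 1) (?w r) G F"
                  using conjunct2[OF less.IH[OF lt half_flat_dir_ang[OF elim(3) kN1]]] FG elim(4)
                    section_ang[OF elim(3) kN1] by metis
                then show ?case using elim(1,2) by simp
              qed
              then show ?thesis using eventually_happens'[OF trivial_limit_at_left_real] by blast
            qed
            moreover have "?R k x F G \<longleftrightarrow> b" "?R k x G F \<longleftrightarrow> b'"
              using recursion_constant[OF pF(4) k1 kN B b] recursion_constant[OF pF(4) k1 kN B b'] .
            ultimately show ?thesis using UFG UGF xy d k1 same by auto
          qed
        qed
      qed
    qed
  qed
qed

lemma polar_order_strict_linear: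
  assumes "half_flat_dir i th u"
  shows "strict_linear_order_on (section_facets A p e i th) (polar_order A p e i th)"
proof -
  note tt = polar_less_total_and_trans[OF assms]
  have in_order: "(S, T) \<in> polar_order A p e i th \<longleftrightarrow> (\<exists>F G. S = section_of p e i th F \<and> T
    = section_of p e i th G \<and>
      F \<in> facets A \<and> G \<in> facets A \<and> S \<noteq> {} \<and> T \<noteq> {} \<and> polar_less p e i th F G)" for S T
    by (auto simp: polar_order_def)
  have "trans (polar_order A p e i th)"
  proof (rule transI)
    fix S T U assume "(S, T) \<in> polar_order A p e i th" "(T, U) \<in> polar_order A p e i th"
    then obtain F G G' H where *: "F \<in> facets A" "G \<in> facets A" "G' \<in> facets A" "H \<in> facets A"
      "S = section_of p e i th F" "T = section_of p e i th G" "T = section_of p e i th G'"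
        "U = section_of p e i th H"
      "S \<noteq> {}" "T \<noteq> {}" "U \<noteq> {}" "polar_less p e i th F G" "polar_less p e i th G' H"
      unfolding in_order by blast
    have "G = G'" using section_eq_iff[OF *(2,3), of i th] *(6,7,10) by simp
    then have "polar_less p e i th F H" using conjunct1[OF tt] * by blast
    then show "(S, U) \<in> polar_order A p e i th" unfolding in_order using * by blast
  qed
  moreover have "irrefl (polar_order A p e i th)"
  proof (rule irreflI)
    fix S show "(S, S) \<notin> polar_order A p e i th"
    proof
      assume "(S, S) \<in> polar_order A p e i th"
      then obtain F G where *: "F \<in> facets A" "G \<in> facets A" "S = section_of p e i th F"
        "S = section_of p e i th G" "S \<noteq> {}" "polar_less p e i th F G" unfolding in_order by blast
      then have "F = G" using section_eq_iff[OF *(1,2), of i th] by simp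
      then show False using * polar_less_irrefl by blast
    qed
  qed
  moreover have "total_on (section_facets A p e i th) (polar_order A p e i th)"
  proof (rule total_onI)
    fix S T assume "S \<in> section_facets A p e i th" "T \<in> section_facets A p e i th" and ST: "S \<noteq> T"
    then obtain F G where *: "F \<in> facets A" "G \<in> facets A" "S = section_of p e i th F"
      "T = section_of p e i th G"
      "S \<noteq> {}" "T \<noteq> {}" by (auto simp: section_facets_def)
    then have "F \<noteq> G" using ST by blast
    then have "polar_less p e i th F G \<or> polar_less p e i th G F" using conjunct2[OF tt] * by blast
    then show "(S, T) \<in> polar_order A p e i th \<or> (T, S) \<in> polar_order A p e i th"
      unfolding in_order using * by blast
  qed
  ultimately show ?thesis by (simp add: strict_linear_order_on_def)
qed

section \<open>From angles in [0, \<delta>] to directions\<close>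

lemma half_flat_dir_top: "half_flat_dir CARD('n) th (eh CARD('n))"
  by (simp add: half_flat_dir_def eh_good_dirs)

text \<open>A point of the half-flat provides the direction: its coordinates from \<open>i\<close>
  on are kept and the others set to 0. Angles in [0, \<delta>] place it in
  \<open>sector_dirs\<close>.\<close>

lemma half_flat_dir_exists:
  assumes i: "i < CARD('n)" and th: "\<And>j. i \<le> j \<Longrightarrow> j < CARD('n) \<Longrightarrow> 0 \<le> th j \<and> (0 < j \<longrightarrow> th j \<le> \<delta>)"
    and ne: "half_flat p e i th \<noteq> {}"
  shows "\<exists>u. half_flat_dir i th u"
proof -
  let ?n = "CARD('n)"
  obtain q where q: "q \<in> half_flat p e i th" using ne by blast
  then have nf: "0 < i \<Longrightarrow> q \<notin> flag p e (i - 1)"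
    and "\<exists>t. is_polar p e q t \<and> (\<forall>j\<in>{i..<?n}. t j = th j)" using i by (auto simp: half_flat_def)
  then obtain t where t: "is_polar p e q t" and tj: "\<forall>j\<in>{i..<?n}. t j = th j" by blast
  have nV: "hom q \<notin> Vh i"
  proof (cases "i = 0")
    case True
    then show ?thesis using fst_hom[of q] by (auto simp: Vh_0 simp del: fst_hom)
  next
    case False
    then show ?thesis using nf by (simp add: flag_eq)
  qed
  have range: "0 \<le> t j" "t j \<le> \<delta>" if "1 \<le> j" "i \<le> j" "j < ?n" for j
    using th[of j] bspec[OF tj, of j] that by auto
  have sn: "0 \<le> sin (t j)" if "1 \<le> j" "j < ?n" for j
  proof (cases "i \<le> j")
    case True
    then show ?thesis using range[of j] that delta by (intro sin_ge_zero) auto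
  next
    case False
    then have "j + 2 \<le> ?n" using i by simp
    then have "0 \<le> t j \<and> t j \<le> pi" using t that by (auto simp: is_polar_def Let_def)
    then show ?thesis by (simp add: sin_ge_zero)
  qed
  define R where "R j = t 0 * (\<Prod>l\<in>{1..<j}. sin (t l))" for j
  have R0: "0 \<le> R j" if "j \<le> ?n" for j
    unfolding R_def using t sn that
      by (intro mult_nonneg_nonneg prod_nonneg) (auto simp: is_polar_def Let_def)
  have co: "hom q \<bullet> eh j = R j * (if j < ?n then cos (t j) else 1)" if "1 \<le> j" "j \<le> ?n" for j
    using t that by (auto simp: is_polar_def Let_def eh_pos R_def)
  \<comment> \<open>The angles from \<open>i\<close> on are at most \<delta> < pi/2 and have
    nonnegative sine and cosine, so the last nonzero coordinate cannot be negative.\<close>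
  have lp: "hom q \<in> lpos"
  proof -
    let ?S = "{k. k \<le> ?n \<and> hom q \<bullet> eh k \<noteq> 0}"
    have S: "finite ?S" "?S \<noteq> {}" using eh_0[of "hom q"] by auto
    define k where "k = Max ?S"
    have k: "k \<in> ?S" unfolding k_def by (rule Max_in[OF S])
    have kV: "hom q \<in> Vh (Suc k)"
    proof -
      have "l \<notin> ?S" if "Suc k \<le> l" for l using Max_ge[OF S(1), of l] that unfolding k_def
        by linarith
      then show ?thesis unfolding Vh_def by blast
    qed
    have ik: "i \<le> k"
    proof (rule ccontr)
      assume "\<not> i \<le> k"
      then have "hom q \<in> Vh i" using kV Vh_mono[of "Suc k" i] by auto
      then show False using nV by blast
    qed
    have "0 < hom q \<bullet> eh k"
    proof (cases "k = 0")
      case True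
      then show ?thesis by (simp add: eh_0)
    next
      case False
      have "0 \<le> hom q \<bullet> eh k"
      proof (cases "k < ?n")
        case True
        then have "0 \<le> cos (t k)" using range[of k] False ik delta by (intro cos_ge_zero) auto
        then show ?thesis using co[of k] R0[of k] k False True by simp
      next
        case n: False
        then show ?thesis using co[of k] R0[of k] k False by simp
      qed
      then show ?thesis using k by simp
    qed
    then show ?thesis using k kV by (auto simp: lpos_def)
  qed
  have ta: "t = ang (hom q)" using is_polar_unique[OF lp t] .
  obtain u where "\<forall>j\<le>?n. u \<bullet> eh j = (if i \<le> j then hom q \<bullet> eh j else 0)"
    using eh_coords[of "\<lambda>j. if i \<le> j then hom q \<bullet> eh j else 0"] by blast
  then have u: "u \<bullet> eh j = (if i \<le> j then hom q \<bullet> eh j else 0)" if "j \<le> ?n" for j using that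
    by blast
  have d: "hom q - u \<in> Vh i" using u by (simp add: Vh_def inner_diff_left)
  have "u \<in> sector_dirs i"
    unfolding sector_dirs_def
  proof (intro CollectI conjI impI allI)
    show "u \<in> Dh i" using u i by (simp add: Dh_def)
    show "u \<noteq> 0" using d nV by auto
    show "0 < fst u" if "i = 0" using u[of 0] that by (simp add: eh_0)
    show "0 \<le> u \<bullet> eh ?n" using u[of ?n] i lpos_top[OF lp] by simp
    fix j assume j: "1 \<le> j \<and> i \<le> j \<and> j < ?n"
    have "hom q - u \<in> Vh j" using d Vh_mono[of i j] j by auto
    then have T: "tail j u = tail j (hom q)" using tail_Vh by simp
    have "cos \<delta> \<le> cos (t j)" using range[of j] j delta by (intro cos_monotone_0_pi_le) auto
    then have "cos \<delta> * tail j (hom q) \<le> tail j (hom q) * cos (t j)"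
      using tail_nonneg[of j "hom q"] by (metis mult.commute mult_left_mono)
    then show "cos \<delta> * tail j u \<le> u \<bullet> eh j"
      using tail_mult_cos(1)[OF lp, of j] T u[of j] j ta by simp
  qed
  then have g: "u \<in> good_dirs i" using sector_dirs_good_dirs i by simp
  have "th j = ang u j" if "i \<le> j" "j < ?n" for j
  proof -
    have "hom q - u \<in> Vh j" using d Vh_mono[OF that(1)] by blast
    then have "ang (hom q) j = ang u j" by (rule ang_cong)
    then show ?thesis using bspec[OF tj, of j] that ta by simp
  qed
  then have "half_flat p e i th = cone i u" by (rule half_flat_ang[OF g i])
  then show ?thesis using g i unfolding half_flat_dir_def by blast
qed

lemma strict_linear_order_on_sections:
  assumes "i \<le> CARD('n)" "\<forall>j\<in>{i..<CARD('n)}. 0 \<le> th j \<and> (0 < j \<longrightarrow> th j \<le> \<delta>)"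
  shows "strict_linear_order_on (section_facets A p e i th) (polar_order A p e i th)"
proof (cases "half_flat p e i th = {}")
  case True
  \<comment> \<open>Angles that violate the convention on 0 and pi give an empty half-flat; there is
    then nothing to order.\<close>
  then have "section_of p e i th F = {}" for F by (simp add: section_of_def)
  then have "section_facets A p e i th = {}" "polar_order A p e i th = {}"
    by (auto simp: section_facets_def polar_order_def)
  then show ?thesis
    by (simp add: strict_linear_order_on_def trans_def irrefl_def total_on_def)
next
  case False
  have "\<exists>u. half_flat_dir i th u"
  proof (cases "i = CARD('n)")
    case True
    then show ?thesis using half_flat_dir_top by blast
  next
    case i: False
    then show ?thesis using half_flat_dir_exists[of i th] False assms by simp
  qed
  then show ?thesis using polar_order_strict_linear by blast
qed

lemma section_facets_top: "section_facets A p e CARD('n) th = facets A"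
proof -
  have "section_of p e CARD('n) th F = F" for F by (simp add: section_of_def half_flat_def)
  then show ?thesis using facets_nonempty by (auto simp: section_facets_def)
qed

end

theorem theorem3:
  fixes A :: "(real^'n) set set" and p :: "real^'n"
    and e :: "nat \<Rightarrow> real^'n" and \<delta> :: real
  assumes "arrangement A" and "essential A" and "generic_polar A p e \<delta>"
  shows "(\<forall>i\<le>CARD('n). \<forall>th :: nat \<Rightarrow> real.
            (\<forall>j\<in>{i..<CARD('n)}. 0 \<le> th j \<and> (0 < j \<longrightarrow> th j \<le> \<delta>)) \<longrightarrow>
            strict_linear_order_on (section_facets A p e i th) (polar_order A p e i th)) \<and>
         (\<forall>th. strict_linear_order_on (facets A) (polar_order A p e CARD('n) th))"
proof -
  interpret generic_arrangement p e A \<delta>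
    using assms by unfold_locales (auto simp: generic_polar_def)
  show ?thesis
    using strict_linear_order_on_sections polar_order_strict_linear[OF half_flat_dir_top]
    by (simp add: section_facets_top)
qed

end
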